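(* Let $d\ge 2$, $a,b>0$ and $\lambda=\frac{a}{2b}$. The square root velocity transform $$R:\mathcal I_0([0,1],\mathbb R^d)\to C^\infty([0,1],\mathbb R^d\setminus\{0\}),\qquad R(c)=\frac{c'}{\sqrt{|c'|}},$$ is an isometry of $\left(\mathcal I_0([0,1],\mathbb R^d),G^{a,b}\right)$ and $\left(C^\infty([0,1],\mathbb R^d\setminus\{0\}),4b^2\,G^{L^2_\lambda}\right)$. Furthermore, for each $c_0\in\mathcal I_0([0,1],\mathbb R^d)$ there exists a neighborhood $\mathcal U(c_0)$ such that for any $c_1\in\mathcal U(c_0)$ the geodesic distance of $G^{a,b}$ between $c_0$ and $c_1$ is $$\operatorname{dist}_{a,b}(c_0,c_1)=2b\sqrt{\ell_{c_0}+\ell_{c_1}-2\int_0^1\sqrt{|c_0'(u)|\,|c_1'(u)|}\,\cos\left(\tfrac{a}{2b}\theta(u)\right)du},$$ where $$\theta(u)=\cos^{-1}\left(\frac{R(c_0)(u)\cdot R(c_1)(u)}{|R(c_0)(u)|\,|R(c_1)(u)|}\right).$$ If $d\ge 3$, then the formula for the geodesic distance holds globally, i.e. for arbitrary $c_0,c_1\in\mathcal I_0([0,1],\mathbb R^d)$, after replacing the formula for $\theta$ by $$\theta(u)=\min\left(\cos^{-1}\left(\frac{R(c_0)(u)\cdot R(c_1)(u)}{|R(c_0)(u)|\,|R(c_1)(u)|}\right),\tfrac{2b\pi}{a}\right).$$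
   Context: $\mathcal I_0([0,1],\mathbb R^d)$ is the space of smooth curves $c\in C^\infty([0,1],\mathbb R^d)$ with $c'(u)\ne 0$ for all $u$ and $c(0)=0$ (it is identified with the space of smooth immersions modulo translations). It is an infinite-dimensional Fréchet manifold (with the $C^\infty$ topology); tangent vectors at $c$ are smooth vector fields $h:[0,1]\to\mathbb R^d$ along $c$ (modulo constants, equivalently with $h(0)=0$). $\cdot$ and $|\cdot|$ are the Euclidean inner product and norm, and $\ell_c=\int_0^1|c'|\,du$ is the length of $c$. For $a,b>0$ the elastic metric is the Riemannian metric $$G^{a,b}_c(h,k)=\int_0^1 \left[a^2\,(D_sh^\bot\cdot D_sk^\bot)+b^2\,(D_sh^\top\cdot D_sk^\top)\right]ds,$$ where $D_s=\frac1{|c'|}\frac{d}{du}$, $ds=|c'|\,du$, $D_sh^\top=\left(D_sh\cdot\frac{c'}{|c'|}\right)\frac{c'}{|c'|}$ and $D_sh^\bot=D_sh-D_sh^\top$. The geodesic distance of $G^{a,b}$ is $\operatorname{dist}_{a,b}(c_0,c_1)=\inf\int_0^1\sqrt{G^{a,b}_{c(t)}(\partial_tc(t),\partial_tc(t))}\,dt$, the infimum being over all paths $t\mapsto c(t)$ in $\mathcal I_0([0,1],\mathbb R^d)$ (piecewise smooth in $t$) from $c_0$ to $c_1$. For $\lambda>0$, $g^\lambda$ is the Riemannian metric on $\mathbb R^d\setminus\{0\}$ given, for $q\in\mathbb R^d\setminus\{0\}$ and $v,w\in T_q(\mathbb R^d\setminus\{0\})\cong\mathbb R^d$, by $g^\lambda_q(v,w)=\lambda^2(v^\bot\cdot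 w^\bot)+(v^\top\cdot w^\top)$, with $w^\top=\frac{w\cdot q}{q\cdot q}q$ and $w^\bot=w-w^\top$. It induces on $C^\infty([0,1],\mathbb R^d\setminus\{0\})$ the $L^2$-Riemannian metric $G^{L^2_\lambda}_q(q_1,q_2)=\int_0^1 g^\lambda_{q(u)}(q_1(u),q_2(u))\,du$, for $q_1,q_2\in C^\infty([0,1],\mathbb R^d)$ tangent vectors at $q$. "Isometry" means a diffeomorphism that pulls back the target Riemannian metric to the source Riemannian metric. *)

theory Defs
  imports "HOL-Analysis.Analysis"
begin

section \<open>The Frechet space of smooth maps on the unit interval\<close>

text \<open>Derivatives at the end points of the interval are one-sided.\<close>

definition smooth01 :: "(real \<Rightarrow> 'a::real_normed_vector) \<Rightarrow> bool" where
  "smooth01 f \<longleftrightarrow> (\<exists>D :: nat \<Rightarrow> real \<Rightarrow> 'a.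
     (\<forall>u\<in>{0..1}. D 0 u = f u) \<and>
     (\<forall>k. \<forall>u\<in>{0..1}. (D k has_vector_derivative D (Suc k) u) (at u within {0..1})))"

lemma smooth01_const: "smooth01 (\<lambda>u. c)"
  unfolding smooth01_def
  by (rule exI[of _ "\<lambda>k u. if k = 0 then c else 0"]) (auto intro: derivative_eq_intros)

lemma smooth01_add:
  assumes "smooth01 f" "smooth01 g" shows "smooth01 (\<lambda>u. f u + g u)"
proof -
  from assms obtain D E where
    "\<forall>u\<in>{0..1}. D 0 u = f u"
    "\<forall>k. \<forall>u\<in>{0..1}. (D k has_vector_derivative D (Suc k) u) (at u within {0..1})"
    "\<forall>u\<in>{0..1}. E 0 u = g u"
    "\<forall>k. \<forall>u\<in>{0..1}. (E k has_vector_derivative E (Suc k) u) (at u within {0..1})"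
    unfolding smooth01_def by metis
  then show ?thesis
    unfolding smooth01_def
    by (intro exI[of _ "\<lambda>k u. D k u + E k u"]) (auto intro: has_vector_derivative_add)
qed

lemma smooth01_scaleR:
  assumes "smooth01 f" shows "smooth01 (\<lambda>u. r *\<^sub>R f u)"
proof -
  from assms obtain D where
    "\<forall>u\<in>{0..1}. D 0 u = f u"
    "\<forall>k. \<forall>u\<in>{0..1}. (D k has_vector_derivative D (Suc k) u) (at u within {0..1})"
    unfolding smooth01_def by metis
  then show ?thesis
    unfolding smooth01_def
    by (intro exI[of _ "\<lambda>k u. r *\<^sub>R D k u"])
      (auto intro: bounded_linear.has_vector_derivative[OF bounded_linear_scaleR_right])
qed

lemma smooth01_vector_derivative:
  assumes "smooth01 f"
  shows "smooth01 (\<lambda>u. if u \<in> {0..1} then vector_derivative f (at u within {0..1}) else 0)"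
proof -
  from assms obtain D where
    D0: "\<forall>u\<in>{0..1}. D 0 u = f u" and
    D: "\<forall>k. \<forall>u\<in>{0..1}. (D k has_vector_derivative D (Suc k) u) (at u within {0..1})"
    unfolding smooth01_def by metis
  have "vector_derivative f (at u within {0..1}) = D (Suc 0) u" if "u \<in> {0..1}" for u
  proof (rule vector_derivative_within)
    show "(f has_vector_derivative D (Suc 0) u) (at u within {0..1})"
      by (rule has_vector_derivative_transform[OF that _ D[rule_format, of u 0, OF that]])
        (use D0 in auto)
    show "at u within {0..1} \<noteq> bot"
      using that by (simp add: trivial_limit_within islimpt_Icc)
  qed
  then show ?thesis
    unfolding smooth01_def using D by (intro exI[of _ "\<lambda>k u. D (Suc k) u"]) auto
qed

text \<open>
  An element of \<open>C\<^sup>\<infinity>([0,1], 'a)\<close> is represented by its extension by 0 to the real line,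
  so that equality in the type is equality on the unit interval. This extension is only a
  normalisation: nothing is required of it at the end points.
\<close>

typedef (overloaded) 'a smooth_map = "{f :: real \<Rightarrow> 'a::real_normed_vector.
    smooth01 f \<and> (\<forall>u. u \<notin> {0..1} \<longrightarrow> f u = 0)}"
  morphisms ev mk_smooth_map
  by (rule exI[of _ "\<lambda>_. 0"]) (simp add: smooth01_const)

setup_lifting type_definition_smooth_map

instantiation smooth_map :: (real_normed_vector) real_vector
begin

lift_definition zero_smooth_map :: "'a smooth_map" is "\<lambda>_. 0"
  by (simp add: smooth01_const)

lift_definition plus_smooth_map :: "'a smooth_map \<Rightarrow> 'a smooth_map \<Rightarrow> 'a smooth_map"
  is "\<lambda>f g u. f u + g u"
  by (simp add: smooth01_add)

lift_definition scaleR_smooth_map :: "real \<Rightarrow> 'a smooth_map \<Rightarrow> 'a smooth_map"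
  is "\<lambda>r f u. r *\<^sub>R f u"
  by (simp add: smooth01_scaleR)

lift_definition uminus_smooth_map :: "'a smooth_map \<Rightarrow> 'a smooth_map" is "\<lambda>f u. - f u"
  using smooth01_scaleR[where r = "-1"] by auto

lift_definition minus_smooth_map :: "'a smooth_map \<Rightarrow> 'a smooth_map \<Rightarrow> 'a smooth_map"
  is "\<lambda>f g u. f u - g u"
  using smooth01_add smooth01_scaleR[where r = "-1"] by fastforce

instance
  by standard (transfer, simp add: algebra_simps)+

end

lift_definition D\<^sub>u :: "'a::real_normed_vector smooth_map \<Rightarrow> 'a smooth_map"
  is "\<lambda>f u. if u \<in> {0..1} then vector_derivative f (at u within {0..1}) else 0"
  using smooth01_vector_derivative by auto

text \<open>
  The \<open>C\<^sup>\<infinity>\<close> topology: uniform convergence of all derivatives.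
\<close>

definition C_ball :: "nat \<Rightarrow> 'a::real_normed_vector smooth_map \<Rightarrow> real \<Rightarrow> 'a smooth_map set" where
  "C_ball k f \<epsilon> = {g. \<forall>j\<le>k. \<forall>u\<in>{0..1}. dist (ev ((D\<^sub>u ^^ j) f) u) (ev ((D\<^sub>u ^^ j) g) u) < \<epsilon>}"

lemma C_ball_mono: "k \<le> l \<Longrightarrow> \<epsilon> \<le> \<delta> \<Longrightarrow> C_ball l f \<epsilon> \<subseteq> C_ball k f \<delta>"
  unfolding C_ball_def by (blast intro: order_trans less_le_trans)

instantiation smooth_map :: (real_normed_vector) t2_space
begin

definition open_smooth_map :: "'a smooth_map set \<Rightarrow> bool" where
  "open_smooth_map U \<longleftrightarrow> (\<forall>f\<in>U. \<exists>k. \<exists>\<epsilon>>0. C_ball k f \<epsilon> \<subseteq> U)"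

instance
proof
  show "open (UNIV :: 'a smooth_map set)"
    by (auto simp: open_smooth_map_def intro: exI[of _ 1])
next
  fix S T :: "'a smooth_map set"
  assume S: "open S" and T: "open T"
  show "open (S \<inter> T)"
    unfolding open_smooth_map_def
  proof
    fix f assume "f \<in> S \<inter> T"
    with S T obtain k l \<epsilon> \<delta> where
      "\<epsilon> > 0" "C_ball k f \<epsilon> \<subseteq> S" "\<delta> > 0" "C_ball l f \<delta> \<subseteq> T"
      unfolding open_smooth_map_def by (metis IntD1 IntD2)
    moreover have "C_ball (max k l) f (min \<epsilon> \<delta>) \<subseteq> C_ball k f \<epsilon> \<inter> C_ball l f \<delta>"
      by (simp add: C_ball_mono)
    ultimately have "min \<epsilon> \<delta> > 0 \<and> C_ball (max k l) f (min \<epsilon> \<delta>) \<subseteq> S \<inter> T" by auto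
    then show "\<exists>k. \<exists>\<epsilon>>0. C_ball k f \<epsilon> \<subseteq> S \<inter> T" by blast
  qed
next
  fix K :: "'a smooth_map set set"
  assume "\<forall>S\<in>K. open S"
  then show "open (\<Union>K)" unfolding open_smooth_map_def by (meson Union_iff Union_upper subset_trans)
next
  fix f g :: "'a smooth_map"
  assume "f \<noteq> g"
  then have "ev f \<noteq> ev g" by (simp add: ev_inject)
  then obtain u where u: "ev f u \<noteq> ev g u" by auto
  then have u01: "u \<in> {0..1}" using ev[of f] ev[of g] by fastforce
  define B where "B p r = {h :: 'a smooth_map. dist (ev p u) (ev h u) < r}" for p r
  have B: "open (B p r)" for p r
    unfolding open_smooth_map_def
  proof
    fix h assume "h \<in> B p r"
    then have "r - dist (ev p u) (ev h u) > 0" by (simp add: B_def)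
    moreover have "C_ball 0 h (r - dist (ev p u) (ev h u)) \<subseteq> B p r"
    proof
      fix g assume "g \<in> C_ball 0 h (r - dist (ev p u) (ev h u))"
      with u01 have "dist (ev h u) (ev g u) < r - dist (ev p u) (ev h u)"
        by (simp add: C_ball_def)
      then show "g \<in> B p r"
        using dist_triangle[of "ev p u" "ev g u" "ev h u"] by (simp add: B_def)
    qed
    ultimately show "\<exists>k. \<exists>\<epsilon>>0. C_ball k h \<epsilon> \<subseteq> B p r" by blast
  qed
  define r where "r = dist (ev f u) (ev g u) / 2"
  have "r > 0" using u by (simp add: r_def)
  then have "f \<in> B f r" "g \<in> B g r" by (simp_all add: B_def)
  moreover have "B f r \<inter> B g r = {}"
  proof (rule equals0I)
    fix h assume "h \<in> B f r \<inter> B g r"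
    then have "dist (ev f u) (ev h u) < r" "dist (ev g u) (ev h u) < r" by (simp_all add: B_def)
    then show False
      using dist_triangle2[of "ev f u" "ev g u" "ev h u"] by (simp add: r_def)
  qed
  ultimately show "\<exists>U V. open U \<and> open V \<and> f \<in> U \<and> g \<in> V \<and> U \<inter> V = {}"
    using B[of f r] B[of g r] by (intro exI[of _ "B f r"] exI[of _ "B g r"] conjI)
qed

end

section \<open>Calculus in Frechet spaces\<close>

text \<open>
  A manifold is given here by a relatively open subset \<open>U\<close> of a model space, the model space
  being a closed linear subspace \<open>V\<close> of the ambient type; \<open>V\<close> is the tangent space at every
  point of \<open>U\<close>.

  Smoothness is in the sense of Michal--Bastiani and Hamilton: the iterated directional
  derivatives \<open>D k x (h 0, ..., h (k-1))\<close> exist and are jointly continuous in the point and the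
  directions. The directions are collected in a sequence with the product topology, of which
  \<open>D k\<close> only sees the first \<open>k\<close> entries (the limits below force this).
\<close>

definition frechet_smooth ::
  "'e::{real_vector,topological_space} set \<Rightarrow> 'e set \<Rightarrow> ('e \<Rightarrow> 'f::{real_vector,topological_space}) \<Rightarrow> bool"
where
  "frechet_smooth V U F \<longleftrightarrow> openin (top_of_set V) U \<and>
     (\<exists>D :: nat \<Rightarrow> 'e \<Rightarrow> (nat \<Rightarrow> 'e) \<Rightarrow> 'f.
        (\<forall>x\<in>U. \<forall>h. range h \<subseteq> V \<longrightarrow> D 0 x h = F x) \<and>
        (\<forall>k. \<forall>x\<in>U. \<forall>h. range h \<subseteq> V \<longrightarrow>
           ((\<lambda>t::real. (D k (x + t *\<^sub>R h k) h - D k x h) /\<^sub>R t) \<longlongrightarrow> D (Suc k) x h) (at 0)) \<and>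
        (\<forall>k. continuous_on (U \<times> {h. range h \<subseteq> V}) (\<lambda>(x, h). D k x h)))"

definition dir_deriv ::
  "('e::real_vector \<Rightarrow> 'f::{real_vector,t2_space}) \<Rightarrow> 'e \<Rightarrow> 'e \<Rightarrow> 'f"
where
  "dir_deriv F x h = Lim (at 0) (\<lambda>t::real. (F (x + t *\<^sub>R h) - F x) /\<^sub>R t)"

definition frechet_diffeo ::
  "'e::{real_vector,topological_space} set \<Rightarrow> 'e set \<Rightarrow>
   'f::{real_vector,topological_space} set \<Rightarrow> 'f set \<Rightarrow> ('e \<Rightarrow> 'f) \<Rightarrow> bool"
where
  "frechet_diffeo V U V' U' F \<longleftrightarrow>
     bij_betw F U U' \<and> frechet_smooth V U F \<and> frechet_smooth V' U' (inv_into U F)"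

definition riemannian_isometry ::
  "'e::{real_vector,topological_space} set \<Rightarrow> 'e set \<Rightarrow> ('e \<Rightarrow> 'e \<Rightarrow> 'e \<Rightarrow> real) \<Rightarrow>
   'f::{real_vector,t2_space} set \<Rightarrow> 'f set \<Rightarrow> ('f \<Rightarrow> 'f \<Rightarrow> 'f \<Rightarrow> real) \<Rightarrow> ('e \<Rightarrow> 'f) \<Rightarrow> bool"
where
  "riemannian_isometry V U G V' U' G' F \<longleftrightarrow>
     frechet_diffeo V U V' U' F \<and>
     (\<forall>x\<in>U. \<forall>h\<in>V. \<forall>k\<in>V. G x h k = G' (F x) (dir_deriv F x h) (dir_deriv F x k))"

definition smooth_path_on ::
  "real set \<Rightarrow> (real \<Rightarrow> 'e::{real_vector,topological_space}) \<Rightarrow> bool"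
where
  "smooth_path_on S \<gamma> \<longleftrightarrow> (\<exists>D :: nat \<Rightarrow> real \<Rightarrow> 'e.
     (\<forall>t\<in>S. D 0 t = \<gamma> t) \<and>
     (\<forall>k. \<forall>t\<in>S. ((\<lambda>s. (D k s - D k t) /\<^sub>R (s - t)) \<longlongrightarrow> D (Suc k) t) (at t within S)))"

text \<open>Continuity at the break points is automatic, since the closed pieces share them.\<close>

definition piecewise_smooth_path :: "(real \<Rightarrow> 'e::{real_vector,topological_space}) \<Rightarrow> bool" where
  "piecewise_smooth_path \<gamma> \<longleftrightarrow> (\<exists>(n::nat) (\<tau> :: nat \<Rightarrow> real).
     \<tau> 0 = 0 \<and> \<tau> n = 1 \<and>
     (\<forall>i<n. \<tau> i < \<tau> (Suc i) \<and> smooth_path_on {\<tau> i..\<tau> (Suc i)} \<gamma>))"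

definition velocity :: "(real \<Rightarrow> 'e::{real_vector,t2_space}) \<Rightarrow> real \<Rightarrow> 'e" where
  "velocity \<gamma> t = Lim (at t within {0..1}) (\<lambda>s. (\<gamma> s - \<gamma> t) /\<^sub>R (s - t))"

text \<open>The velocity is unspecified at the finitely many break points, which the integral ignores.\<close>

definition path_length ::
  "('e \<Rightarrow> 'e \<Rightarrow> 'e \<Rightarrow> real) \<Rightarrow> (real \<Rightarrow> 'e::{real_vector,t2_space}) \<Rightarrow> real"
where
  "path_length G \<gamma> = integral {0..1} (\<lambda>t. sqrt (G (\<gamma> t) (velocity \<gamma> t) (velocity \<gamma> t)))"

definition geodesic_dist ::
  "'e::{real_vector,t2_space} set \<Rightarrow> ('e \<Rightarrow> 'e \<Rightarrow> 'e \<Rightarrow> real) \<Rightarrow> 'e \<Rightarrow> 'e \<Rightarrow> ereal"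
where
  "geodesic_dist U G x y =
     (INF \<gamma> \<in> {\<gamma>. piecewise_smooth_path \<gamma> \<and> (\<forall>t\<in>{0..1}. \<gamma> t \<in> U) \<and> \<gamma> 0 = x \<and> \<gamma> 1 = y}.
        ereal (path_length G \<gamma>))"

section \<open>Elastic metrics\<close>

definition based_maps :: "'a::real_normed_vector smooth_map set" where
  "based_maps = {h. ev h 0 = 0}"

definition immersions0 :: "'a::real_normed_vector smooth_map set" where
  "immersions0 = {c. ev c 0 = 0 \<and> (\<forall>u\<in>{0..1}. ev (D\<^sub>u c) u \<noteq> 0)}"

definition nonvanishing_maps :: "'a::real_normed_vector smooth_map set" where
  "nonvanishing_maps = {q. \<forall>u\<in>{0..1}. ev q u \<noteq> 0}"

definition curve_length :: "'a::real_normed_vector smooth_map \<Rightarrow> real" where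
  "curve_length c = integral {0..1} (\<lambda>u. norm (ev (D\<^sub>u c) u))"

definition D\<^sub>s :: "'a::real_normed_vector smooth_map \<Rightarrow> 'a smooth_map \<Rightarrow> real \<Rightarrow> 'a" where
  "D\<^sub>s c h u = ev (D\<^sub>u h) u /\<^sub>R norm (ev (D\<^sub>u c) u)"

definition D\<^sub>s_tan :: "'a::real_inner smooth_map \<Rightarrow> 'a smooth_map \<Rightarrow> real \<Rightarrow> 'a" where
  "D\<^sub>s_tan c h u =
     (D\<^sub>s c h u \<bullet> (ev (D\<^sub>u c) u /\<^sub>R norm (ev (D\<^sub>u c) u))) *\<^sub>R (ev (D\<^sub>u c) u /\<^sub>R norm (ev (D\<^sub>u c) u))"

definition D\<^sub>s_perp :: "'a::real_inner smooth_map \<Rightarrow> 'a smooth_map \<Rightarrow> real \<Rightarrow> 'a" where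
  "D\<^sub>s_perp c h u = D\<^sub>s c h u - D\<^sub>s_tan c h u"

text \<open>The last factor is the arc length element \<open>ds = |c'| du\<close>.\<close>

definition elastic_metric ::
  "real \<Rightarrow> real \<Rightarrow> 'a::real_inner smooth_map \<Rightarrow> 'a smooth_map \<Rightarrow> 'a smooth_map \<Rightarrow> real"
where
  "elastic_metric a b c h k = integral {0..1} (\<lambda>u.
     (a\<^sup>2 * (D\<^sub>s_perp c h u \<bullet> D\<^sub>s_perp c k u) + b\<^sup>2 * (D\<^sub>s_tan c h u \<bullet> D\<^sub>s_tan c k u))
       * norm (ev (D\<^sub>u c) u))"

definition radial_part :: "'a::real_inner \<Rightarrow> 'a \<Rightarrow> 'a" where
  "radial_part q w = ((w \<bullet> q) / (q \<bullet> q)) *\<^sub>R q"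

definition cone_metric :: "real \<Rightarrow> 'a::real_inner \<Rightarrow> 'a \<Rightarrow> 'a \<Rightarrow> real" where
  "cone_metric lam q v w =
     lam\<^sup>2 * ((v - radial_part q v) \<bullet> (w - radial_part q w)) + radial_part q v \<bullet> radial_part q w"

definition L2_metric ::
  "real \<Rightarrow> 'a::real_inner smooth_map \<Rightarrow> 'a smooth_map \<Rightarrow> 'a smooth_map \<Rightarrow> real"
where
  "L2_metric lam q h k = integral {0..1} (\<lambda>u. cone_metric lam (ev q u) (ev h u) (ev k u))"

text \<open>
  Off the unit interval \<open>D\<^sub>u c\<close> is 0, so the function below is 0 there, as \<open>mk_smooth_map\<close>
  requires.
\<close>

definition SRVT :: "'a::real_normed_vector smooth_map \<Rightarrow> 'a smooth_map" where
  "SRVT c = mk_smooth_map (\<lambda>u. ev (D\<^sub>u c) u /\<^sub>R sqrt (norm (ev (D\<^sub>u c) u)))"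

definition srv_angle :: "'a::real_inner smooth_map \<Rightarrow> 'a smooth_map \<Rightarrow> real \<Rightarrow> real" where
  "srv_angle c0 c1 u =
     arccos ((ev (SRVT c0) u \<bullet> ev (SRVT c1) u) / (norm (ev (SRVT c0) u) * norm (ev (SRVT c1) u)))"

end

theory Submission
  imports Defs
begin

text \<open>
  In the coordinates \<open>v = c'\<close> the elastic metric has no derivatives of \<open>v\<close>: it is the \<open>L\<^sup>2\<close> metric of a cone metric on
  \<open>\<real>\<^sup>d - {0}\<close>, and the transform \<open>v \<mapsto> v / |v|\<^sup>1\<^sup>/\<^sup>2\<close> is a pointwise diffeomorphism.
  The distance of the cone is explicit, by the law of cosines with angle \<open>min(lam \<theta>, \<pi>)\<close>. Let \<open>D\<close> be the \<open>L\<^sup>2\<close> distance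
  built from it. The triangle inequality for \<open>D\<close> (Minkowski) and its infinitesimal comparison with the metric show that no
  path is shorter than \<open>D\<close>. Conversely, if \<open>c\<^sub>0'\<close> and \<open>c\<^sub>1'\<close> are nowhere antiparallel, subdividing pointwise almost geodesics
  of the cone and approximating them by polynomials gives a chain of curves, and the polygon in the linear space of
  curves through this chain is almost as short as \<open>D\<close>. Nearby curves are nowhere antiparallel, and for \<open>d \<ge> 3\<close> a small
  translation of \<open>c\<^sub>1'\<close> makes them so, since a two-dimensional family of directions is a null set.
\<close>

section \<open>Limits and derivatives of smooth maps\<close>

text \<open>With the radius \<open>r = sqrt |v|\<close>, the tangential term
  \<open>b^2 (d|v|)^2 / |v|\<close> is \<open>4 b^2 dr^2\<close> and the normal term is
  \<open>a^2 r^2 (d angle)^2\<close>, so the metric is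
  \<open>4 b^2 (dr^2 + lam^2 r^2 (d angle)^2)\<close>. This is the origin of the square root, of
  \<open>lam = a / (2 * b)\<close> and of the factor \<open>2 * b\<close>. The angle is cut off at
  \<open>pi\<close> because from there on the shortest connection runs through the vertex; the
  vertex is missing, so the infimum need not be attained and only almost minimizing paths are built.
  Two obstacles shape the upper bound. The length of a path of curves is not the integral over
  \<open>u\<close> of pointwise lengths; squares do integrate. So \<open>N\<close> times the sum of
  the squared distances of \<open>N\<close> consecutive points is controlled pointwise and
  integrated, and the Cauchy-Schwarz inequality passes to lengths only at the end. Moreover the
  minimizing path between two vectors depends discontinuously on them where they are antiparallel,
  since no plane is singled out there. In the plane, a direction that turns past the opposite one
  cannot be freed from this by a small translation.\<close>

lemma ev_in: "smooth01 (ev f)" "u \<notin> {0..1} \<Longrightarrow> ev f u = 0"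
  using ev[of f] by auto

lemma sm_eqI: "(\<And>u. u \<in> {0..1} \<Longrightarrow> ev f u = ev g u) \<Longrightarrow> f = g"
  by (metis ev_inject ev_in(2) ext)

lemma at_within_01: "u \<in> {0..1} \<Longrightarrow> at u within {0..1::real} \<noteq> bot"
  by (simp add: trivial_limit_within islimpt_Icc)

lemma ev_D\<^sub>u:
  assumes "u \<in> {0..1}"
  shows "(ev f has_vector_derivative ev (D\<^sub>u f) u) (at u within {0..1})"
proof -
  obtain D where D0: "\<forall>u\<in>{0..1}. D 0 u = ev f u" and
    D: "\<forall>k. \<forall>u\<in>{0..1}. (D k has_vector_derivative D (Suc k) u) (at u within {0..1})"
    using ev_in(1)[of f] unfolding smooth01_def by blast
  have "(ev f has_vector_derivative D (Suc 0) u) (at u within {0..1})"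
    by (rule has_vector_derivative_transform[OF assms _ D[rule_format, of u 0, OF assms]])
      (use D0 in auto)
  then have "(ev f has_vector_derivative vector_derivative (ev f) (at u within {0..1})) (at u within {0..1})"
    using vector_derivative_works differentiableI_vector by blast
  then show ?thesis using assms by (simp add: D\<^sub>u.rep_eq)
qed

lemma vector_derivative_unique_01:
  fixes f :: "real \<Rightarrow> 'a::real_normed_vector"
  assumes "u \<in> {0..1}" "(f has_vector_derivative a) (at u within {0..1})"
    "(f has_vector_derivative b) (at u within {0..1})"
  shows "a = b"
  using vector_derivative_unique_within[OF at_within_01[OF assms(1)] assms(2,3)] .

lemma D\<^sub>u_eqI:
  assumes "\<And>u. u \<in> {0..1} \<Longrightarrow> (ev f has_vector_derivative ev g u) (at u within {0..1})"
  shows "D\<^sub>u f = g"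
  using assms ev_D\<^sub>u vector_derivative_unique_01 by (blast intro: sm_eqI)

lemma continuous_ev [continuous_intros]: "S \<subseteq> {0..1} \<Longrightarrow> continuous_on S (ev f)"
  by (meson continuous_on_subset continuous_on_vector_derivative ev_D\<^sub>u)

lemma bounded_ev: "bounded (ev f ` {0..1})"
  by (intro compact_imp_bounded compact_continuous_image continuous_intros) auto

section \<open>Smoothness order by order, and closure under products and powers of the norm\<close>

text \<open>\<open>smooth01\<close> asks for all derivatives at once. Grading by the order makes
  closure properties provable by induction, with no formula for higher derivatives.\<close>

primrec Ck :: "nat \<Rightarrow> (real \<Rightarrow> 'a::real_normed_vector) \<Rightarrow> bool" where
  "Ck 0 f = continuous_on {0..1} f"
| "Ck (Suc k) f = (\<exists>f'. (\<forall>u\<in>{0..1}. (f has_vector_derivative f' u) (at u within {0..1})) \<and> Ck k f')"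

lemma Ck_cong:
  assumes "Ck k f" "\<And>u. u \<in> {0..1} \<Longrightarrow> f u = g u"
  shows "Ck k g"
proof (cases k)
  case 0
  then show ?thesis using assms continuous_on_cong[of "{0..1}" "{0..1}" f g] by simp
next
  case (Suc m)
  then obtain f' where f': "\<forall>u\<in>{0..1}. (f has_vector_derivative f' u) (at u within {0..1})" "Ck m f'"
    using assms by auto
  have "\<forall>u\<in>{0..1}. (g has_vector_derivative f' u) (at u within {0..1})"
    using f'(1) assms(2) has_vector_derivative_transform by metis
  then show ?thesis using f'(2) Suc by auto
qed

lemma Ck_Suc_Ck: "Ck (Suc k) f \<Longrightarrow> Ck k f"
  by (induction k arbitrary: f) (auto intro: continuous_on_vector_derivative)

text \<open>The derivatives hidden in \<open>Ck k\<close> for different \<open>k\<close> coincide,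
  because derivatives within the interval are unique. Hence iterating one canonical derivative
  \<open>d\<close> yields the single sequence that \<open>smooth01\<close> demands.\<close>

lemma smooth01_iff_Ck: "smooth01 f \<longleftrightarrow> (\<forall>k. Ck k f)"
proof
  assume "smooth01 f"
  then obtain D where D0: "\<forall>u\<in>{0..1}. D 0 u = f u" and
    D: "\<forall>k. \<forall>u\<in>{0..1}. (D k has_vector_derivative D (Suc k) u) (at u within {0..1})"
    unfolding smooth01_def by blast
  have "Ck k (D n)" for k n
  proof (induction k arbitrary: n)
    case 0
    then show ?case using D by (auto intro: continuous_on_vector_derivative)
  next
    case (Suc k)
    then show ?case using D by auto
  qed
  then show "\<forall>k. Ck k f" using D0 Ck_cong by blast
next
  assume f: "\<forall>k. Ck k f"
  define d where "d g = (\<lambda>u. vector_derivative g (at u within {0..1}))" for g :: "real \<Rightarrow> 'a"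
  have step: "(\<forall>u\<in>{0..1}. (g has_vector_derivative d g u) (at u within {0..1})) \<and> (\<forall>k. Ck k (d g))"
    if g: "\<forall>k. Ck k g" for g
  proof -
    have *: "\<exists>g'. (\<forall>u\<in>{0..1}. (g has_vector_derivative g' u) (at u within {0..1})) \<and> Ck k g'" for k
      using g[rule_format, of "Suc k"] by simp
    then have 1: "\<forall>u\<in>{0..1}. (g has_vector_derivative d g u) (at u within {0..1})"
      unfolding d_def using vector_derivative_works differentiableI_vector by blast
    have "Ck k (d g)" for k
      using *[of k] 1 vector_derivative_unique_01 Ck_cong by metis
    with 1 show ?thesis by blast
  qed
  have "\<forall>k. Ck k ((d ^^ n) f)" for n
    by (induction n) (use f step in auto)
  then show "smooth01 f"
    unfolding smooth01_def using step by (intro exI[of _ "\<lambda>k. (d ^^ k) f"]) auto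
qed

lemma Ck_ev: "Ck k (ev f)"
  using ev_in(1) smooth01_iff_Ck by blast

lemma Ck_add: "Ck k f \<Longrightarrow> Ck k g \<Longrightarrow> Ck k (\<lambda>u. f u + g u)"
proof (induction k arbitrary: f g)
  case (Suc k)
  then obtain f' g' where
    "\<forall>u\<in>{0..1}. (f has_vector_derivative f' u) (at u within {0..1})" "Ck k f'"
    "\<forall>u\<in>{0..1}. (g has_vector_derivative g' u) (at u within {0..1})" "Ck k g'" by auto
  then show ?case
    using Suc.IH by (auto intro!: exI[of _ "\<lambda>u. f' u + g' u"] has_vector_derivative_add)
qed (auto intro: continuous_intros)

lemma Ck_bilinear:
  assumes B: "bounded_bilinear B"
  shows "Ck k f \<Longrightarrow> Ck k g \<Longrightarrow> Ck k (\<lambda>u. B (f u) (g u))"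
proof (induction k arbitrary: f g)
  case 0
  then show ?case using bounded_bilinear.continuous_on[OF B] by auto
next
  case (Suc k)
  then obtain f' g' where
    "\<forall>u\<in>{0..1}. (f has_vector_derivative f' u) (at u within {0..1})" "Ck k f'"
    "\<forall>u\<in>{0..1}. (g has_vector_derivative g' u) (at u within {0..1})" "Ck k g'" by auto
  moreover have "Ck k (\<lambda>u. B (f u) (g' u) + B (f' u) (g u))"
    using Suc.IH calculation(2,4) Ck_Suc_Ck[OF Suc.prems(1)] Ck_Suc_Ck[OF Suc.prems(2)] by (intro Ck_add) blast+
  moreover have "\<forall>u\<in>{0..1}. ((\<lambda>u. B (f u) (g u)) has_vector_derivative
      B (f u) (g' u) + B (f' u) (g u)) (at u within {0..1})"
    using bounded_bilinear.has_vector_derivative[OF B] calculation(1,3) by blast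
  ultimately show ?case
    unfolding Ck.simps by (intro exI[of _ "\<lambda>u. B (f u) (g' u) + B (f' u) (g u)"]) simp
qed

text \<open>The norm is not differentiated itself: \<open>norm x powr p\<close> is the power
  \<open>p/2\<close> of the quadratic function \<open>x \<bullet> x\<close>, which is positive at
  \<open>v u\<close>.\<close>

lemma has_vector_derivative_norm_powr:
  fixes v :: "real \<Rightarrow> 'a::real_inner"
  assumes "(v has_vector_derivative v') (at u within S)" "v u \<noteq> 0"
  shows "((\<lambda>u. norm (v u) powr p) has_vector_derivative
          p * (norm (v u) powr (p - 2) * (v u \<bullet> v'))) (at u within S)"
proof -
  have eq: "norm x powr p = (x \<bullet> x) powr (p/2)" for x :: 'a and p
    by (simp add: norm_eq_sqrt_inner powr_half_sqrt[symmetric] powr_powr)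
  have 1: "((\<lambda>u. v u \<bullet> v u) has_field_derivative 2 * (v u \<bullet> v')) (at u within S)"
    using bounded_bilinear.has_vector_derivative[OF bounded_bilinear_inner assms(1) assms(1)]
    by (simp add: has_real_derivative_iff_has_vector_derivative inner_commute)
  have "((\<lambda>u. (v u \<bullet> v u) powr (p/2)) has_field_derivative
         (p/2) * (v u \<bullet> v u) powr (p/2 - 1) * (2 * (v u \<bullet> v'))) (at u within S)"
    using assms(2) by (intro DERIV_chain'[OF 1] has_real_derivative_powr) simp
  then show ?thesis
    unfolding eq has_real_derivative_iff_has_vector_derivative by (simp add: diff_divide_distrib algebra_simps)
qed

lemma Ck_norm_powr:
  fixes v :: "real \<Rightarrow> 'a::real_inner"
  assumes "\<And>u. u \<in> {0..1} \<Longrightarrow> v u \<noteq> 0"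
  shows "Ck k v \<Longrightarrow> Ck k (\<lambda>u. norm (v u) powr p)"
proof (induction k arbitrary: p)
  case 0
  then show ?case using assms by (auto intro!: continuous_intros)
next
  case (Suc k)
  then obtain v' where v': "\<forall>u\<in>{0..1}. (v has_vector_derivative v' u) (at u within {0..1})" "Ck k v'" by auto
  have "Ck k (\<lambda>u. p * (norm (v u) powr (p - 2) * (v u \<bullet> v' u)))"
    using Suc.IH Ck_Suc_Ck[OF Suc.prems] v'(2)
    by (intro Ck_bilinear[OF bounded_bilinear_mult] Ck_bilinear[OF bounded_bilinear_inner])
      (use smooth01_const smooth01_iff_Ck in auto)
  moreover have "\<forall>u\<in>{0..1}. ((\<lambda>u. norm (v u) powr p) has_vector_derivative
      p * (norm (v u) powr (p - 2) * (v u \<bullet> v' u))) (at u within {0..1})"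
    using v'(1) assms has_vector_derivative_norm_powr by blast
  ultimately show ?case
    unfolding Ck.simps by (intro exI[of _ "\<lambda>u. p * (norm (v u) powr (p - 2) * (v u \<bullet> v' u))"]) simp
qed

text \<open>Multiplication of real functions, scaling of vector fields and inner products are all
  instances, so the product rule and the limit theorems are proved once, for a bounded bilinear
  \<open>B\<close>.\<close>

definition pointwise :: "('a::real_normed_vector \<Rightarrow> 'b::real_normed_vector \<Rightarrow> 'c::real_normed_vector) \<Rightarrow>
    'a smooth_map \<Rightarrow> 'b smooth_map \<Rightarrow> 'c smooth_map" where
  "pointwise B f g = mk_smooth_map (\<lambda>u. B (ev f u) (ev g u))"

lemma ev_mk: "smooth01 f \<Longrightarrow> (\<And>u. u \<notin> {0..1} \<Longrightarrow> f u = 0) \<Longrightarrow> ev (mk_smooth_map f) = f"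
  by (simp add: mk_smooth_map_inverse)

lemma ev_sbil: "bounded_bilinear B \<Longrightarrow> ev (pointwise B f g) u = B (ev f u) (ev g u)"
  unfolding pointwise_def
  by (subst ev_mk) (auto simp: smooth01_iff_Ck Ck_ev ev_in(2) bounded_bilinear.zero_left intro: Ck_bilinear)

text \<open>The extension by 0 outside the unit interval is respected even for negative
  \<open>p\<close>, because \<open>0 powr p = 0\<close>.\<close>

definition npow :: "real \<Rightarrow> 'a::real_inner smooth_map \<Rightarrow> real smooth_map" where
  "npow p v = mk_smooth_map (\<lambda>u. norm (ev v u) powr p)"

lemma ev_npow:
  assumes "v \<in> nonvanishing_maps"
  shows "ev (npow p v) u = norm (ev v u) powr p"
  unfolding npow_def using assms
  by (subst ev_mk) (auto simp: smooth01_iff_Ck nonvanishing_maps_def ev_in(2) intro!: Ck_norm_powr Ck_ev)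

lemma ev_simps [simp]:
  "ev (f + g) u = ev f u + ev g u" "ev (f - g) u = ev f u - ev g u" "ev (r *\<^sub>R f) u = r *\<^sub>R ev f u"
  "ev 0 u = 0" "ev (- f) u = - ev f u"
  by (simp_all add: plus_smooth_map.rep_eq minus_smooth_map.rep_eq scaleR_smooth_map.rep_eq
      zero_smooth_map.rep_eq uminus_smooth_map.rep_eq)

lemma ev_simps_fun:
  "ev (f + g) = (\<lambda>u. ev f u + ev g u)" "ev (f - g) = (\<lambda>u. ev f u - ev g u)"
  "ev (r *\<^sub>R f) = (\<lambda>u. r *\<^sub>R ev f u)" "ev 0 = (\<lambda>u. 0)"
  by auto

lemma D\<^sub>u_add: "D\<^sub>u (f + g) = D\<^sub>u f + D\<^sub>u g"
  by (rule D\<^sub>u_eqI) (auto simp: ev_simps_fun intro!: derivative_intros ev_D\<^sub>u)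

lemma D\<^sub>u_diff: "D\<^sub>u (f - g) = D\<^sub>u f - D\<^sub>u g"
  by (rule D\<^sub>u_eqI) (auto simp: ev_simps_fun intro!: derivative_intros ev_D\<^sub>u)

lemma D\<^sub>u_scaleR: "D\<^sub>u (r *\<^sub>R f) = r *\<^sub>R D\<^sub>u f"
  by (rule D\<^sub>u_eqI)
    (auto simp: ev_simps_fun intro!: bounded_linear.has_vector_derivative[OF bounded_linear_scaleR_right] ev_D\<^sub>u)

lemma D\<^sub>u_sbil:
  assumes "bounded_bilinear B"
  shows "D\<^sub>u (pointwise B f g) = pointwise B f (D\<^sub>u g) + pointwise B (D\<^sub>u f) g"
proof (rule D\<^sub>u_eqI)
  fix u :: real assume u: "u \<in> {0..1}"
  have "ev (pointwise B f g) = (\<lambda>u. B (ev f u) (ev g u))" using ev_sbil[OF assms] by blast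
  then show "(ev (pointwise B f g) has_vector_derivative ev (pointwise B f (D\<^sub>u g) + pointwise B (D\<^sub>u f) g) u) (at u within {0..1})"
    using bounded_bilinear.has_vector_derivative[OF assms ev_D\<^sub>u[OF u, of f] ev_D\<^sub>u[OF u, of g]]
    by (simp add: ev_sbil[OF assms])
qed

lemma D\<^sub>u_npow:
  assumes "v \<in> nonvanishing_maps"
  shows "D\<^sub>u (npow p v) = p *\<^sub>R pointwise (*) (npow (p - 2) v) (pointwise (\<bullet>) v (D\<^sub>u v))"
proof (rule D\<^sub>u_eqI)
  fix u :: real assume u: "u \<in> {0..1}"
  then have "ev v u \<noteq> 0" using assms by (auto simp: nonvanishing_maps_def)
  moreover have "ev (npow p v) = (\<lambda>u. norm (ev v u) powr p)" using ev_npow[OF assms] by blast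
  ultimately show "(ev (npow p v) has_vector_derivative
      ev (p *\<^sub>R pointwise (*) (npow (p - 2) v) (pointwise (\<bullet>) v (D\<^sub>u v))) u) (at u within {0..1})"
    using has_vector_derivative_norm_powr[OF ev_D\<^sub>u[OF u, of v], of p]
    by (simp add: ev_sbil bounded_bilinear_mult bounded_bilinear_inner ev_npow[OF assms])
qed

section \<open>Convergence at a fixed order of differentiation\<close>

text \<open>Convergence in one seminorm of the topology. With the order fixed, limit theorems follow
  by induction: \<open>Ck_lim_Suc\<close> trades one order for one application of
  \<open>D\<^sub>u\<close>.\<close>

definition Ck_lim :: "nat \<Rightarrow> ('i \<Rightarrow> 'a::real_normed_vector smooth_map) \<Rightarrow> 'a smooth_map \<Rightarrow> 'i filter \<Rightarrow> bool" where
  "Ck_lim k X l F \<longleftrightarrow> (\<forall>j\<le>k. uniform_limit {0..1} (\<lambda>i. ev ((D\<^sub>u ^^ j) (X i))) (ev ((D\<^sub>u ^^ j) l)) F)"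

lemma Ck_lim_0: "Ck_lim 0 X l F \<longleftrightarrow> uniform_limit {0..1} (\<lambda>i. ev (X i)) (ev l) F"
  by (simp add: Ck_lim_def)

lemma Ck_lim_Suc:
  "Ck_lim (Suc k) X l F \<longleftrightarrow> uniform_limit {0..1} (\<lambda>i. ev (X i)) (ev l) F \<and> Ck_lim k (\<lambda>i. D\<^sub>u (X i)) (D\<^sub>u l) F"
  unfolding Ck_lim_def by (auto simp: All_less_Suc2 funpow_Suc_right less_Suc_eq_le[symmetric] simp del: funpow.simps(2))

lemma Ck_lim_uniform_limit: "Ck_lim k X l F \<Longrightarrow> uniform_limit {0..1} (\<lambda>i. ev (X i)) (ev l) F"
  by (cases k) (auto simp: Ck_lim_0 Ck_lim_Suc)

lemma Ck_lim_Suc_Ck_lim: "Ck_lim (Suc k) X l F \<Longrightarrow> Ck_lim k X l F"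
  by (auto simp: Ck_lim_def)

lemma tendsto_iff_Ck_lim: "(X \<longlongrightarrow> l) F \<longleftrightarrow> (\<forall>k. Ck_lim k X l F)"
proof
  assume X: "(X \<longlongrightarrow> l) F"
  show "\<forall>k. Ck_lim k X l F"
    unfolding Ck_lim_def
  proof (intro allI impI uniform_limitI)
    fix k j :: nat and e :: real assume "j \<le> k" "e > 0"
    \<comment> \<open>The uniform margin \<open>r < e\<close> makes this ball open by the triangle
      inequality alone; for the strict pointwise bound of \<open>C_ball\<close> the margin would
      first have to be extracted from compactness.\<close>
    define W where "W = {g. \<exists>r<e. \<forall>i\<le>k. \<forall>u\<in>{0..1}. dist (ev ((D\<^sub>u ^^ i) l) u) (ev ((D\<^sub>u ^^ i) g) u) \<le> r}"
    have "open W"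
      unfolding open_smooth_map_def
    proof
      fix g assume "g \<in> W"
      then obtain r where r: "r < e" "\<forall>i\<le>k. \<forall>u\<in>{0..1}. dist (ev ((D\<^sub>u ^^ i) l) u) (ev ((D\<^sub>u ^^ i) g) u) \<le> r"
        by (auto simp: W_def)
      have "C_ball k g ((e - r) / 2) \<subseteq> W"
      proof
        fix f assume f: "f \<in> C_ball k g ((e - r) / 2)"
        have "dist (ev ((D\<^sub>u ^^ i) l) u) (ev ((D\<^sub>u ^^ i) f) u) \<le> r + (e - r) / 2" if "i \<le> k" "u \<in> {0..1}" for i u
        proof -
          have "dist (ev ((D\<^sub>u ^^ i) l) u) (ev ((D\<^sub>u ^^ i) g) u) \<le> r"
            "dist (ev ((D\<^sub>u ^^ i) g) u) (ev ((D\<^sub>u ^^ i) f) u) < (e - r) / 2"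
            using r(2) f that unfolding C_ball_def by auto
          then show ?thesis
            using dist_triangle[of "ev ((D\<^sub>u ^^ i) l) u" "ev ((D\<^sub>u ^^ i) f) u" "ev ((D\<^sub>u ^^ i) g) u"] by linarith
        qed
        moreover have "r + (e - r) / 2 < e" using r(1) by (simp add: field_simps)
        ultimately show "f \<in> W" unfolding W_def by blast
      qed
      then show "\<exists>k. \<exists>\<epsilon>>0. C_ball k g \<epsilon> \<subseteq> W" using r(1) by (intro exI[of _ k] exI[of _ "(e - r)/2"]) auto
    qed
    moreover have "l \<in> W" using \<open>e > 0\<close> unfolding W_def by (auto intro!: exI[of _ 0])
    ultimately have "\<forall>\<^sub>F n in F. X n \<in> W" using X topological_tendstoD by blast
    then show "\<forall>\<^sub>F n in F. \<forall>u\<in>{0..1}. dist (ev ((D\<^sub>u ^^ j) (X n)) u) (ev ((D\<^sub>u ^^ j) l) u) < e"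
      by eventually_elim (use \<open>j \<le> k\<close> in \<open>auto simp: W_def dist_commute intro: le_less_trans\<close>)
  qed
next
  assume X: "\<forall>k. Ck_lim k X l F"
  show "(X \<longlongrightarrow> l) F"
  proof (rule topological_tendstoI)
    fix S assume "open S" "l \<in> S"
    then obtain k e where e: "e > 0" "C_ball k l e \<subseteq> S" unfolding open_smooth_map_def by blast
    have "\<forall>\<^sub>F n in F. \<forall>j\<in>{..k}. \<forall>u\<in>{0..1}. dist (ev ((D\<^sub>u ^^ j) (X n)) u) (ev ((D\<^sub>u ^^ j) l) u) < e"
      using X e(1) by (intro eventually_ball_finite) (auto simp: Ck_lim_def uniform_limit_iff)
    then show "\<forall>\<^sub>F n in F. X n \<in> S"
      by eventually_elim (use e(2) in \<open>auto simp: C_ball_def dist_commute\<close>)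
  qed
qed

lemma Ck_lim_const: "Ck_lim k (\<lambda>_. l) l F"
  unfolding Ck_lim_def by (auto intro: uniform_limit_const)

lemma Ck_lim_add: "Ck_lim k X l F \<Longrightarrow> Ck_lim k Y m F \<Longrightarrow> Ck_lim k (\<lambda>i. X i + Y i) (l + m) F"
proof (induction k arbitrary: X Y l m)
  case 0
  then show ?case by (auto simp: Ck_lim_0 ev_simps_fun intro: uniform_limit_add)
next
  case (Suc k)
  then show ?case by (auto simp: Ck_lim_Suc ev_simps_fun D\<^sub>u_add intro: uniform_limit_add)
qed

lemma uniform_limit_bilinear_ev:
  assumes "bounded_bilinear B"
    "uniform_limit {0..1} (\<lambda>i. ev (X i)) (ev l) F" "uniform_limit {0..1} (\<lambda>i. ev (Y i)) (ev m) F"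
  shows "uniform_limit {0..1} (\<lambda>i u. B (ev (X i) u) (ev (Y i) u)) (\<lambda>u. B (ev l u) (ev m u)) F"
  using bounded_bilinear.bounded_uniform_limit[OF assms bounded_ev bounded_ev] .

lemma Ck_lim_bilinear:
  assumes B: "bounded_bilinear B"
  shows "Ck_lim k X l F \<Longrightarrow> Ck_lim k Y m F \<Longrightarrow> Ck_lim k (\<lambda>i. pointwise B (X i) (Y i)) (pointwise B l m) F"
proof (induction k arbitrary: X Y l m)
  case 0
  then show ?case
    using bounded_bilinear.bounded_uniform_limit[OF B _ _ bounded_ev bounded_ev]
    by (simp add: Ck_lim_0 ev_sbil[OF B, abs_def])
next
  case (Suc k)
  have "uniform_limit {0..1} (\<lambda>i. ev (pointwise B (X i) (Y i))) (ev (pointwise B l m)) F"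
    using uniform_limit_bilinear_ev[OF B, of X l F Y m] Suc.prems
    by (simp add: Ck_lim_Suc ev_sbil[OF B, abs_def])
  moreover have "Ck_lim k (\<lambda>i. pointwise B (X i) (D\<^sub>u (Y i))) (pointwise B l (D\<^sub>u m)) F"
    "Ck_lim k (\<lambda>i. pointwise B (D\<^sub>u (X i)) (Y i)) (pointwise B (D\<^sub>u l) m) F"
    using Suc.IH Suc.prems[THEN Ck_lim_Suc_Ck_lim] Suc.prems[unfolded Ck_lim_Suc] by blast+
  ultimately show ?case
    by (auto simp: Ck_lim_Suc D\<^sub>u_sbil[OF B] intro!: Ck_lim_add)
qed

lemma Ck_lim_scaleR:
  assumes "Ck_lim k X l F" "(c \<longlongrightarrow> d) F"
  shows "Ck_lim k (\<lambda>i. c i *\<^sub>R X i) (d *\<^sub>R l) F"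
  using assms(1)
proof (induction k arbitrary: X l)
  have *: "uniform_limit {0..1} (\<lambda>i. ev (c i *\<^sub>R X i)) (ev (d *\<^sub>R l)) F"
    if "uniform_limit {0..1} (\<lambda>i. ev (X i)) (ev l) F" for X l
  proof -
    have "uniform_limit {0..1} (\<lambda>i u::real. c i) (\<lambda>u. d) F"
      using assms(2) by (auto simp: uniform_limit_iff tendsto_iff)
    then have "uniform_limit {0..1} (\<lambda>i u. c i *\<^sub>R ev (X i) u) (\<lambda>u. d *\<^sub>R ev l u) F"
      using bounded_bilinear.bounded_uniform_limit[OF bounded_bilinear_scaleR _ that, of "\<lambda>i u. c i" "\<lambda>u. d"]
        bounded_ev[of l] by (simp add: image_constant_conv)
    then show ?thesis by (simp add: ev_simps_fun)
  qed
  {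
    case 0
    then show ?case using * by (simp add: Ck_lim_0)
  next
    case (Suc k)
    then show ?case using * by (auto simp: Ck_lim_Suc D\<^sub>u_scaleR)
  }
qed

lemma Ck_lim_cong: "Ck_lim k X l F \<Longrightarrow> \<forall>\<^sub>F i in F. X i = Y i \<Longrightarrow> Ck_lim k Y l F"
  unfolding Ck_lim_def uniform_limit_iff by (fastforce elim: eventually_elim2)

lemma nonvanishing_mapsD: "v \<in> nonvanishing_maps \<Longrightarrow> u \<in> {0..1} \<Longrightarrow> ev v u \<noteq> 0"
  by (auto simp: nonvanishing_maps_def)

lemma nonvanishing_bounds:
  assumes "v \<in> nonvanishing_maps"
  obtains m M where "0 < m" "\<And>u. u \<in> {0..1} \<Longrightarrow> m \<le> norm (ev v u) \<and> norm (ev v u) \<le> M"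
proof -
  have c: "continuous_on {0..1} (\<lambda>u. norm (ev v u))" by (intro continuous_intros) auto
  obtain x y where "x \<in> {0..1}" "\<forall>u\<in>{0..1}. norm (ev v x) \<le> norm (ev v u)"
    "\<forall>u\<in>{0..1}. norm (ev v u) \<le> norm (ev v y)"
    using continuous_attains_inf[OF _ _ c] continuous_attains_sup[OF _ _ c] by auto
  then show thesis using that[of "norm (ev v x)" "norm (ev v y)"] nonvanishing_mapsD[OF assms] by auto
qed

lemma uniform_limit_nonvanishing:
  assumes "uniform_limit {0..1} (\<lambda>i. ev (X i)) (ev v) F" "v \<in> nonvanishing_maps"
  shows "\<forall>\<^sub>F i in F. X i \<in> nonvanishing_maps"
proof -
  obtain m M where m: "0 < m" "\<And>u. u \<in> {0..1} \<Longrightarrow> m \<le> norm (ev v u) \<and> norm (ev v u) \<le> M"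
    using nonvanishing_bounds[OF assms(2)] by blast
  then have "\<forall>\<^sub>F i in F. \<forall>u\<in>{0..1}. dist (ev (X i) u) (ev v u) < m"
    using assms(1) by (simp add: uniform_limit_iff)
  then show ?thesis
  proof eventually_elim
    case (elim i)
    show ?case unfolding nonvanishing_maps_def
    proof (intro CollectI ballI notI)
      fix u :: real assume "u \<in> {0..1}" "ev (X i) u = 0"
      then show False using bspec[OF elim, of u] m(2)[of u] by simp
    qed
  qed
qed

lemma uniform_limit_norm_powr:
  assumes X: "uniform_limit {0..1} (\<lambda>i. ev (X i)) (ev v) F" and v: "v \<in> nonvanishing_maps"
  shows "uniform_limit {0..1} (\<lambda>i u. norm (ev (X i) u) powr p) (\<lambda>u. norm (ev v u) powr p) F"
proof (rule uniform_limitI)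
  fix e :: real assume e: "e > 0"
  obtain m M where m: "0 < m" "\<And>u. u \<in> {0..1} \<Longrightarrow> m \<le> norm (ev v u) \<and> norm (ev v u) \<le> M"
    using nonvanishing_bounds[OF v] by blast
  \<comment> \<open>A compact interval away from 0 that contains the norms of \<open>v\<close> and,
    once within \<open>m/2\<close> of \<open>v\<close>, also those of \<open>X i\<close>.\<close>
  have "uniformly_continuous_on {m/2..M+m} (\<lambda>s. s powr p)"
    using m(1) by (intro compact_uniformly_continuous continuous_intros) auto
  then obtain d where d: "d > 0" "\<And>x y. x \<in> {m/2..M+m} \<Longrightarrow> y \<in> {m/2..M+m} \<Longrightarrow> dist x y < d
      \<Longrightarrow> dist (x powr p) (y powr p) < e"
    using e unfolding uniformly_continuous_on_def by (metis dist_commute)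
  have "\<forall>\<^sub>F i in F. \<forall>u\<in>{0..1}. dist (ev (X i) u) (ev v u) < min d (m/2)"
    using d(1) m(1) by (intro uniform_limitD[OF X]) simp
  then show "\<forall>\<^sub>F i in F. \<forall>u\<in>{0..1}. dist (norm (ev (X i) u) powr p) (norm (ev v u) powr p) < e"
  proof eventually_elim
    case (elim i)
    show ?case
    proof
      fix u :: real assume u: "u \<in> {0..1}"
      have *: "\<bar>norm (ev (X i) u) - norm (ev v u)\<bar> < min d (m/2)"
        using elim u norm_triangle_ineq3[of "ev (X i) u" "ev v u"] by (fastforce simp: dist_norm)
      show "dist (norm (ev (X i) u) powr p) (norm (ev v u) powr p) < e"
      proof (rule d(2))
        have **: "\<bar>norm (ev (X i) u) - norm (ev v u)\<bar> < m/2" using * by simp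
        show "norm (ev (X i) u) \<in> {m/2..M+m}" "norm (ev v u) \<in> {m/2..M+m}"
          using ** m(2)[OF u] m(1) unfolding atLeastAtMost_iff abs_less_iff by linarith+
      qed (use * in \<open>simp add: dist_real_def\<close>)
    qed
  qed
qed

lemma Ck_lim_npow:
  assumes "Ck_lim k X v F" "v \<in> nonvanishing_maps"
  shows "Ck_lim k (\<lambda>i. npow p (X i)) (npow p v) F"
  using assms(1)
proof (induction k arbitrary: p)
  have nv: "\<forall>\<^sub>F i in F. X i \<in> nonvanishing_maps"
    using uniform_limit_nonvanishing[OF Ck_lim_uniform_limit[OF assms(1)] assms(2)] .
  have base: "uniform_limit {0..1} (\<lambda>i. ev (npow p (X i))) (ev (npow p v)) F" for p
  proof -
    have "\<forall>\<^sub>F i in F. \<forall>u\<in>{0..1}. norm (ev (X i) u) powr p = ev (npow p (X i)) u"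
      using nv by eventually_elim (simp add: ev_npow)
    with uniform_limit_norm_powr[OF Ck_lim_uniform_limit[OF assms(1)] assms(2), of p] show ?thesis
      by (rule uniform_limit_cong[THEN iffD1, rotated -1]) (simp_all add: ev_npow assms(2))
  qed
  {
    case 0
    show ?case using base by (simp add: Ck_lim_0)
  next
    case (Suc k)
    have "Ck_lim k (\<lambda>i. p *\<^sub>R pointwise (*) (npow (p - 2) (X i)) (pointwise (\<bullet>) (X i) (D\<^sub>u (X i))))
        (p *\<^sub>R pointwise (*) (npow (p - 2) v) (pointwise (\<bullet>) v (D\<^sub>u v))) F"
      using Suc.IH Ck_lim_Suc_Ck_lim[OF Suc.prems] Suc.prems[unfolded Ck_lim_Suc]
      by (intro Ck_lim_scaleR Ck_lim_bilinear bounded_bilinear_mult bounded_bilinear_inner tendsto_const) auto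
    moreover have "\<forall>\<^sub>F i in F. p *\<^sub>R pointwise (*) (npow (p - 2) (X i)) (pointwise (\<bullet>) (X i) (D\<^sub>u (X i))) = D\<^sub>u (npow p (X i))"
      using nv by eventually_elim (simp add: D\<^sub>u_npow)
    ultimately show ?case
      using base by (auto simp: Ck_lim_Suc D\<^sub>u_npow[OF assms(2)] intro: Ck_lim_cong)
  }
qed

section \<open>Directional derivatives at a fixed order\<close>

definition Ck_deriv :: "nat \<Rightarrow> (real \<Rightarrow> 'a::real_normed_vector smooth_map) \<Rightarrow> 'a smooth_map \<Rightarrow> bool" where
  "Ck_deriv k X X' \<longleftrightarrow> Ck_lim k (\<lambda>t. (X t - X 0) /\<^sub>R t) X' (at 0)"

lemma Ck_deriv_Suc: "Ck_deriv (Suc k) X X' \<longleftrightarrow>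
  uniform_limit {0..1} (\<lambda>t. ev ((X t - X 0) /\<^sub>R t)) (ev X') (at 0) \<and> Ck_deriv k (\<lambda>t. D\<^sub>u (X t)) (D\<^sub>u X')"
  by (simp add: Ck_deriv_def Ck_lim_Suc D\<^sub>u_scaleR D\<^sub>u_diff)

lemma Ck_deriv_Ck_lim: assumes "Ck_deriv k X X'" shows "Ck_lim k X (X 0) (at 0)"
proof -
  have "Ck_lim k (\<lambda>t. X 0 + t *\<^sub>R ((X t - X 0) /\<^sub>R t)) (X 0 + 0 *\<^sub>R X') (at 0)"
    using assms unfolding Ck_deriv_def by (intro Ck_lim_add Ck_lim_const Ck_lim_scaleR tendsto_ident_at)
  moreover have "\<forall>\<^sub>F t in at 0. X 0 + t *\<^sub>R ((X t - X 0) /\<^sub>R t) = X t"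
    by (auto simp: eventually_at intro!: exI[of _ 1])
  ultimately show ?thesis using Ck_lim_cong by fastforce
qed

lemma Ck_deriv_const: "Ck_deriv k (\<lambda>t. x) 0"
  by (simp add: Ck_deriv_def Ck_lim_const)

lemma Ck_deriv_line: "Ck_deriv k (\<lambda>t. x + t *\<^sub>R h) h"
  unfolding Ck_deriv_def by (rule Ck_lim_cong[OF Ck_lim_const]) (auto simp: eventually_at intro!: exI[of _ 1])

lemma Ck_deriv_add: "Ck_deriv k X X' \<Longrightarrow> Ck_deriv k Y Y' \<Longrightarrow> Ck_deriv k (\<lambda>t. X t + Y t) (X' + Y')"
  unfolding Ck_deriv_def using Ck_lim_add by (fastforce simp: scaleR_diff_right scaleR_add_right algebra_simps)

lemma pointwise_algebra:
  assumes "bounded_bilinear B"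
  shows "pointwise B (x + y) z = pointwise B x z + pointwise B y z" "pointwise B x (z + w) = pointwise B x z + pointwise B x w"
    "pointwise B (x - y) z = pointwise B x z - pointwise B y z" "pointwise B x (z - w) = pointwise B x z - pointwise B x w"
    "pointwise B (r *\<^sub>R x) z = r *\<^sub>R pointwise B x z" "pointwise B x (r *\<^sub>R z) = r *\<^sub>R pointwise B x z"
  using assms by (auto intro!: sm_eqI simp: ev_sbil bounded_bilinear.add_left bounded_bilinear.add_right
      bounded_bilinear.diff_left bounded_bilinear.diff_right bounded_bilinear.scaleR_left bounded_bilinear.scaleR_right)

lemma Ck_deriv_bilinear:
  assumes B: "bounded_bilinear B" and "Ck_deriv k X X'" "Ck_deriv k Y Y'"
  shows "Ck_deriv k (\<lambda>t. pointwise B (X t) (Y t)) (pointwise B X' (Y 0) + pointwise B (X 0) Y')"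
proof -
  have "Ck_lim k (\<lambda>t. pointwise B ((X t - X 0) /\<^sub>R t) (Y t) + pointwise B (X 0) ((Y t - Y 0) /\<^sub>R t))
      (pointwise B X' (Y 0) + pointwise B (X 0) Y') (at 0)"
    using assms(2,3) Ck_deriv_Ck_lim[OF assms(3)] unfolding Ck_deriv_def
    by (intro Ck_lim_add Ck_lim_bilinear[OF B] Ck_lim_const)
  then show ?thesis
    by (simp add: Ck_deriv_def pointwise_algebra[OF B] scaleR_diff_right)
qed

lemma Ck_deriv_scaleR: "Ck_deriv k X X' \<Longrightarrow> Ck_deriv k (\<lambda>t. r *\<^sub>R X t) (r *\<^sub>R X')"
  unfolding Ck_deriv_def using Ck_lim_scaleR[OF _ tendsto_const[of r], of k "\<lambda>t. (X t - X 0) /\<^sub>R t" X' "at 0"]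
  by (simp add: scaleR_diff_right mult.commute)

text \<open>The quotients must converge uniformly in \<open>u\<close>. For fixed \<open>u\<close>
  the mean value inequality bounds the error by the oscillation of the derivative along the segment
  from \<open>v\<close> to \<open>v + t *\<^sub>R h\<close>, and \<open>Ck_lim_npow\<close> makes
  this oscillation small for all \<open>u\<close> at once.\<close>

lemma uniform_Ck_deriv_npow:
  fixes v h :: "'a::real_inner smooth_map"
  assumes v: "v \<in> nonvanishing_maps"
  shows "uniform_limit {0..1} (\<lambda>t. ev ((npow p (v + t *\<^sub>R h) - npow p v) /\<^sub>R t))
    (ev (p *\<^sub>R pointwise (*) (npow (p - 2) v) (pointwise (\<bullet>) v h))) (at 0)"
proof (rule uniform_limitI)
  fix e :: real assume e: "e > 0"
  define \<psi> where "\<psi> = (\<lambda>t. p *\<^sub>R pointwise (*) (npow (p - 2) (v + t *\<^sub>R h)) (pointwise (\<bullet>) (v + t *\<^sub>R h) h))"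
  have line: "Ck_lim 0 (\<lambda>t. v + t *\<^sub>R h) v (at 0)"
    using Ck_deriv_Ck_lim[OF Ck_deriv_line[of 0 v h]] by simp
  have "Ck_lim 0 \<psi> (\<psi> 0) (at 0)"
    unfolding \<psi>_def using v Ck_lim_npow[OF line] line
    by (intro Ck_lim_scaleR Ck_lim_bilinear bounded_bilinear_mult bounded_bilinear_inner tendsto_const Ck_lim_const) auto
  then have "\<forall>\<^sub>F t in at 0. \<forall>u\<in>{0..1}. dist (ev (\<psi> t) u) (ev (\<psi> 0) u) < e/2"
    unfolding Ck_lim_0 using e by (intro uniform_limitD) simp_all
  moreover have "\<forall>\<^sub>F t in at 0. v + t *\<^sub>R h \<in> nonvanishing_maps"
    using uniform_limit_nonvanishing[OF _ v] line by (simp add: Ck_lim_0)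
  ultimately have "\<forall>\<^sub>F t in at 0. (\<forall>u\<in>{0..1}. dist (ev (\<psi> t) u) (ev (\<psi> 0) u) < e/2) \<and> v + t *\<^sub>R h \<in> nonvanishing_maps"
    by eventually_elim auto
  then obtain d where d: "d > 0" "\<And>t. t \<noteq> 0 \<Longrightarrow> dist t 0 < d \<Longrightarrow>
     (\<forall>u\<in>{0..1}. dist (ev (\<psi> t) u) (ev (\<psi> 0) u) < e/2) \<and> v + t *\<^sub>R h \<in> nonvanishing_maps"
    unfolding eventually_at by blast
  have d': "(\<forall>u\<in>{0..1}. dist (ev (\<psi> t) u) (ev (\<psi> 0) u) \<le> e/2) \<and> v + t *\<^sub>R h \<in> nonvanishing_maps"
    if "t \<in> ball 0 d" for t
    using d(2)[of t] that e v by (cases "t = 0") (auto simp: dist_commute intro: less_imp_le)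
  have *: "dist (ev ((npow p (v + t *\<^sub>R h) - npow p v) /\<^sub>R t) u) (ev (\<psi> 0) u) < e"
    if t: "t \<noteq> 0" "t \<in> ball 0 d" and u: "u \<in> {0..1}" for t u
  proof -
    define \<phi> where "\<phi> s = norm (ev v u + s *\<^sub>R ev h u) powr p - s * ev (\<psi> 0) u" for s
    have "(\<phi> has_field_derivative ev (\<psi> s) u - ev (\<psi> 0) u) (at s within ball 0 d)" if s: "s \<in> ball 0 d" for s
    proof -
      have nz: "ev v u + s *\<^sub>R ev h u \<noteq> 0" using d'[OF s] u nonvanishing_mapsD by fastforce
      have 1: "((\<lambda>s. ev v u + s *\<^sub>R ev h u) has_vector_derivative ev h u) (at s within ball 0 d)"
        by (auto intro!: derivative_eq_intros)
      show ?thesis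
        unfolding \<phi>_def
        by (rule DERIV_cong[OF DERIV_diff[OF has_vector_derivative_norm_powr[OF 1 nz, of p,
              folded has_real_derivative_iff_has_vector_derivative] DERIV_cmult_right[OF DERIV_ident]]])
          (use d'[OF s] in \<open>simp add: \<psi>_def ev_sbil bounded_bilinear_mult bounded_bilinear_inner ev_npow\<close>)
    qed
    then have "norm (\<phi> t - \<phi> 0) \<le> e/2 * norm (t - 0)"
      using d' u t d(1) by (intro field_differentiable_bound[OF convex_ball, of 0 d \<phi> "\<lambda>s. ev (\<psi> s) u - ev (\<psi> 0) u"]) (auto simp: dist_norm)
    then have "\<bar>(norm (ev v u + t *\<^sub>R ev h u) powr p - norm (ev v u) powr p - t * ev (\<psi> 0) u) / t\<bar> \<le> e/2"
      using t(1) by (simp add: \<phi>_def field_simps abs_divide)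
    moreover have "(norm (ev v u + t *\<^sub>R ev h u) powr p - norm (ev v u) powr p - t * ev (\<psi> 0) u) / t
       = ev ((npow p (v + t *\<^sub>R h) - npow p v) /\<^sub>R t) u - ev (\<psi> 0) u"
      using t(1) d'[OF t(2)] v by (simp add: ev_npow field_simps)
    ultimately show ?thesis using e by (simp add: dist_norm)
  qed
  have "\<psi> 0 = p *\<^sub>R pointwise (*) (npow (p - 2) v) (pointwise (\<bullet>) v h)" by (simp add: \<psi>_def)
  then show "\<forall>\<^sub>F t in at 0. \<forall>u\<in>{0..1}. dist (ev ((npow p (v + t *\<^sub>R h) - npow p v) /\<^sub>R t) u)
      (ev (p *\<^sub>R pointwise (*) (npow (p - 2) v) (pointwise (\<bullet>) v h)) u) < e"
    unfolding eventually_at using * d(1) by (intro exI[of _ d]) (auto simp: dist_commute)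
qed

text \<open>
  The induction on \<open>k\<close> treats all exponents at once: \<open>D\<^sub>u\<close> turns \<open>|v|\<^sup>p\<close> into a product involving \<open>|v|\<^sup>p\<^sup>-\<^sup>2\<close>.
\<close>

lemma Ck_deriv_npow:
  fixes v h :: "'a::real_inner smooth_map"
  assumes v: "v \<in> nonvanishing_maps"
  shows "Ck_deriv k (\<lambda>t. npow p (v + t *\<^sub>R h)) (p *\<^sub>R pointwise (*) (npow (p - 2) v) (pointwise (\<bullet>) v h))"
proof (induction k arbitrary: p)
  case 0
  then show ?case using uniform_Ck_deriv_npow[OF v] by (simp add: Ck_deriv_def Ck_lim_0)
next
  case (Suc k)
  note bb = bounded_bilinear_mult bounded_bilinear_inner
  have "Ck_deriv k (\<lambda>t. p *\<^sub>R pointwise (*) (npow (p - 2) (v + t *\<^sub>R h)) (pointwise (\<bullet>) (v + t *\<^sub>R h) (D\<^sub>u v + t *\<^sub>R D\<^sub>u h)))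
    (p *\<^sub>R (pointwise (*) ((p - 2) *\<^sub>R pointwise (*) (npow (p - 2 - 2) v) (pointwise (\<bullet>) v h))
          (pointwise (\<bullet>) (v + 0 *\<^sub>R h) (D\<^sub>u v + 0 *\<^sub>R D\<^sub>u h))
        + pointwise (*) (npow (p - 2) (v + 0 *\<^sub>R h)) (pointwise (\<bullet>) h (D\<^sub>u v + 0 *\<^sub>R D\<^sub>u h) + pointwise (\<bullet>) (v + 0 *\<^sub>R h) (D\<^sub>u h))))"
    by (intro Ck_deriv_scaleR Ck_deriv_bilinear bb Suc.IH Ck_deriv_line)
  \<comment> \<open>Derivatives in the direction \<open>h\<close> commute with
    \<open>D\<^sub>u\<close>: the product rule gives the same terms in either order, which is what
    allows the induction to descend by one order.\<close>
  moreover have "(p *\<^sub>R (pointwise (*) ((p - 2) *\<^sub>R pointwise (*) (npow (p - 2 - 2) v) (pointwise (\<bullet>) v h))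
          (pointwise (\<bullet>) (v + 0 *\<^sub>R h) (D\<^sub>u v + 0 *\<^sub>R D\<^sub>u h))
        + pointwise (*) (npow (p - 2) (v + 0 *\<^sub>R h)) (pointwise (\<bullet>) h (D\<^sub>u v + 0 *\<^sub>R D\<^sub>u h) + pointwise (\<bullet>) (v + 0 *\<^sub>R h) (D\<^sub>u h))))
    = D\<^sub>u (p *\<^sub>R pointwise (*) (npow (p - 2) v) (pointwise (\<bullet>) v h))"
    by (rule sm_eqI) (simp add: D\<^sub>u_scaleR D\<^sub>u_sbil bb D\<^sub>u_npow[OF v] ev_sbil ev_npow[OF v] inner_commute algebra_simps)
  ultimately have 1: "Ck_deriv k (\<lambda>t. p *\<^sub>R pointwise (*) (npow (p - 2) (v + t *\<^sub>R h)) (pointwise (\<bullet>) (v + t *\<^sub>R h) (D\<^sub>u v + t *\<^sub>R D\<^sub>u h)))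
     (D\<^sub>u (p *\<^sub>R pointwise (*) (npow (p - 2) v) (pointwise (\<bullet>) v h)))" by simp
  have "\<forall>\<^sub>F t in at 0. v + t *\<^sub>R h \<in> nonvanishing_maps"
    using uniform_limit_nonvanishing[OF Ck_lim_uniform_limit v] Ck_deriv_Ck_lim[OF Ck_deriv_line[of 0 v h]] by simp
  then have "\<forall>\<^sub>F t in at 0. (p *\<^sub>R pointwise (*) (npow (p - 2) (v + t *\<^sub>R h)) (pointwise (\<bullet>) (v + t *\<^sub>R h) (D\<^sub>u v + t *\<^sub>R D\<^sub>u h))
      - p *\<^sub>R pointwise (*) (npow (p - 2) (v + 0 *\<^sub>R h)) (pointwise (\<bullet>) (v + 0 *\<^sub>R h) (D\<^sub>u v + 0 *\<^sub>R D\<^sub>u h))) /\<^sub>R t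
      = (D\<^sub>u (npow p (v + t *\<^sub>R h)) - D\<^sub>u (npow p (v + 0 *\<^sub>R h))) /\<^sub>R t"
    by eventually_elim (simp add: D\<^sub>u_npow v D\<^sub>u_add D\<^sub>u_scaleR)
  then have "Ck_deriv k (\<lambda>t. D\<^sub>u (npow p (v + t *\<^sub>R h))) (D\<^sub>u (p *\<^sub>R pointwise (*) (npow (p - 2) v) (pointwise (\<bullet>) v h)))"
    using 1 unfolding Ck_deriv_def by (rule Ck_lim_cong[rotated])
  then show ?case using uniform_Ck_deriv_npow[OF v] by (simp add: Ck_deriv_Suc)
qed

section \<open>The square root velocity transform\<close>

text \<open>
  The iterated directional derivatives of \<open>v \<mapsto> |v|\<^sup>p v\<close> are sums of the following terms. Variable \<open>0\<close>
  stands for the point \<open>v\<close> and variable \<open>Suc k\<close> for the direction of the derivative number \<open>k\<close>.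
\<close>

datatype scalar_expr = Scl real scalar_expr | Pw real | Ip nat nat | Mul scalar_expr scalar_expr | Add scalar_expr scalar_expr
datatype vector_expr = Tm scalar_expr nat | VAdd vector_expr vector_expr

primrec scalar_eval :: "scalar_expr \<Rightarrow> (nat \<Rightarrow> 'a::real_inner smooth_map) \<Rightarrow> real smooth_map" where
  "scalar_eval (Scl r e) x = r *\<^sub>R scalar_eval e x"
| "scalar_eval (Pw p) x = npow p (x 0)"
| "scalar_eval (Ip i j) x = pointwise (\<bullet>) (x i) (x j)"
| "scalar_eval (Mul e f) x = pointwise (*) (scalar_eval e x) (scalar_eval f x)"
| "scalar_eval (Add e f) x = scalar_eval e x + scalar_eval f x"

primrec vector_eval :: "vector_expr \<Rightarrow> (nat \<Rightarrow> 'a::real_inner smooth_map) \<Rightarrow> 'a smooth_map" where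
  "vector_eval (Tm e i) x = pointwise (*\<^sub>R) (scalar_eval e x) (x i)"
| "vector_eval (VAdd e f) x = vector_eval e x + vector_eval f x"

text \<open>Only variable \<open>0\<close> moves; the directions are constants. The syntax has no
  zero, so a vanishing summand is an arbitrary term under \<open>Scl 0\<close>.\<close>

primrec scalar_deriv :: "nat \<Rightarrow> scalar_expr \<Rightarrow> scalar_expr" where
  "scalar_deriv k (Scl r e) = Scl r (scalar_deriv k e)"
| "scalar_deriv k (Pw p) = Scl p (Mul (Pw (p - 2)) (Ip 0 (Suc k)))"
| "scalar_deriv k (Ip i j) = Add (if i = 0 then Ip (Suc k) j else Scl 0 (Ip i j)) (if j = 0 then Ip i (Suc k) else Scl 0 (Ip i j))"
| "scalar_deriv k (Mul e f) = Add (Mul (scalar_deriv k e) f) (Mul e (scalar_deriv k f))"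
| "scalar_deriv k (Add e f) = Add (scalar_deriv k e) (scalar_deriv k f)"

primrec vector_deriv :: "nat \<Rightarrow> vector_expr \<Rightarrow> vector_expr" where
  "vector_deriv k (Tm e i) = VAdd (Tm (scalar_deriv k e) i) (Tm (if i = 0 then e else Scl 0 e) (if i = 0 then Suc k else i))"
| "vector_deriv k (VAdd e f) = VAdd (vector_deriv k e) (vector_deriv k f)"

lemma Ck_deriv_var: "Ck_deriv n (\<lambda>t. (x(0 := x 0 + t *\<^sub>R h)) i) (if i = 0 then h else 0)"
  by (cases "i = 0") (simp_all add: Ck_deriv_line Ck_deriv_const)

lemma pointwise_zero: "bounded_bilinear B \<Longrightarrow> pointwise B 0 y = 0" "bounded_bilinear B \<Longrightarrow> pointwise B x 0 = 0"
  by (auto intro!: sm_eqI simp: ev_sbil bounded_bilinear.zero_left bounded_bilinear.zero_right)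

lemma Ck_deriv_scalar_eval:
  assumes "x 0 \<in> nonvanishing_maps"
  shows "Ck_deriv n (\<lambda>t. scalar_eval e (x(0 := x 0 + t *\<^sub>R x (Suc k)))) (scalar_eval (scalar_deriv k e) x)"
proof (induction e)
  case (Scl r e)
  then show ?case by (simp add: Ck_deriv_scaleR)
next
  case (Pw p)
  then show ?case using Ck_deriv_npow[OF assms] by simp
next
  case (Ip i j)
  have "Ck_deriv n (\<lambda>t. pointwise (\<bullet>) ((x(0 := x 0 + t *\<^sub>R x (Suc k))) i) ((x(0 := x 0 + t *\<^sub>R x (Suc k))) j))
    (pointwise (\<bullet>) (if i = 0 then x (Suc k) else 0) ((x(0 := x 0 + 0 *\<^sub>R x (Suc k))) j)
    + pointwise (\<bullet>) ((x(0 := x 0 + 0 *\<^sub>R x (Suc k))) i) (if j = 0 then x (Suc k) else 0))"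
    by (intro Ck_deriv_bilinear bounded_bilinear_inner Ck_deriv_var)
  then show ?case by (auto simp: pointwise_zero bounded_bilinear_inner)
next
  case (Mul e f)
  from Ck_deriv_bilinear[OF bounded_bilinear_mult this] show ?case by simp
next
  case (Add e f)
  then show ?case by (simp add: Ck_deriv_add)
qed

lemma Ck_deriv_vector_eval:
  assumes "x 0 \<in> nonvanishing_maps"
  shows "Ck_deriv n (\<lambda>t. vector_eval e (x(0 := x 0 + t *\<^sub>R x (Suc k)))) (vector_eval (vector_deriv k e) x)"
proof (induction e)
  case (Tm e i)
  have "Ck_deriv n (\<lambda>t. pointwise (*\<^sub>R) (scalar_eval e (x(0 := x 0 + t *\<^sub>R x (Suc k)))) ((x(0 := x 0 + t *\<^sub>R x (Suc k))) i))
    (pointwise (*\<^sub>R) (scalar_eval (scalar_deriv k e) x) ((x(0 := x 0 + 0 *\<^sub>R x (Suc k))) i)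
    + pointwise (*\<^sub>R) (scalar_eval e (x(0 := x 0 + 0 *\<^sub>R x (Suc k)))) (if i = 0 then x (Suc k) else 0))"
    by (intro Ck_deriv_bilinear bounded_bilinear_scaleR Ck_deriv_var Ck_deriv_scalar_eval[where x = x, OF assms])
  then show ?case by (auto simp: pointwise_zero bounded_bilinear_scaleR fun_upd_def)
next
  case (VAdd e f)
  then show ?case by (simp add: Ck_deriv_add)
qed

lemma Ck_lim_scalar_eval:
  assumes "\<And>i. Ck_lim n (\<lambda>a. X a i) (x i) F" "x 0 \<in> nonvanishing_maps"
  shows "Ck_lim n (\<lambda>a. scalar_eval e (X a)) (scalar_eval e x) F"
  by (induction e) (auto intro!: Ck_lim_scaleR Ck_lim_npow Ck_lim_bilinear Ck_lim_add assms
      bounded_bilinear_inner bounded_bilinear_mult)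

lemma Ck_lim_vector_eval:
  assumes "\<And>i. Ck_lim n (\<lambda>a. X a i) (x i) F" "x 0 \<in> nonvanishing_maps"
  shows "Ck_lim n (\<lambda>a. vector_eval e (X a)) (vector_eval e x) F"
  by (induction e) (auto intro!: Ck_lim_bilinear Ck_lim_add Ck_lim_scalar_eval assms bounded_bilinear_scaleR)

lemma tendsto_line:
  fixes x h :: "'a::real_normed_vector smooth_map"
  shows "((\<lambda>t. x + t *\<^sub>R h) \<longlongrightarrow> x) (at 0)"
  using Ck_deriv_Ck_lim[OF Ck_deriv_line, of _ x h] by (simp add: tendsto_iff_Ck_lim)

text \<open>
  \<open>P\<close> and \<open>L\<close> will be \<open>D\<^sub>u\<close> and the identity for the transform, the identity and \<open>antideriv\<close> for its inverse.
\<close>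

lemma superposition_smooth:
  fixes P :: "'b::real_normed_vector smooth_map \<Rightarrow> 'a::real_inner smooth_map"
    and L :: "'a smooth_map \<Rightarrow> 'c::real_normed_vector smooth_map"
  assumes U: "openin (top_of_set V) U" and V: "subspace V"
    and P: "linear P" "continuous_on UNIV P" "P ` U \<subseteq> nonvanishing_maps"
    and L: "linear L" "continuous_on UNIV L"
    and F: "\<And>x. x \<in> U \<Longrightarrow> F x = L (pointwise (*\<^sub>R) (npow p (P x)) (P x))"
  shows "frechet_smooth V U F"
    and "x \<in> U \<Longrightarrow> h \<in> V \<Longrightarrow>
       ((\<lambda>t::real. (F (x + t *\<^sub>R h) - F x) /\<^sub>R t) \<longlongrightarrow>
         L (p *\<^sub>R pointwise (*\<^sub>R) (pointwise (*) (npow (p - 2) (P x)) (pointwise (\<bullet>) (P x) (P h))) (P x)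
            + pointwise (*\<^sub>R) (npow p (P x)) (P h))) (at 0)"
proof -
  \<comment> \<open>\<open>e k\<close> is the formal derivative of order \<open>k\<close> of the
    initial term. One expression serves all points and directions, so joint continuity of
    \<open>D k\<close> is just continuity of evaluation.\<close>
  define e where "e = rec_nat (Tm (Pw p) 0) (\<lambda>k. vector_deriv k)"
  have e: "e 0 = Tm (Pw p) 0" "\<And>k. e (Suc k) = vector_deriv k (e k)" by (simp_all add: e_def)
  define D where "D k x h = L (vector_eval (e k) (case_nat (P x) (P \<circ> h)))" for k x h
  have P_tendsto: "((\<lambda>i. P (X i)) \<longlongrightarrow> P l) G" if "(X \<longlongrightarrow> l) G" for X l and G :: "'i filter"
    using continuous_on_tendsto_compose[OF P(2) that] by simp
  have L_tendsto: "((\<lambda>i. L (X i)) \<longlongrightarrow> L l) G" if "(X \<longlongrightarrow> l) G" for X l and G :: "'i filter"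
    using continuous_on_tendsto_compose[OF L(2) that] by simp
  have D_0: "D 0 x h = F x" if "x \<in> U" for x h
    using F[OF that] by (simp add: D_def e)
  have D_Suc: "((\<lambda>t::real. (D k (x + t *\<^sub>R h k) h - D k x h) /\<^sub>R t) \<longlongrightarrow> D (Suc k) x h) (at 0)"
    if "x \<in> U" for k x h
  proof -
    let ?y = "case_nat (P x) (P \<circ> h)"
    have "?y 0 \<in> nonvanishing_maps" using P(3) that by auto
    then have "\<forall>n. Ck_deriv n (\<lambda>t. vector_eval (e k) (?y(0 := ?y 0 + t *\<^sub>R ?y (Suc k)))) (vector_eval (vector_deriv k (e k)) ?y)"
      using Ck_deriv_vector_eval by blast
    moreover have "?y(0 := ?y 0 + t *\<^sub>R ?y (Suc k)) = case_nat (P (x + t *\<^sub>R h k)) (P \<circ> h)" for t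
      using P(1) by (auto simp: linear_add linear_scale split: nat.split)
    ultimately have "((\<lambda>t. (vector_eval (e k) (case_nat (P (x + t *\<^sub>R h k)) (P \<circ> h)) - vector_eval (e k) ?y) /\<^sub>R t)
        \<longlongrightarrow> vector_eval (e (Suc k)) ?y) (at 0)"
      by (simp add: Ck_deriv_def tendsto_iff_Ck_lim e fun_upd_idem)
    from L_tendsto[OF this] show ?thesis
      unfolding D_def using L(1) by (simp add: linear_diff linear_scale)
  qed
  have D_cont: "continuous_on (U \<times> {h. range h \<subseteq> V}) (\<lambda>(x, h). D k x h)" for k
    unfolding continuous_on_def
  proof
    fix z :: "'b smooth_map \<times> (nat \<Rightarrow> 'b smooth_map)" assume z: "z \<in> U \<times> {h. range h \<subseteq> V}"
    let ?G = "at z within U \<times> {h. range h \<subseteq> V}"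
    have f: "(fst \<longlongrightarrow> fst z) ?G" and s: "(snd \<longlongrightarrow> snd z) ?G"
      by (auto intro: tendsto_fst tendsto_snd tendsto_ident_at)
    have s': "((\<lambda>w. snd w i) \<longlongrightarrow> snd z i) ?G" for i
      using continuous_on_tendsto_compose[OF continuous_on_product_coordinates s] by simp
    have "((\<lambda>w. case_nat (P (fst w)) (P \<circ> snd w) i) \<longlongrightarrow> case_nat (P (fst z)) (P \<circ> snd z) i) ?G" for i
      by (cases i) (auto intro: P_tendsto f s')
    then have "((\<lambda>w. vector_eval (e k) (case_nat (P (fst w)) (P \<circ> snd w))) \<longlongrightarrow> vector_eval (e k) (case_nat (P (fst z)) (P \<circ> snd z))) ?G"
      using z P(3) by (auto simp: tendsto_iff_Ck_lim intro!: Ck_lim_vector_eval)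
    from L_tendsto[OF this] show "((\<lambda>(x, h). D k x h) \<longlongrightarrow> (case z of (x, h) \<Rightarrow> D k x h)) ?G"
      unfolding D_def case_prod_unfold .
  qed
  show "frechet_smooth V U F"
    unfolding frechet_smooth_def
    using U D_0 D_Suc D_cont by (intro conjI exI[of _ D]) auto
  show "((\<lambda>t::real. (F (x + t *\<^sub>R h) - F x) /\<^sub>R t) \<longlongrightarrow>
         L (p *\<^sub>R pointwise (*\<^sub>R) (pointwise (*) (npow (p - 2) (P x)) (pointwise (\<bullet>) (P x) (P h))) (P x)
            + pointwise (*\<^sub>R) (npow p (P x)) (P h))) (at 0)" if x: "x \<in> U" and h: "h \<in> V"
  proof -
    \<comment> \<open>\<open>F\<close> obeys its formula on \<open>U\<close> only, so its quotients
      can be replaced by those of \<open>D 0\<close> only for \<open>t\<close> so small that the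
      line stays in \<open>U\<close>.\<close>
    obtain T where T: "open T" "U = V \<inter> T" using U openin_open by blast
    have "\<forall>\<^sub>F t in at 0. x + t *\<^sub>R h \<in> T"
      using topological_tendstoD[OF tendsto_line T(1)] x T(2) by auto
    then have "\<forall>\<^sub>F t in at 0. x + t *\<^sub>R h \<in> U"
      by eventually_elim (use x h T(2) V in \<open>auto intro: subspace_add subspace_scale\<close>)
    then have "\<forall>\<^sub>F t in at 0. (D 0 (x + t *\<^sub>R h) (\<lambda>_. h) - D 0 x (\<lambda>_. h)) /\<^sub>R t = (F (x + t *\<^sub>R h) - F x) /\<^sub>R t"
      by eventually_elim (simp add: D_0 x)
    from Lim_transform_eventually[OF D_Suc[OF x, of 0 "\<lambda>_. h"] this]
    have "((\<lambda>t. (F (x + t *\<^sub>R h) - F x) /\<^sub>R t) \<longlongrightarrow> D (Suc 0) x (\<lambda>_. h)) (at 0)" .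
    then show ?thesis by (simp add: D_def e pointwise_algebra bounded_bilinear_scaleR)
  qed
qed

section \<open>Antiderivatives, and continuity of \<open>D\<^sub>u\<close> and its inverse\<close>

lift_definition antideriv :: "'a::euclidean_space smooth_map \<Rightarrow> 'a smooth_map"
  is "\<lambda>f u. if u \<in> {0..1} then integral {0..u} f else 0"
proof (intro conjI)
  fix f :: "real \<Rightarrow> 'a" assume f: "smooth01 f \<and> (\<forall>u. u \<notin> {0..1} \<longrightarrow> f u = 0)"
  then have "Ck k f" for k by (simp add: smooth01_iff_Ck)
  then have c: "continuous_on {0..1} f" by (metis Ck.simps(1))
  have I: "Ck k (\<lambda>u. integral {0..u} f)" for k
  proof (rule Ck_Suc_Ck)
    show "Ck (Suc k) (\<lambda>u. integral {0..u} f)"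
      using \<open>Ck k f\<close> integral_has_vector_derivative[OF c] by (auto intro!: exI[of _ f])
  qed
  then show "smooth01 (\<lambda>u. if u \<in> {0..1} then integral {0..u} f else 0)"
    unfolding smooth01_iff_Ck by (intro allI Ck_cong[OF I]) simp
qed auto

lemma D\<^sub>u_antideriv: "D\<^sub>u (antideriv f) = f"
proof (rule D\<^sub>u_eqI)
  fix u :: real assume u: "u \<in> {0..1}"
  have "((\<lambda>u. integral {0..u} (ev f)) has_vector_derivative ev f u) (at u within {0..1})"
    by (rule integral_has_vector_derivative) (use u in \<open>auto intro: continuous_intros\<close>)
  then show "(ev (antideriv f) has_vector_derivative ev f u) (at u within {0..1})"
    by (rule has_vector_derivative_transform[rotated 2]) (use u in \<open>auto simp: antideriv.rep_eq\<close>)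
qed

lemma antideriv_based: "ev (antideriv f) 0 = 0"
  by (simp add: antideriv.rep_eq)

lemma based_eqI:
  fixes f g :: "'a::euclidean_space smooth_map"
  assumes "D\<^sub>u f = D\<^sub>u g" "ev f 0 = ev g 0"
  shows "f = g"
proof (rule sm_eqI)
  fix u :: real assume u: "u \<in> {0..1}"
  have "(ev (f - g) has_vector_derivative 0) (at x within {0..1})" if "x \<in> {0..1}" for x
    using ev_D\<^sub>u[OF that, of "f - g"] by (simp add: D\<^sub>u_diff assms(1))
  then obtain c where "\<And>x. x \<in> {0..1} \<Longrightarrow> ev (f - g) x = c"
    using has_vector_derivative_zero_constant[of "{0..1}" "ev (f - g)"] by auto
  then have "ev (f - g) u = ev (f - g) 0" using u by simp
  then show "ev f u = ev g u" using assms(2) by simp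
qed

lemma linear_D\<^sub>u: "linear D\<^sub>u"
  by (intro linearI D\<^sub>u_add D\<^sub>u_scaleR)

lemma linear_antideriv: "linear antideriv"
  by (rule linearI; rule based_eqI) (simp_all add: D\<^sub>u_antideriv D\<^sub>u_add D\<^sub>u_scaleR antideriv_based)

text \<open>Order \<open>k\<close> of the image needs order \<open>Suc k\<close> of the argument;
  this loss of a derivative is harmless because the topology controls all orders.\<close>

lemma continuous_D\<^sub>u: "continuous_on S D\<^sub>u"
  unfolding continuous_on_def tendsto_iff_Ck_lim
proof (intro ballI allI)
  fix x :: "'a smooth_map" and k assume "x \<in> S"
  have "Ck_lim (Suc k) (\<lambda>x. x) x (at x within S)"
    using tendsto_ident_at[of x S] by (simp add: tendsto_iff_Ck_lim)
  then show "Ck_lim k D\<^sub>u (D\<^sub>u x) (at x within S)"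
    by (simp add: Ck_lim_Suc)
qed

text \<open>\<open>D\<^sub>u\<close> cancels the integral, so all orders except 0 are inherited from
  the hypothesis. Order 0 is the estimate of an integral over an interval of length at most
  1.\<close>

lemma Ck_lim_antideriv: "Ck_lim k X l F \<Longrightarrow> Ck_lim k (\<lambda>i. antideriv (X i)) (antideriv l) F"
proof -
  have base: "uniform_limit {0..1} (\<lambda>i. ev (antideriv (X i))) (ev (antideriv l)) F" if "uniform_limit {0..1} (\<lambda>i. ev (X i)) (ev l) F"
  proof (rule uniform_limitI)
    fix e :: real assume e: "e > 0"
    have "\<forall>\<^sub>F i in F. \<forall>u\<in>{0..1}. dist (ev (X i) u) (ev l u) < e/2"
      using e by (intro uniform_limitD[OF that]) auto
    then show "\<forall>\<^sub>F i in F. \<forall>u\<in>{0..1}. dist (ev (antideriv (X i)) u) (ev (antideriv l) u) < e"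
    proof eventually_elim
      case (elim i)
      show ?case
      proof
        fix u :: real assume u: "u \<in> {0..1}"
        have "dist (ev (antideriv (X i)) u) (ev (antideriv l) u) = norm (integral {0..u} (\<lambda>s. ev (X i) s - ev l s))"
          using u by (auto simp: dist_norm antideriv.rep_eq intro!: integral_diff[symmetric] arg_cong[of _ _ norm]
              integrable_continuous_real continuous_intros)
        also have "\<dots> \<le> e/2 * (u - 0)"
          using u elim by (intro integral_bound) (auto intro!: continuous_intros simp: dist_norm less_imp_le)
        also have "\<dots> \<le> e/2" using u e by (simp add: mult_left_le)
        finally show "dist (ev (antideriv (X i)) u) (ev (antideriv l) u) < e" using e by simp
      qed
    qed
  qed
  assume c: "Ck_lim k X l F"
  show ?thesis
  proof (cases k)
    case 0
    then show ?thesis using base c by (simp add: Ck_lim_0)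
  next
    case (Suc m)
    then show ?thesis
      using base[OF Ck_lim_uniform_limit[OF c]] Ck_lim_Suc_Ck_lim[of m X l F] c by (simp add: Ck_lim_Suc D\<^sub>u_antideriv)
  qed
qed

lemma continuous_antideriv: "continuous_on S antideriv"
  unfolding continuous_on_def tendsto_iff_Ck_lim
proof (intro ballI allI)
  fix x :: "'a smooth_map" and k assume "x \<in> S"
  have "Ck_lim k (\<lambda>x. x) x (at x within S)"
    using tendsto_ident_at[of x S] by (simp add: tendsto_iff_Ck_lim)
  then show "Ck_lim k antideriv (antideriv x) (at x within S)" by (rule Ck_lim_antideriv)
qed

lemma open_nonvanishing_maps: "open (nonvanishing_maps :: 'a::real_inner smooth_map set)"
  unfolding open_smooth_map_def
proof
  fix v :: "'a smooth_map" assume v: "v \<in> nonvanishing_maps"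
  obtain m M where m: "0 < m" "\<And>u. u \<in> {0..1} \<Longrightarrow> m \<le> norm (ev v u) \<and> norm (ev v u) \<le> M"
    using nonvanishing_bounds[OF v] by blast
  have "C_ball 0 v m \<subseteq> nonvanishing_maps"
    unfolding nonvanishing_maps_def C_ball_def using m(2) by fastforce
  then show "\<exists>k. \<exists>\<epsilon>>0. C_ball k v \<epsilon> \<subseteq> nonvanishing_maps" using m(1) by blast
qed

lemma immersions0_eq: "immersions0 = based_maps \<inter> D\<^sub>u -` nonvanishing_maps"
  by (auto simp: immersions0_def based_maps_def nonvanishing_maps_def)

lemma D\<^sub>u_immersion: "c \<in> immersions0 \<Longrightarrow> D\<^sub>u c \<in> nonvanishing_maps"
  by (simp add: immersions0_eq)

lemma openin_immersions0: "openin (top_of_set based_maps) (immersions0 :: 'a::real_inner smooth_map set)"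
  unfolding immersions0_eq
  using open_vimage[OF open_nonvanishing_maps continuous_D\<^sub>u] by (rule openin_open_Int)

lemma subspace_based_maps: "subspace based_maps"
  by (auto simp: subspace_def based_maps_def)

section \<open>The transform, its inverse and its differential\<close>

lemma powr_neg_half_sqrt: "x \<ge> 0 \<Longrightarrow> x powr (- (1/2)) = inverse (sqrt x)"
  using powr_minus[of x "1/2"] powr_half_sqrt[of x] by simp

lemma SRVT_eq:
  assumes "c \<in> immersions0"
  shows "SRVT c = pointwise (*\<^sub>R) (npow (-1/2) (D\<^sub>u c)) (D\<^sub>u c)"
proof -
  have "D\<^sub>u c \<in> nonvanishing_maps" using assms by (simp add: immersions0_eq)
  then have "ev (pointwise (*\<^sub>R) (npow (-1/2) (D\<^sub>u c)) (D\<^sub>u c)) = (\<lambda>u. ev (D\<^sub>u c) u /\<^sub>R sqrt (norm (ev (D\<^sub>u c) u)))"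
    by (auto simp: ev_sbil bounded_bilinear_scaleR ev_npow powr_neg_half_sqrt)
  then show ?thesis unfolding SRVT_def by (metis ev_inverse)
qed

lemma ev_SRVT:
  fixes c :: "'a::real_inner smooth_map"
  assumes "c \<in> immersions0"
  shows "ev (SRVT c) u = ev (D\<^sub>u c) u /\<^sub>R sqrt (norm (ev (D\<^sub>u c) u))"
  using assms unfolding SRVT_eq[OF assms]
  by (simp add: ev_sbil bounded_bilinear_scaleR ev_npow powr_neg_half_sqrt immersions0_eq)

text \<open>From \<open>q = c' / sqrt |c'|\<close> follows \<open>|q| = sqrt |c'|\<close>, hence
  \<open>c' = |q| q\<close>; the condition \<open>c(0) = 0\<close> then selects the
  antiderivative.\<close>

definition SRVT_inv :: "'a::euclidean_space smooth_map \<Rightarrow> 'a smooth_map" where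
  "SRVT_inv q = antideriv (pointwise (*\<^sub>R) (npow 1 q) q)"

lemma SRVT_inv_immersion: "q \<in> nonvanishing_maps \<Longrightarrow> SRVT_inv q \<in> immersions0"
  by (auto simp: immersions0_def SRVT_inv_def antideriv_based D\<^sub>u_antideriv ev_sbil bounded_bilinear_scaleR ev_npow
      nonvanishing_mapsD)

lemma SRVT_SRVT_inv:
  assumes "q \<in> nonvanishing_maps" shows "SRVT (SRVT_inv q) = q"
proof (rule sm_eqI)
  fix u :: real assume "u \<in> {0..1}"
  then show "ev (SRVT (SRVT_inv q)) u = ev q u"
    unfolding ev_SRVT[OF SRVT_inv_immersion[OF assms]]
    using assms by (simp add: SRVT_inv_def D\<^sub>u_antideriv ev_sbil bounded_bilinear_scaleR
        ev_npow nonvanishing_mapsD)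
qed

lemma SRVT_nonvanishing:
  fixes c :: "'a::real_inner smooth_map"
  shows "c \<in> immersions0 \<Longrightarrow> SRVT c \<in> nonvanishing_maps"
  using nonvanishing_mapsD[OF D\<^sub>u_immersion, of c] by (auto simp: nonvanishing_maps_def ev_SRVT)

lemma SRVT_inv_SRVT:
  assumes "c \<in> immersions0" shows "SRVT_inv (SRVT c) = c"
proof (rule based_eqI)
  show "D\<^sub>u (SRVT_inv (SRVT c)) = D\<^sub>u c"
  proof (rule sm_eqI)
    fix u :: real assume "u \<in> {0..1}"
    show "ev (D\<^sub>u (SRVT_inv (SRVT c))) u = ev (D\<^sub>u c) u"
      by (simp add: SRVT_inv_def D\<^sub>u_antideriv ev_sbil bounded_bilinear_scaleR ev_npow SRVT_nonvanishing assms ev_SRVT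
          real_sqrt_mult[symmetric] divide_simps)
  qed
qed (use assms in \<open>simp add: SRVT_inv_def antideriv_based immersions0_def\<close>)

lemma bij_betw_SRVT: "bij_betw SRVT immersions0 (nonvanishing_maps :: 'a::euclidean_space smooth_map set)"
  by (rule bij_betw_byWitness[of _ SRVT_inv])
    (auto simp: SRVT_SRVT_inv SRVT_inv_SRVT SRVT_nonvanishing SRVT_inv_immersion)

lemma frechet_diffeo_SRVT:
  "frechet_diffeo based_maps (immersions0 :: 'a::euclidean_space smooth_map set) UNIV nonvanishing_maps SRVT"
  unfolding frechet_diffeo_def
proof (intro conjI bij_betw_SRVT)
  show "frechet_smooth based_maps immersions0 (SRVT :: 'a smooth_map \<Rightarrow> _)"
    by (rule superposition_smooth(1)[where P = D\<^sub>u and L = "\<lambda>x. x" and p = "-1/2"])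
      (auto simp: openin_immersions0 subspace_based_maps linear_D\<^sub>u continuous_D\<^sub>u SRVT_eq
        D\<^sub>u_immersion intro: linear_ident continuous_on_id)
  show "frechet_smooth UNIV nonvanishing_maps (inv_into immersions0 (SRVT :: 'a smooth_map \<Rightarrow> _))"
  proof (rule superposition_smooth(1)[where P = "\<lambda>x. x" and L = antideriv and p = 1])
    fix q :: "'a smooth_map" assume "q \<in> nonvanishing_maps"
    then show "inv_into immersions0 SRVT q = antideriv (pointwise (*\<^sub>R) (npow 1 q) q)"
      using bij_betw_SRVT[unfolded bij_betw_def] SRVT_SRVT_inv SRVT_inv_immersion
      by (intro inv_into_f_eq) (auto simp: SRVT_inv_def)
  qed (auto simp: open_nonvanishing_maps linear_antideriv continuous_antideriv intro: linear_ident continuous_on_id)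
qed

lemma dir_deriv_SRVT:
  fixes c h :: "'a::euclidean_space smooth_map"
  assumes c: "c \<in> immersions0" and h: "h \<in> based_maps"
  shows "ev (dir_deriv SRVT c h) u = norm (ev (D\<^sub>u c) u) powr (-1/2) *\<^sub>R ev (D\<^sub>u h) u
    - (1/2 * (norm (ev (D\<^sub>u c) u) powr (-5/2) * (ev (D\<^sub>u c) u \<bullet> ev (D\<^sub>u h) u))) *\<^sub>R ev (D\<^sub>u c) u"
proof -
  let ?D = "(-1/2) *\<^sub>R pointwise (*\<^sub>R) (pointwise (*) (npow (-1/2 - 2) (D\<^sub>u c)) (pointwise (\<bullet>) (D\<^sub>u c) (D\<^sub>u h))) (D\<^sub>u c)
    + pointwise (*\<^sub>R) (npow (-1/2) (D\<^sub>u c)) (D\<^sub>u h)"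
  have "((\<lambda>t::real. (SRVT (c + t *\<^sub>R h) - SRVT c) /\<^sub>R t) \<longlongrightarrow> ?D) (at 0)"
    by (rule superposition_smooth(2)[where P = D\<^sub>u and L = "\<lambda>x. x" and p = "-1/2" and U = immersions0 and V = based_maps])
      (auto simp: openin_immersions0 subspace_based_maps linear_D\<^sub>u continuous_D\<^sub>u SRVT_eq assms
        D\<^sub>u_immersion intro: linear_ident continuous_on_id)
  then have "dir_deriv SRVT c h = ?D" unfolding dir_deriv_def by (intro tendsto_Lim) auto
  moreover have "D\<^sub>u c \<in> nonvanishing_maps" using c by (simp add: immersions0_eq)
  ultimately show ?thesis
    by (simp add: ev_sbil bounded_bilinear_mult bounded_bilinear_inner bounded_bilinear_scaleR ev_npow)
qed

section \<open>The pullback of the cone metric\<close>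

text \<open>The integrand of the elastic metric for \<open>v = c'\<close>, \<open>x = h'\<close>,
  \<open>y = k'\<close>. The single division by \<open>norm v\<close> remains from the two factors
  \<open>1 / |c'|\<close> in the arc length derivatives and the factor \<open>|c'|\<close> in
  \<open>ds\<close>.\<close>

definition elastic_inner :: "real \<Rightarrow> real \<Rightarrow> 'a::real_inner \<Rightarrow> 'a \<Rightarrow> 'a \<Rightarrow> real" where
  "elastic_inner a b v x y =
    (a\<^sup>2 * (x \<bullet> y - (v \<bullet> x) * (v \<bullet> y) / (norm v)\<^sup>2) + b\<^sup>2 * ((v \<bullet> x) * (v \<bullet> y) / (norm v)\<^sup>2)) / norm v"

text \<open>\<open>X\<close> and \<open>Y\<close> are the images of \<open>x\<close> and
  \<open>y\<close> under the differential of \<open>v \<mapsto> v / sqrt |v|\<close>. Up to the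
  factor \<open>1 / sqrt |v|\<close>, this differential halves the radial component and keeps the
  orthogonal one, so the coefficients become \<open>4 * b^2 * (1/4) = b^2\<close> and
  \<open>4 * b^2 * lam^2 = a^2\<close>.\<close>

lemma elastic_integrand:
  fixes v x y :: "'a::real_inner"
  assumes "v \<noteq> 0" "b > 0" "lam = a / (2 * b)"
  defines "n \<equiv> norm v"
  defines "X \<equiv> (n powr (-1/2)) *\<^sub>R x - (1/2 * (n powr (-5/2) * (v \<bullet> x))) *\<^sub>R v"
    and "Y \<equiv> (n powr (-1/2)) *\<^sub>R y - (1/2 * (n powr (-5/2) * (v \<bullet> y))) *\<^sub>R v"
  shows "4 * b\<^sup>2 * cone_metric lam (v /\<^sub>R sqrt n) X Y =
    elastic_inner a b v x y"
proof -
  \<comment> \<open>In terms of \<open>s\<close> all fractional powers of the norm become integral,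
    and what remains is an identity of rational functions.\<close>
  define s where "s = sqrt n"
  have s: "s > 0" "n = s\<^sup>2" using assms(1) by (auto simp: s_def n_def)
  have vv: "v \<bullet> v = s^4" using s(2) by (simp add: n_def dot_square_norm power2_eq_square power4_eq_xxxx mult.assoc)
  have p1: "n powr (-1/2) = 1/s"
    by (simp add: powr_neg_half_sqrt s_def n_def inverse_eq_divide)
  have "n powr (-5/2) = (n powr (1/2)) powr (-5)" by (simp add: powr_powr)
  also have "n powr (1/2) = s" by (simp add: powr_half_sqrt s_def n_def)
  also have "s powr (-5) = 1 / s^5" using s(1) powr_minus[of s 5] by (simp add: inverse_eq_divide)
  finally have p2: "n powr (-5/2) = 1 / s^5" .
  have rad: "radial_part (v /\<^sub>R s) ((1/s) *\<^sub>R z - (1/2 * (1/s^5 * (v \<bullet> z))) *\<^sub>R v) = ((v \<bullet> z) / (2 * s^5)) *\<^sub>R v" for z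
  proof -
    have "(v /\<^sub>R s) \<bullet> (v /\<^sub>R s) = s^4 / (s * s)"
      unfolding inner_scaleR_left inner_scaleR_right vv using s(1) by (simp add: field_simps)
    moreover have "((1/s) *\<^sub>R z - (1/2 * (1/s^5 * (v \<bullet> z))) *\<^sub>R v) \<bullet> (v /\<^sub>R s)
        = (1/s) * (v \<bullet> z) / s - (1/2 * (1/s^5 * (v \<bullet> z))) * s^4 / s"
      unfolding inner_diff_left inner_scaleR_left inner_scaleR_right vv inner_commute[of z v] inverse_eq_divide
      using s(1) by (simp add: field_simps)
    ultimately have "(((1/s) *\<^sub>R z - (1/2 * (1/s^5 * (v \<bullet> z))) *\<^sub>R v) \<bullet> (v /\<^sub>R s)) / ((v /\<^sub>R s) \<bullet> (v /\<^sub>R s)) / s = (v \<bullet> z) / (2 * s^5)"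
      using s(1) by (simp add: field_simps eval_nat_numeral)
    then show ?thesis unfolding radial_part_def by (simp only: scaleR_scaleR divide_inverse)
  qed
  define A B C where "A = v \<bullet> x" and "B = v \<bullet> y" and "C = x \<bullet> y"
  have X: "X - radial_part (v /\<^sub>R s) X = (1/s) *\<^sub>R x - (A / s^5) *\<^sub>R v" "radial_part (v /\<^sub>R s) X = (A / (2 * s^5)) *\<^sub>R v"
    and Y: "Y - radial_part (v /\<^sub>R s) Y = (1/s) *\<^sub>R y - (B / s^5) *\<^sub>R v" "radial_part (v /\<^sub>R s) Y = (B / (2 * s^5)) *\<^sub>R v"
    unfolding X_def Y_def p1 p2 rad A_def B_def by (simp_all add: algebra_simps flip: scaleR_add_left)
  have 1: "((1/s) *\<^sub>R x - (A / s^5) *\<^sub>R v) \<bullet> ((1/s) *\<^sub>R y - (B / s^5) *\<^sub>R v) = C / s^2 - A * B / s^6"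
  proof -
    have "((1/s) *\<^sub>R x - (A / s^5) *\<^sub>R v) \<bullet> ((1/s) *\<^sub>R y - (B / s^5) *\<^sub>R v)
      = 1/s * (1/s) * C - 1/s * (B / s^5) * A - (A / s^5) * (1/s) * B + (A / s^5) * (B / s^5) * s^4"
      by (simp add: inner_diff_left inner_diff_right vv A_def B_def C_def inner_commute)
    also have "\<dots> = C / s^2 - A * B / s^6" using s(1) by (simp add: field_simps eval_nat_numeral)
    finally show ?thesis .
  qed
  have 2: "((A / (2 * s^5)) *\<^sub>R v) \<bullet> ((B / (2 * s^5)) *\<^sub>R v) = A * B / (4 * s^6)"
    using s(1) by (simp add: vv field_simps eval_nat_numeral)
  have "4 * b\<^sup>2 * cone_metric lam (v /\<^sub>R s) X Y = 4 * b\<^sup>2 * (lam\<^sup>2 * (C / s^2 - A * B / s^6) + A * B / (4 * s^6))"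
    unfolding cone_metric_def unfolding X(1) Y(1) 1 unfolding X(2) Y(2) 2 ..
  also have "\<dots> = (2 * b * lam)\<^sup>2 * (C / s^2 - A * B / s^6) + b\<^sup>2 * (A * B / s^6)"
    by (simp add: power_mult_distrib algebra_simps)
  also have "2 * b * lam = a" using assms(2,3) by simp
  also have "a\<^sup>2 * (C / s^2 - A * B / s^6) + b\<^sup>2 * (A * B / s^6) = (a\<^sup>2 * (C - A * B / n\<^sup>2) + b\<^sup>2 * (A * B / n\<^sup>2)) / n"
    using s(1) unfolding s(2) by (simp add: field_simps eval_nat_numeral)
  finally show ?thesis unfolding A_def B_def C_def s_def elastic_inner_def n_def[symmetric] .
qed

lemma elastic_metric_eq:
  assumes "c \<in> immersions0"
  shows "elastic_metric a b c h k = integral {0..1} (\<lambda>u.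
     elastic_inner a b (ev (D\<^sub>u c) u) (ev (D\<^sub>u h) u) (ev (D\<^sub>u k) u))"
  unfolding elastic_metric_def
proof (rule integral_cong)
  fix u :: real assume u: "u \<in> {0..1}"
  define v where "v = ev (D\<^sub>u c) u"
  have n: "norm v \<noteq> 0" using assms u by (auto simp: immersions0_def v_def)
  define A B C where "A = v \<bullet> ev (D\<^sub>u h) u" and "B = v \<bullet> ev (D\<^sub>u k) u" and "C = ev (D\<^sub>u h) u \<bullet> ev (D\<^sub>u k) u"
  define n where "n = norm v"
  have n0: "n > 0" using n by (simp add: n_def)
  have vv: "v \<bullet> v = n\<^sup>2" by (simp add: n_def dot_square_norm)
  have tan: "D\<^sub>s_tan c h u = (A / n^3) *\<^sub>R v" "D\<^sub>s_tan c k u = (B / n^3) *\<^sub>R v"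
    by (simp_all add: D\<^sub>s_tan_def D\<^sub>s_def v_def[symmetric] A_def B_def n_def[symmetric] inner_commute inverse_eq_divide eval_nat_numeral)
  have D: "D\<^sub>s c h u = (1/n) *\<^sub>R ev (D\<^sub>u h) u" "D\<^sub>s c k u = (1/n) *\<^sub>R ev (D\<^sub>u k) u"
    by (simp_all add: D\<^sub>s_def v_def n_def inverse_eq_divide)
  have 1: "D\<^sub>s_perp c h u \<bullet> D\<^sub>s_perp c k u = 1/n * (1/n) * C - 1/n * (B / n^3) * A - (A / n^3) * (1/n) * B + (A / n^3) * (B / n^3) * n^2"
    by (simp add: D\<^sub>s_perp_def tan D inner_diff_left inner_diff_right vv A_def B_def C_def inner_commute)
  have 2: "D\<^sub>s_tan c h u \<bullet> D\<^sub>s_tan c k u = (A / n^3) * (B / n^3) * n^2"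
    by (simp add: tan vv)
  have "(a\<^sup>2 * (D\<^sub>s_perp c h u \<bullet> D\<^sub>s_perp c k u) + b\<^sup>2 * (D\<^sub>s_tan c h u \<bullet> D\<^sub>s_tan c k u)) * n
    = (a\<^sup>2 * (C - A * B / n\<^sup>2) + b\<^sup>2 * (A * B / n\<^sup>2)) / n"
    unfolding 1 2 using n0 by (simp add: field_simps eval_nat_numeral)
  then show "(a\<^sup>2 * (D\<^sub>s_perp c h u \<bullet> D\<^sub>s_perp c k u) + b\<^sup>2 * (D\<^sub>s_tan c h u \<bullet> D\<^sub>s_tan c k u)) * norm (ev (D\<^sub>u c) u) =
    elastic_inner a b (ev (D\<^sub>u c) u) (ev (D\<^sub>u h) u) (ev (D\<^sub>u k) u)"
    by (simp add: elastic_inner_def A_def B_def C_def n_def v_def)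
qed

lemma riemannian_isometry_SRVT:
  assumes "a > 0" "b > 0" "lam = a / (2 * b)"
  shows "riemannian_isometry
       based_maps (immersions0 :: 'a::euclidean_space smooth_map set) (elastic_metric a b)
       UNIV nonvanishing_maps (\<lambda>q h k. 4 * b\<^sup>2 * L2_metric lam q h k) SRVT"
  unfolding riemannian_isometry_def
proof (intro conjI frechet_diffeo_SRVT ballI)
  fix c h k :: "'a smooth_map" assume c: "c \<in> immersions0" and h: "h \<in> based_maps" and k: "k \<in> based_maps"
  show "elastic_metric a b c h k = 4 * b\<^sup>2 * L2_metric lam (SRVT c) (dir_deriv SRVT c h) (dir_deriv SRVT c k)"
    unfolding elastic_metric_eq[OF c] L2_metric_def integral_mult_right[symmetric]
  proof (rule integral_cong)
    fix u :: real assume "u \<in> {0..1}"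
    then have "ev (D\<^sub>u c) u \<noteq> 0" using c by (auto simp: immersions0_def)
    from elastic_integrand[OF this assms(2,3), of "ev (D\<^sub>u h) u" "ev (D\<^sub>u k) u"]
    show "elastic_inner a b (ev (D\<^sub>u c) u) (ev (D\<^sub>u h) u) (ev (D\<^sub>u k) u)
      = 4 * b\<^sup>2 * cone_metric lam (ev (SRVT c) u) (ev (dir_deriv SRVT c h) u) (ev (dir_deriv SRVT c k) u)"
      by (simp add: ev_SRVT[OF c] dir_deriv_SRVT[OF c h] dir_deriv_SRVT[OF c k])
  qed
qed

section \<open>Distance on the cone\<close>

definition vang :: "'a::real_inner \<Rightarrow> 'a \<Rightarrow> real" where
  "vang v w = arccos ((v \<bullet> w) / (norm v * norm w))"

definition cosine_law :: "real \<Rightarrow> real \<Rightarrow> real \<Rightarrow> real" where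
  "cosine_law r s \<phi> = r\<^sup>2 + s\<^sup>2 - 2 * r * s * cos \<phi>"

text \<open>The squared distance for the metric \<open>dr^2 + lam^2 r^2 (d angle)^2\<close> at the
  radii \<open>sqrt |v|\<close> and \<open>sqrt |w|\<close>. At the cut-off angle \<open>pi\<close>
  the cosine law gives the square of the sum of the radii, the length of the connection through the
  vertex.\<close>

definition cone_dist2 :: "real \<Rightarrow> 'a::real_inner \<Rightarrow> 'a \<Rightarrow> real" where
  "cone_dist2 lam v w = norm v + norm w - 2 * sqrt (norm v * norm w) * cos (min (lam * vang v w) pi)"

definition elastic_form :: "real \<Rightarrow> real \<Rightarrow> 'a::real_inner \<Rightarrow> 'a \<Rightarrow> real" where
  "elastic_form a b v x =
    (a\<^sup>2 * ((norm x)\<^sup>2 - (v \<bullet> x)\<^sup>2 / (norm v)\<^sup>2) + b\<^sup>2 * ((v \<bullet> x)\<^sup>2 / (norm v)\<^sup>2)) / norm v"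

lemma inner_quotient_bound:
  fixes v w :: "'a::real_inner"
  shows "- 1 \<le> (v \<bullet> w) / (norm v * norm w)" "(v \<bullet> w) / (norm v * norm w) \<le> 1"
proof -
  have "\<bar>(v \<bullet> w) / (norm v * norm w)\<bar> \<le> 1"
  proof (cases "v = 0 \<or> w = 0")
    case False
    then show ?thesis using Cauchy_Schwarz_ineq2[of v w] by (simp add: abs_mult)
  qed auto
  then show "- 1 \<le> (v \<bullet> w) / (norm v * norm w)" "(v \<bullet> w) / (norm v * norm w) \<le> 1"
    unfolding abs_le_iff by linarith+
qed

lemma vang_bounds: "0 \<le> vang v w" "vang v w \<le> pi"
  unfolding vang_def by (intro arccos_lbound arccos_ubound inner_quotient_bound)+

lemma cos_vang: "cos (vang v w) = (v \<bullet> w) / (norm v * norm w)"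
  unfolding vang_def by (intro cos_arccos inner_quotient_bound)

lemma scaled_vang_nonneg: "lam > 0 \<Longrightarrow> 0 \<le> lam * vang v w"
  using vang_bounds(1)[of v w] by simp

lemma vang_commute: "vang v w = vang w v"
  by (simp add: vang_def inner_commute mult.commute)

lemma norm_minus_projection:
  fixes x y :: "'a::real_inner"
  assumes "norm x = 1" "norm y = 1"
  shows "(norm (x - (x \<bullet> y) *\<^sub>R y))\<^sup>2 = 1 - (x \<bullet> y)\<^sup>2"
proof -
  have "x \<bullet> x = 1" "y \<bullet> y = 1" using assms by (simp_all add: dot_square_norm)
  then show ?thesis
    unfolding power2_norm_eq_inner
    by (simp add: inner_diff_left inner_diff_right inner_commute power2_eq_square algebra_simps)
qed

text \<open>For unit vectors, split off the components along the middle one. The lengths of the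
  remainders are the sines of the two angles, and the Cauchy-Schwarz inequality for the remainders
  says that the cosine of the sum is at most the cosine of the third angle.\<close>

lemma vang_triangle:
  fixes u v w :: "'a::real_inner"
  assumes "u \<noteq> 0" "v \<noteq> 0" "w \<noteq> 0"
  shows "vang u w \<le> vang u v + vang v w"
proof (cases "vang u v + vang v w \<le> pi")
  case True
  define x y z where "x = u /\<^sub>R norm u" and "y = v /\<^sub>R norm v" and "z = w /\<^sub>R norm w"
  have n: "norm x = 1" "norm y = 1" "norm z = 1" using assms by (simp_all add: x_def y_def z_def)
  have c: "cos (vang u v) = x \<bullet> y" "cos (vang v w) = z \<bullet> y" "cos (vang u w) = x \<bullet> z"
    by (simp_all add: cos_vang x_def y_def z_def inner_commute divide_inverse mult_ac)
  have yy: "y \<bullet> y = 1" using n by (simp add: dot_square_norm)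
  have s: "sin (vang u v) = norm (x - (x \<bullet> y) *\<^sub>R y)" "sin (vang v w) = norm (z - (z \<bullet> y) *\<^sub>R y)"
    using norm_minus_projection[OF n(1,2)] norm_minus_projection[OF n(3,2)] sin_ge_zero vang_bounds
      sin_cos_squared_add2 c
    by (metis add_diff_cancel_right' norm_ge_zero power2_eq_imp_eq sin_squared_eq)+
  have "cos (vang u v + vang v w) = (x \<bullet> y) * (z \<bullet> y) - norm (x - (x \<bullet> y) *\<^sub>R y) * norm (z - (z \<bullet> y) *\<^sub>R y)"
    by (simp add: cos_add c s)
  also have "\<dots> \<le> (x \<bullet> y) * (z \<bullet> y) + (x - (x \<bullet> y) *\<^sub>R y) \<bullet> (z - (z \<bullet> y) *\<^sub>R y)"
    using Cauchy_Schwarz_ineq2[of "x - (x \<bullet> y) *\<^sub>R y" "z - (z \<bullet> y) *\<^sub>R y"] by linarith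
  also have "\<dots> = cos (vang u w)"
    by (simp add: c inner_diff_left inner_diff_right yy inner_commute)
  finally have "cos (vang u v + vang v w) \<le> cos (vang u w)" .
  then show ?thesis
    using cos_monotone_0_pi[of "vang u v + vang v w" "vang u w"] vang_bounds
    by (meson add_nonneg_nonneg not_le)
next
  case False
  then show ?thesis using vang_bounds(2)[of u w] by linarith
qed

lemma cosine_law_cmod: "cosine_law r s \<phi> = (cmod (of_real r - of_real s * cis \<phi>))\<^sup>2"
proof -
  have "(cmod (of_real r - of_real s * cis \<phi>))\<^sup>2 = r\<^sup>2 + s\<^sup>2 * ((cos \<phi>)\<^sup>2 + (sin \<phi>)\<^sup>2) - 2 * r * s * cos \<phi>"
    unfolding cmod_power2 by (simp add: power2_diff power_mult_distrib distrib_left del: sin_cos_squared_add2)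
  then show ?thesis by (simp add: cosine_law_def)
qed

lemma cosine_law_nonneg: "0 \<le> cosine_law r s \<phi>"
  by (simp add: cosine_law_cmod)

lemma cosine_law_mono:
  assumes "0 \<le> r" "0 \<le> s" "0 \<le> \<phi>" "\<phi> \<le> \<psi>" "\<psi> \<le> pi"
  shows "cosine_law r s \<phi> \<le> cosine_law r s \<psi>"
proof -
  have "cos \<psi> \<le> cos \<phi>" using assms by (intro cos_monotone_0_pi_le) auto
  then show ?thesis using assms unfolding cosine_law_def by (simp add: mult_left_mono)
qed

lemma cosine_law_triangle_add:
  "sqrt (cosine_law r t (\<phi> + \<psi>)) \<le> sqrt (cosine_law r s \<phi>) + sqrt (cosine_law s t \<psi>)"
proof -
  have "cmod (of_real s - of_real t * cis \<psi>) = cmod (cis \<phi> * (of_real s - of_real t * cis \<psi>))"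
    by (simp add: norm_mult)
  also have "cis \<phi> * (of_real s - of_real t * cis \<psi>) = of_real s * cis \<phi> - of_real t * cis (\<phi> + \<psi>)"
    by (simp add: algebra_simps cis_mult)
  finally show ?thesis
    using norm_triangle_ineq[of "of_real r - of_real s * cis \<phi>" "of_real s * cis \<phi> - of_real t * cis (\<phi> + \<psi>)"]
    by (simp add: cosine_law_cmod)
qed

lemma cosine_law_triangle:
  assumes "0 \<le> r" "0 \<le> s" "0 \<le> t" "0 \<le> \<phi>" "\<phi> \<le> pi" "0 \<le> \<psi>" "\<psi> \<le> pi" "0 \<le> \<theta>" "\<theta> \<le> pi" "\<theta> \<le> \<phi> + \<psi>"
  shows "sqrt (cosine_law r t \<theta>) \<le> sqrt (cosine_law r s \<phi>) + sqrt (cosine_law s t \<psi>)"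
proof -
  \<comment> \<open>The cosine law is monotone in the angle only up to \<open>pi\<close>. Shrinking
    the second angle to at most \<open>pi - \<phi>\<close> keeps the sum in this range, and the sum
    still dominates \<open>\<theta>\<close> since \<open>\<theta> \<le> pi\<close>.\<close>
  define \<psi>' where "\<psi>' = min \<psi> (pi - \<phi>)"
  have "sqrt (cosine_law r t \<theta>) \<le> sqrt (cosine_law r t (\<phi> + \<psi>'))"
    using assms by (intro real_sqrt_le_mono cosine_law_mono) (auto simp: \<psi>'_def)
  also have "\<dots> \<le> sqrt (cosine_law r s \<phi>) + sqrt (cosine_law s t \<psi>')"
    by (rule cosine_law_triangle_add)
  also have "sqrt (cosine_law s t \<psi>') \<le> sqrt (cosine_law s t \<psi>)"
    using assms by (intro real_sqrt_le_mono cosine_law_mono) (auto simp: \<psi>'_def)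
  finally show ?thesis by simp
qed

lemma cone_dist2_cosine_law:
  "cone_dist2 lam v w = cosine_law (sqrt (norm v)) (sqrt (norm w)) (min (lam * vang v w) pi)"
  by (simp add: cone_dist2_def cosine_law_def real_sqrt_mult)

lemma cone_dist2_nonneg: "0 \<le> cone_dist2 lam v w"
  by (simp add: cone_dist2_cosine_law cosine_law_nonneg)

lemma cone_dist_triangle:
  fixes u v w :: "'a::real_inner"
  assumes "u \<noteq> 0" "v \<noteq> 0" "w \<noteq> 0" "lam > 0"
  shows "sqrt (cone_dist2 lam u w) \<le> sqrt (cone_dist2 lam u v) + sqrt (cone_dist2 lam v w)"
  unfolding cone_dist2_cosine_law
proof (rule cosine_law_triangle)
  have "lam * vang u w \<le> lam * vang u v + lam * vang v w"
    using vang_triangle[OF assms(1-3)] assms(4) by (simp flip: distrib_left)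
  moreover have "0 \<le> lam * vang u v" "0 \<le> lam * vang v w"
    using assms(4) by (simp_all add: scaled_vang_nonneg)
  ultimately show "min (lam * vang u w) pi \<le> min (lam * vang u v) pi + min (lam * vang v w) pi"
    using pi_gt_zero by linarith
qed (use assms(4) in \<open>simp_all add: scaled_vang_nonneg\<close>)

lemma continuous_on_cone_dist2:
  fixes f g :: "'b::t2_space \<Rightarrow> 'a::real_inner"
  assumes "continuous_on S f" "continuous_on S g" "\<And>x. x \<in> S \<Longrightarrow> f x \<noteq> 0" "\<And>x. x \<in> S \<Longrightarrow> g x \<noteq> 0"
  shows "continuous_on S (\<lambda>x. cone_dist2 lam (f x) (g x))"
  unfolding cone_dist2_def vang_def
  using assms inner_quotient_bound
  by (intro continuous_intros ballI conjI) (auto simp: norm_cauchy_schwarz)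

section \<open>The metric tensor against the distance of nearby vectors\<close>

lemma elastic_form_nonneg: "0 \<le> elastic_form a b v x"
proof -
  have "(v \<bullet> x)\<^sup>2 \<le> (norm v)\<^sup>2 * (norm x)\<^sup>2"
    using Cauchy_Schwarz_ineq[of v x] by (simp add: power2_norm_eq_inner)
  then have "(v \<bullet> x)\<^sup>2 / (norm v)\<^sup>2 \<le> (norm x)\<^sup>2"
    by (cases "v = 0") (auto simp: divide_simps mult.commute)
  then show ?thesis unfolding elastic_form_def by (intro divide_nonneg_nonneg add_nonneg_nonneg mult_nonneg_nonneg) auto
qed

text \<open>
  With \<open>z = (|w| / |v|) exp(i \<angle>(v, w))\<close>, the map \<open>z \<mapsto> |z|\<^sup>1\<^sup>/\<^sup>2 exp(i lam arg z)\<close> develops the cone over the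
  plane spanned by \<open>v\<close> and \<open>w\<close> isometrically, up to the scale \<open>|v|\<^sup>1\<^sup>/\<^sup>2\<close>. Its differential at 1 is the metric
  tensor, so that one limit at \<open>z = 1\<close> compares metric and distance uniformly in \<open>v\<close>.
\<close>

definition cone_chart :: "real \<Rightarrow> complex \<Rightarrow> complex" where
  "cone_chart lam z = exp (Complex (Re (Ln z) / 2) (lam * Im (Ln z)))"

definition cone_lin :: "real \<Rightarrow> complex \<Rightarrow> complex" where
  "cone_lin lam h = Complex (Re h / 2) (lam * Im h)"

lemma bounded_linear_cone_lin: "bounded_linear (cone_lin lam)"
proof -
  have "cone_lin lam = (\<lambda>h. complex_of_real (Re h * (1/2)) + \<i> * complex_of_real (Im h * lam))"
    by (auto simp: cone_lin_def complex_eq_iff)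
  then show ?thesis
    by (simp only:) (intro bounded_linear_add bounded_linear_const_mult bounded_linear_of_real[THEN bounded_linear_compose]
        bounded_linear_mult_const bounded_linear_Re bounded_linear_Im)
qed

lemma cone_chart_derivative: "(cone_chart lam has_derivative cone_lin lam) (at 1)"
proof -
  have "(Ln has_field_derivative 1) (at 1)"
    using has_field_derivative_Ln[of 1] by simp
  then have "(Ln has_derivative (\<lambda>h. h)) (at 1)"
    by (simp add: has_field_derivative_def mult_1_left[abs_def])
  then have "((\<lambda>z. cone_lin lam (Ln z)) has_derivative (\<lambda>h. cone_lin lam h)) (at 1)"
    by (rule bounded_linear.has_derivative[OF bounded_linear_cone_lin])
  moreover have "(exp has_derivative (\<lambda>h. h)) (at (cone_lin lam (Ln 1)))"
  proof -
    have "cone_lin lam (Ln 1) = 0" by (simp add: cone_lin_def complex_eq_iff)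
    then show ?thesis using DERIV_exp[of "0::complex"] by (simp add: has_field_derivative_def mult_1_left[abs_def])
  qed
  ultimately have "((\<lambda>z. exp (cone_lin lam (Ln z))) has_derivative (\<lambda>h. cone_lin lam h)) (at 1)"
    using has_derivative_compose by blast
  then show ?thesis by (simp add: cone_chart_def[abs_def] cone_lin_def[abs_def])
qed

text \<open>Differentiability leaves a remainder that is small relative to \<open>cmod h\<close>;
  this bound makes it small relative to the metric tensor.\<close>

lemma cone_lin_lower: "min (1/2) \<bar>lam\<bar> * cmod h \<le> cmod (cone_lin lam h)"
proof (rule power2_le_imp_le)
  let ?m = "min (1/2) \<bar>lam\<bar>"
  have "?m\<^sup>2 \<le> (1/2)\<^sup>2" "?m\<^sup>2 \<le> \<bar>lam\<bar>\<^sup>2" by (intro power_mono; simp)+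
  then have "?m\<^sup>2 * (Re h)\<^sup>2 + ?m\<^sup>2 * (Im h)\<^sup>2 \<le> (1/2)\<^sup>2 * (Re h)\<^sup>2 + lam\<^sup>2 * (Im h)\<^sup>2"
    by (intro add_mono mult_right_mono) auto
  then show "(?m * cmod h)\<^sup>2 \<le> (cmod (cone_lin lam h))\<^sup>2"
    by (simp add: power_mult_distrib cmod_power2 cone_lin_def distrib_left power_divide)
qed simp

lemma cone_chart_comparison:
  assumes "e > 0" "lam > 0"
  obtains k where "k > 0" "\<And>z. cmod (z - 1) < k \<Longrightarrow>
     \<bar>cmod (cone_chart lam z - 1) - cmod (cone_lin lam (z - 1))\<bar> \<le> e * cmod (cone_lin lam (z - 1))"
proof -
  let ?m = "min (1/2) \<bar>lam\<bar>"
  have m: "?m > 0" using assms by auto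
  have "cone_chart lam 1 = 1"
    by (simp add: cone_chart_def complex_eq_iff Re_exp Im_exp)
  moreover obtain k where k: "k > 0" "\<And>z. cmod (z - 1) < k \<Longrightarrow>
    cmod (cone_chart lam z - cone_chart lam 1 - cone_lin lam (z - 1)) \<le> (e * ?m) * cmod (z - 1)"
    using cone_chart_derivative[of lam] m assms unfolding has_derivative_at_alt
    by (metis mult_pos_pos)
  ultimately have *: "cmod (cone_chart lam z - 1 - cone_lin lam (z - 1)) \<le> e * cmod (cone_lin lam (z - 1))"
    if "cmod (z - 1) < k" for z
  proof -
    have "cmod (cone_chart lam z - 1 - cone_lin lam (z - 1)) \<le> e * (?m * cmod (z - 1))"
      using k(2)[OF that] \<open>cone_chart lam 1 = 1\<close> by (simp add: mult.assoc)
    also have "\<dots> \<le> e * cmod (cone_lin lam (z - 1))"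
      using assms(1) by (intro mult_left_mono cone_lin_lower) auto
    finally show ?thesis .
  qed
  show thesis
    by (rule that[OF k(1)]) (use * norm_triangle_ineq3 order_trans in blast)
qed

text \<open>Closeness is measured relative to \<open>norm v\<close>, which is the scale invariance
  of the cone; hence one \<open>k\<close> serves all \<open>v\<close>, and later all
  \<open>u\<close> at once.\<close>

lemma cone_dist2_local:
  fixes lam a b :: real
  assumes "e > 0" "a > 0" "b > 0" "lam = a / (2 * b)"
  obtains k where "0 < k" "k < 1" "\<And>v w :: 'a::real_inner. v \<noteq> 0 \<Longrightarrow> norm (w - v) \<le> k * norm v \<Longrightarrow>
     (1 - e) * sqrt (elastic_form a b v (w - v)) \<le> 2 * b * sqrt (cone_dist2 lam v w) \<and>
     2 * b * sqrt (cone_dist2 lam v w) \<le> (1 + e) * sqrt (elastic_form a b v (w - v))"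
proof -
  have lam: "lam > 0" using assms by simp
  obtain k1 where k1: "k1 > 0" "\<And>z. cmod (z - 1) < k1 \<Longrightarrow>
     \<bar>cmod (cone_chart lam z - 1) - cmod (cone_lin lam (z - 1))\<bar> \<le> e * cmod (cone_lin lam (z - 1))"
    using cone_chart_comparison[OF assms(1) lam] by blast
  \<comment> \<open>The radius \<open>k2\<close> keeps \<open>lam * vang v w\<close> below
    \<open>pi\<close>, where the cut-off in \<open>cone_dist2\<close> is inactive and the chart
    computes the distance.\<close>
  have "isCont Ln (1::complex)" by (intro continuous_at_Ln) auto
  then obtain k2 where k2: "k2 > 0" "\<And>z. cmod (z - 1) < k2 \<Longrightarrow> cmod (Ln z) < pi / lam"
    unfolding continuous_at_eps_delta dist_norm using lam pi_gt_zero
    by (metis Ln_1 diff_zero divide_pos_pos)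
  define k where "k = min (1/2) (min k1 k2 / 2)"
  have k: "0 < k" "k < 1" "k < k1" "k < k2" using k1(1) k2(1) by (auto simp: k_def)
  show thesis
  proof (rule that[OF k(1,2)])
    fix v w :: 'a assume v: "v \<noteq> 0" and vw: "norm (w - v) \<le> k * norm v"
    define n where "n = norm v"
    have n: "n > 0" using v by (simp add: n_def)
    have w: "w \<noteq> 0"
    proof
      assume "w = 0"
      then show False using vw k(2) v by simp
    qed
    have vv: "v \<bullet> v = n\<^sup>2" and ww: "w \<bullet> w = (norm w)\<^sup>2" by (simp_all add: n_def dot_square_norm)
    have cs: "(v \<bullet> w)\<^sup>2 \<le> n\<^sup>2 * (norm w)\<^sup>2" using Cauchy_Schwarz_ineq[of v w] vv ww by simp
    \<comment> \<open>Coordinates of \<open>w\<close> along \<open>v\<close> and orthogonal to it,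
      scaled so that \<open>v\<close> becomes 1. The nonnegative root puts \<open>z\<close> into the
      upper half plane, where the argument is the unoriented angle.\<close>
    define z where "z = Complex ((v \<bullet> w) / n\<^sup>2) (sqrt (n\<^sup>2 * (norm w)\<^sup>2 - (v \<bullet> w)\<^sup>2) / n\<^sup>2)"
    have Im2: "(Im z)\<^sup>2 = (norm w)\<^sup>2 / n\<^sup>2 - ((v \<bullet> w) / n\<^sup>2)\<^sup>2"
      using cs n by (simp add: z_def power_divide field_simps eval_nat_numeral)
    have "(cmod z)\<^sup>2 = (norm w / n)\<^sup>2" unfolding cmod_power2 Im2 by (simp add: z_def power_divide)
    then have cz: "cmod z = norm w / n" using n by (simp add: power2_eq_iff_nonneg)
    have z0: "z \<noteq> 0" using cz n w by auto
    define d where "d = w - v"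
    have vd: "v \<bullet> d = v \<bullet> w - n\<^sup>2" by (simp add: d_def inner_diff_right vv)
    have Re1: "Re (z - 1) = (v \<bullet> d) / n\<^sup>2" using n by (simp add: z_def vd field_simps)
    have dd: "(norm d)\<^sup>2 = (norm w)\<^sup>2 - 2 * (v \<bullet> w) + n\<^sup>2"
      by (simp add: d_def power2_norm_eq_inner inner_diff_left inner_diff_right inner_commute vv)
    have Im1: "(Im (z - 1))\<^sup>2 = (norm d)\<^sup>2 / n\<^sup>2 - ((v \<bullet> d) / n\<^sup>2)\<^sup>2"
    proof -
      have "(Im (z - 1))\<^sup>2 = (norm w)\<^sup>2 / n\<^sup>2 - ((v \<bullet> w) / n\<^sup>2)\<^sup>2" using Im2 by simp
      also have "\<dots> = (norm d)\<^sup>2 / n\<^sup>2 - ((v \<bullet> d) / n\<^sup>2)\<^sup>2"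
        unfolding dd vd using n by (simp add: field_simps eval_nat_numeral)
      finally show ?thesis .
    qed
    have "(cmod (z - 1))\<^sup>2 = (norm d / n)\<^sup>2" unfolding cmod_power2 Re1 Im1 by (simp add: power_divide)
    then have z1: "cmod (z - 1) = norm d / n" using n by (simp add: power2_eq_iff_nonneg)
    then have zk: "cmod (z - 1) \<le> k" using vw n by (simp add: d_def n_def pos_divide_le_eq)
    have ImLn: "0 \<le> Im (Ln z)" "Im (Ln z) \<le> pi"
    proof -
      have "0 \<le> Im z" using cs by (simp add: z_def)
      then show "0 \<le> Im (Ln z)" using Im_Ln_pos_le[OF z0] by simp
      show "Im (Ln z) \<le> pi" using Im_Ln_le_pi z0 by blast
    qed
    have "Re z = cmod z * cos (Im (Ln z))"
      using Re_exp[of "Ln z"] z0 by (simp add: Re_Ln)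
    then have "cos (Im (Ln z)) = (v \<bullet> w) / (norm v * norm w)"
      unfolding cz using n w by (simp add: z_def n_def field_simps power2_eq_square)
    then have ang: "Im (Ln z) = vang v w"
      unfolding vang_def using ImLn by (metis arccos_cos)
    have lt: "lam * vang v w < pi"
    proof -
      have "Im (Ln z) < pi / lam" using k2(2)[of z] zk k abs_Im_le_cmod[of "Ln z"] by linarith
      then show ?thesis using lam by (simp add: ang field_simps)
    qed
    have ReLn: "exp (Re (Ln z) / 2) = sqrt (cmod z)"
      using z0 by (simp add: Re_Ln exp_half_le2 ln_sqrt[symmetric])
    have "cone_chart lam z = of_real (sqrt (cmod z)) * cis (lam * vang v w)"
      unfolding cone_chart_def ang ReLn[symmetric] by (simp add: exp_eq_polar)
    then have "(cmod (cone_chart lam z - 1))\<^sup>2 = cosine_law 1 (sqrt (cmod z)) (lam * vang v w)"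
      by (simp add: cosine_law_cmod norm_minus_commute)
    then have "n * (cmod (cone_chart lam z - 1))\<^sup>2 = cone_dist2 lam v w"
    proof -
      have "n * cosine_law 1 (sqrt (norm w / n)) (lam * vang v w)
        = n + n * (norm w / n) - 2 * (n * sqrt (norm w / n)) * cos (lam * vang v w)"
        using n by (simp add: cosine_law_def algebra_simps)
      also have "n * sqrt (norm w / n) = sqrt (n * norm w)"
      proof -
        have "n * sqrt (norm w / n) = sqrt (n\<^sup>2 * (norm w / n))" unfolding real_sqrt_mult using n by simp
        also have "n\<^sup>2 * (norm w / n) = n * norm w" using n by (simp add: power2_eq_square)
        finally show ?thesis .
      qed
      finally show ?thesis
        using n lt \<open>(cmod (cone_chart lam z - 1))\<^sup>2 = cosine_law 1 (sqrt (cmod z)) (lam * vang v w)\<close>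
        by (simp add: cz cone_dist2_def n_def[symmetric])
    qed
    then have A: "2 * b * sqrt (cone_dist2 lam v w) = 2 * b * sqrt n * cmod (cone_chart lam z - 1)"
      using n by (simp add: real_sqrt_mult flip: \<open>n * (cmod (cone_chart lam z - 1))\<^sup>2 = cone_dist2 lam v w\<close>)
    have "4 * b\<^sup>2 * n * (cmod (cone_lin lam (z - 1)))\<^sup>2 = elastic_form a b v d"
    proof -
      have "4 * b\<^sup>2 * n * (cmod (cone_lin lam (z - 1)))\<^sup>2 = 4 * b\<^sup>2 * n * ((Re (z - 1) / 2)\<^sup>2 + lam\<^sup>2 * (Im (z - 1))\<^sup>2)"
        by (simp add: cmod_power2 cone_lin_def power_mult_distrib)
      also have "\<dots> = b\<^sup>2 * n * ((v \<bullet> d) / n\<^sup>2)\<^sup>2 + (2 * b * lam)\<^sup>2 * n * ((norm d)\<^sup>2 / n\<^sup>2 - ((v \<bullet> d) / n\<^sup>2)\<^sup>2)"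
        unfolding Re1 Im1 by (simp add: power_mult_distrib power_divide algebra_simps)
      also have "2 * b * lam = a" using assms by simp
      also have "b\<^sup>2 * n * ((v \<bullet> d) / n\<^sup>2)\<^sup>2 + a\<^sup>2 * n * ((norm d)\<^sup>2 / n\<^sup>2 - ((v \<bullet> d) / n\<^sup>2)\<^sup>2) = elastic_form a b v d"
        unfolding elastic_form_def n_def[symmetric] using n by (simp add: field_simps eval_nat_numeral)
      finally show ?thesis .
    qed
    then have B: "sqrt (elastic_form a b v d) = 2 * b * sqrt n * cmod (cone_lin lam (z - 1))"
      using assms(3) n by (simp add: real_sqrt_mult flip: \<open>4 * b\<^sup>2 * n * (cmod (cone_lin lam (z - 1)))\<^sup>2 = elastic_form a b v d\<close>)
    have C: "\<bar>cmod (cone_chart lam z - 1) - cmod (cone_lin lam (z - 1))\<bar> \<le> e * cmod (cone_lin lam (z - 1))"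
      using k1(2) zk k by auto
    have "(1 - e) * cmod (cone_lin lam (z - 1)) \<le> cmod (cone_chart lam z - 1)"
      "cmod (cone_chart lam z - 1) \<le> (1 + e) * cmod (cone_lin lam (z - 1))"
      using C by (simp_all add: algebra_simps abs_le_iff)
    then have "2 * b * sqrt n * ((1 - e) * cmod (cone_lin lam (z - 1))) \<le> 2 * b * sqrt n * cmod (cone_chart lam z - 1)"
      "2 * b * sqrt n * cmod (cone_chart lam z - 1) \<le> 2 * b * sqrt n * ((1 + e) * cmod (cone_lin lam (z - 1)))"
      using n assms(3) by (intro mult_left_mono; simp)+
    then show "(1 - e) * sqrt (elastic_form a b v (w - v)) \<le> 2 * b * sqrt (cone_dist2 lam v w) \<and>
     2 * b * sqrt (cone_dist2 lam v w) \<le> (1 + e) * sqrt (elastic_form a b v (w - v))"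
      unfolding A d_def[symmetric] B by (simp add: algebra_simps)
  qed
qed

lemma norm_normalized_diff:
  fixes v v' :: "'a::real_inner"
  assumes "v \<noteq> 0" "v' \<noteq> 0"
  shows "norm (v' /\<^sub>R norm v' - v /\<^sub>R norm v) \<le> 2 * norm (v' - v) / norm v"
proof -
  have "v' /\<^sub>R norm v' - v /\<^sub>R norm v = (v' - v) /\<^sub>R norm v + (inverse (norm v') - inverse (norm v)) *\<^sub>R v'"
    by (simp add: algebra_simps)
  also have "norm \<dots> \<le> norm (v' - v) / norm v + \<bar>inverse (norm v') - inverse (norm v)\<bar> * norm v'"
    by (rule order_trans[OF norm_triangle_ineq]) (simp add: divide_inverse mult.commute)
  also have "\<bar>inverse (norm v') - inverse (norm v)\<bar> * norm v' = \<bar>norm v - norm v'\<bar> / norm v"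
    using assms by (simp add: inverse_diff_inverse abs_mult abs_minus_commute field_simps)
  also have "\<dots> \<le> norm (v' - v) / norm v"
    using norm_triangle_ineq3[of v v'] by (intro divide_right_mono) (auto simp: norm_minus_commute)
  finally show ?thesis by simp
qed

text \<open>After multiplication by \<open>norm v\<close> only the direction of \<open>v\<close>
  enters, so a perturbation of \<open>v\<close> reduces to one of a unit vector and one of a scalar
  factor.\<close>

lemma elastic_form_alt:
  assumes "v \<noteq> 0"
  shows "elastic_form a b v x * norm v = a\<^sup>2 * (norm x)\<^sup>2 + (b\<^sup>2 - a\<^sup>2) * ((v /\<^sub>R norm v) \<bullet> x)\<^sup>2"
  using assms by (simp add: elastic_form_def power_mult_distrib power_divide inverse_eq_divide field_simps)

lemma elastic_form_lower:
  assumes "v \<noteq> 0"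
  shows "min (a\<^sup>2) (b\<^sup>2) * (norm x)\<^sup>2 \<le> elastic_form a b v x * norm v"
proof -
  let ?p = "((v /\<^sub>R norm v) \<bullet> x)\<^sup>2"
  have "(v /\<^sub>R norm v) \<bullet> (v /\<^sub>R norm v) = 1" using assms by (simp add: dot_square_norm power2_eq_square)
  then have "?p \<le> (norm x)\<^sup>2"
    using Cauchy_Schwarz_ineq[of "v /\<^sub>R norm v" x] by (simp add: power2_norm_eq_inner)
  moreover have "elastic_form a b v x * norm v = a\<^sup>2 * ((norm x)\<^sup>2 - ?p) + b\<^sup>2 * ?p"
    unfolding elastic_form_alt[OF assms] by (simp add: algebra_simps)
  moreover have "min (a\<^sup>2) (b\<^sup>2) * ((norm x)\<^sup>2 - ?p) \<le> a\<^sup>2 * ((norm x)\<^sup>2 - ?p)"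
    using calculation(1) by (intro mult_right_mono) auto
  moreover have "min (a\<^sup>2) (b\<^sup>2) * ?p \<le> b\<^sup>2 * ?p"
    by (intro mult_right_mono) auto
  ultimately show ?thesis by (simp add: algebra_simps)
qed

text \<open>This serves on the edges of a polygon: the speed at an interior point of an edge is
  compared with the tensor at its initial point.\<close>

lemma elastic_form_perturb:
  assumes "e > 0" "a > 0" "b > 0"
  obtains k where "0 < k" "k < 1" "\<And>v v' x :: 'a::real_inner. v \<noteq> 0 \<Longrightarrow> norm (v' - v) \<le> k * norm v \<Longrightarrow>
    elastic_form a b v' x \<le> (1 + e) * elastic_form a b v x"
proof -
  define m where "m = min (a\<^sup>2) (b\<^sup>2)"
  have m: "m > 0" using assms by (simp add: m_def)
  define C where "C = 4 * \<bar>b\<^sup>2 - a\<^sup>2\<bar> / m"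
  have C: "C \<ge> 0" using m by (simp add: C_def)
  \<comment> \<open>Moving the direction costs a factor \<open>1 + C * k\<close>, and
    \<open>norm v' \<ge> (1 - k) * norm v\<close> costs \<open>1 / (1 - k)\<close>. This
    \<open>k\<close> is the solution of \<open>1 + C * k = (1 + e) * (1 - k)\<close>.\<close>
  define k where "k = e / (C + 1 + e)"
  have k: "0 < k" "k < 1" using assms C by (simp_all add: k_def)
  have kC: "1 + C * k = (1 + e) * (1 - k)" using C assms by (simp add: k_def field_simps)
  show thesis
  proof (rule that[OF k])
    fix v v' x :: 'a assume v: "v \<noteq> 0" and vv': "norm (v' - v) \<le> k * norm v"
    let ?y = "v /\<^sub>R norm v" and ?y' = "v' /\<^sub>R norm v'"
    have n': "(1 - k) * norm v \<le> norm v'"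
      using vv' norm_triangle_ineq2[of v v'] by (simp add: norm_minus_commute algebra_simps)
    then have v': "v' \<noteq> 0" using k v by (auto simp: mult_le_0_iff)
    have "norm (?y' - ?y) \<le> 2 * norm (v' - v) / norm v"
      by (rule norm_normalized_diff[OF v v'])
    also have "\<dots> \<le> 2 * k" using vv' v by (simp add: divide_le_eq)
    finally have y: "norm (?y' - ?y) \<le> 2 * k" .
    have y2: "norm (?y' + ?y) \<le> 2" using norm_triangle_ineq[of ?y' ?y] v v' by simp
    have "\<bar>(?y' \<bullet> x)\<^sup>2 - (?y \<bullet> x)\<^sup>2\<bar> = \<bar>(?y' - ?y) \<bullet> x\<bar> * \<bar>(?y' + ?y) \<bullet> x\<bar>"
      unfolding abs_mult[symmetric] by (simp add: inner_diff_left inner_add_left power2_eq_square algebra_simps)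
    also have "\<dots> \<le> (2 * k * norm x) * (2 * norm x)"
    proof (intro mult_mono)
      show "\<bar>(?y' - ?y) \<bullet> x\<bar> \<le> 2 * k * norm x"
        using Cauchy_Schwarz_ineq2[of "?y' - ?y" x] mult_right_mono[OF y norm_ge_zero[of x]] by linarith
      show "\<bar>(?y' + ?y) \<bullet> x\<bar> \<le> 2 * norm x"
        using Cauchy_Schwarz_ineq2[of "?y' + ?y" x] mult_right_mono[OF y2 norm_ge_zero[of x]] by linarith
    qed (use k in auto)
    finally have d: "\<bar>(?y' \<bullet> x)\<^sup>2 - (?y \<bullet> x)\<^sup>2\<bar> \<le> 4 * k * (norm x)\<^sup>2" by (simp add: power2_eq_square mult_ac)
    have "elastic_form a b v' x * norm v' - elastic_form a b v x * norm v = (b\<^sup>2 - a\<^sup>2) * ((?y' \<bullet> x)\<^sup>2 - (?y \<bullet> x)\<^sup>2)"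
      unfolding elastic_form_alt[OF v] elastic_form_alt[OF v'] by (simp add: algebra_simps)
    also have "\<dots> \<le> \<bar>b\<^sup>2 - a\<^sup>2\<bar> * \<bar>(?y' \<bullet> x)\<^sup>2 - (?y \<bullet> x)\<^sup>2\<bar>" unfolding abs_mult[symmetric] by (rule abs_ge_self)
    also have "\<dots> \<le> \<bar>b\<^sup>2 - a\<^sup>2\<bar> * (4 * k * (norm x)\<^sup>2)" by (rule mult_left_mono[OF d]) simp
    also have "\<dots> = C * k * (m * (norm x)\<^sup>2)" using m by (simp add: C_def)
    also have "\<dots> \<le> C * k * (elastic_form a b v x * norm v)"
      using elastic_form_lower[OF v, of a b x] C k by (intro mult_left_mono) (auto simp: m_def)
    finally have "elastic_form a b v' x * norm v' \<le> (1 + C * k) * (elastic_form a b v x * norm v)"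
      by (simp add: algebra_simps)
    also have "\<dots> = (1 + e) * elastic_form a b v x * ((1 - k) * norm v)" unfolding kC by (simp add: algebra_simps)
    also have "\<dots> \<le> (1 + e) * elastic_form a b v x * norm v'"
      using n' assms elastic_form_nonneg[of a b v x] by (intro mult_left_mono) auto
    finally show "elastic_form a b v' x \<le> (1 + e) * elastic_form a b v x" using v' by simp
  qed
qed

text \<open>
  Polar coordinates of the point \<open>(1 - t) r + t s exp(i \<phi>)\<close> of a chord in a planar sector.
\<close>

definition sector_x :: "real \<Rightarrow> real \<Rightarrow> real \<Rightarrow> real \<Rightarrow> real" where
  "sector_x r s \<phi> t = (1 - t) * r + t * s * cos \<phi>"
definition sector_y :: "real \<Rightarrow> real \<Rightarrow> real \<Rightarrow> real" where
  "sector_y s \<phi> t = t * s * sin \<phi>"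
definition sector_radius :: "real \<Rightarrow> real \<Rightarrow> real \<Rightarrow> real \<Rightarrow> real" where
  "sector_radius r s \<phi> t = sqrt ((sector_x r s \<phi> t)\<^sup>2 + (sector_y s \<phi> t)\<^sup>2)"
definition sector_angle :: "real \<Rightarrow> real \<Rightarrow> real \<Rightarrow> real \<Rightarrow> real" where
  "sector_angle r s \<phi> t = arccos (sector_x r s \<phi> t / sector_radius r s \<phi> t)"

lemma
  assumes "r > 0" "s > 0" "0 < \<phi>" "\<phi> < pi" "0 \<le> t" "t \<le> 1"
  shows sector_radius_pos: "sector_radius r s \<phi> t > 0"
    and sector_quotient_bounds: "- 1 \<le> sector_x r s \<phi> t / sector_radius r s \<phi> t" "sector_x r s \<phi> t / sector_radius r s \<phi> t \<le> 1"
    and sector_angle_bounds: "0 \<le> sector_angle r s \<phi> t" "sector_angle r s \<phi> t \<le> pi"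
    and sector_cos: "sector_radius r s \<phi> t * cos (sector_angle r s \<phi> t) = sector_x r s \<phi> t"
    and sector_sin: "sector_radius r s \<phi> t * sin (sector_angle r s \<phi> t) = sector_y s \<phi> t"
proof -
  let ?x = "sector_x r s \<phi> t" and ?y = "sector_y s \<phi> t" and ?R = "sector_radius r s \<phi> t"
  have s: "sin \<phi> > 0" using assms by (intro sin_gt_zero) auto
  have y: "?y \<ge> 0" using assms s by (simp add: sector_y_def)
  have "?x \<noteq> 0 \<or> ?y \<noteq> 0"
    using assms s by (cases "t = 0") (auto simp: sector_x_def sector_y_def)
  then have "?x\<^sup>2 + ?y\<^sup>2 > 0" by (metis sum_power2_gt_zero_iff)
  then show R: "?R > 0" by (simp add: sector_radius_def)
  have R2: "?R\<^sup>2 = ?x\<^sup>2 + ?y\<^sup>2" by (simp add: sector_radius_def)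
  have "\<bar>?x\<bar> \<le> ?R" by (simp add: sector_radius_def real_le_rsqrt)
  then show b: "- 1 \<le> ?x / ?R" "?x / ?R \<le> 1" using R by (auto simp: field_simps abs_le_iff)
  then show ab: "0 \<le> sector_angle r s \<phi> t" "sector_angle r s \<phi> t \<le> pi"
    unfolding sector_angle_def by (auto intro: arccos_lbound arccos_ubound)
  have c: "cos (sector_angle r s \<phi> t) = ?x / ?R" unfolding sector_angle_def using b by simp
  then show "?R * cos (sector_angle r s \<phi> t) = ?x" using R by simp
  show "?R * sin (sector_angle r s \<phi> t) = ?y"
  proof (rule power2_eq_imp_eq)
    have "(?R * sin (sector_angle r s \<phi> t))\<^sup>2 = ?R\<^sup>2 * (1 - (?x / ?R)\<^sup>2)"
      by (simp add: power_mult_distrib sin_squared_eq c)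
    also have "\<dots> = ?R\<^sup>2 - ?x\<^sup>2" using R by (simp add: power_divide field_simps)
    finally show "(?R * sin (sector_angle r s \<phi> t))\<^sup>2 = ?y\<^sup>2" by (simp add: R2)
  qed (use R y ab in \<open>auto intro!: mult_nonneg_nonneg sin_ge_zero\<close>)
qed

lemma sector_endpoints:
  assumes "r > 0" "s > 0" "0 < \<phi>" "\<phi> < pi"
  shows "sector_radius r s \<phi> 0 = r" "sector_radius r s \<phi> 1 = s"
    "sector_angle r s \<phi> 0 = 0" "sector_angle r s \<phi> 1 = \<phi>"
proof -
  show R: "sector_radius r s \<phi> 0 = r" using assms by (simp add: sector_radius_def sector_x_def sector_y_def)
  show "sector_angle r s \<phi> 0 = 0" using assms by (simp add: sector_angle_def R) (simp add: sector_x_def)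
  have "(s * cos \<phi>)\<^sup>2 + (s * sin \<phi>)\<^sup>2 = s\<^sup>2" by (simp add: power_mult_distrib flip: distrib_left)
  then show R: "sector_radius r s \<phi> 1 = s" using assms by (simp add: sector_radius_def sector_x_def sector_y_def)
  show "sector_angle r s \<phi> 1 = \<phi>" using assms by (simp add: sector_angle_def R) (simp add: sector_x_def arccos_cos)
qed

text \<open>The chord is traversed with constant speed, so the squared distance of two of its points
  is quadratic in the parameter difference. The triangles that they span with the origin have a
  common height, so twice their signed area is linear in it.\<close>

lemma
  assumes "r > 0" "s > 0" "0 < \<phi>" "\<phi> < pi" "0 \<le> t" "t \<le> 1" "0 \<le> t'" "t' \<le> 1"
  defines "R \<equiv> sector_radius r s \<phi>" and "A \<equiv> sector_angle r s \<phi>"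
  shows sector_cosine_law: "cosine_law (R t) (R t') (A t' - A t) = (t' - t)\<^sup>2 * cosine_law r s \<phi>"
    and sector_area: "R t * R t' * sin (A t' - A t) = (t' - t) * (r * s * sin \<phi>)"
proof -
  let ?x = "sector_x r s \<phi>" and ?y = "sector_y s \<phi>"
  have c: "R t * cos (A t) = ?x t" "R t' * cos (A t') = ?x t'"
    and s: "R t * sin (A t) = ?y t" "R t' * sin (A t') = ?y t'"
    unfolding R_def A_def using assms by (simp_all add: sector_cos sector_sin)
  have R2: "(R t)\<^sup>2 = (?x t)\<^sup>2 + (?y t)\<^sup>2" "(R t')\<^sup>2 = (?x t')\<^sup>2 + (?y t')\<^sup>2"
    by (simp_all add: R_def sector_radius_def)
  have "cosine_law (R t) (R t') (A t' - A t)
    = (R t)\<^sup>2 + (R t')\<^sup>2 - 2 * ((R t * cos (A t)) * (R t' * cos (A t')) + (R t * sin (A t)) * (R t' * sin (A t')))"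
    by (simp add: cosine_law_def cos_diff algebra_simps)
  also have "\<dots> = (?x t' - ?x t)\<^sup>2 + (?y t' - ?y t)\<^sup>2"
    unfolding c s R2 by (simp add: power2_eq_square algebra_simps)
  also have "\<dots> = (t' - t)\<^sup>2 * ((s * cos \<phi> - r)\<^sup>2 + (s * sin \<phi>)\<^sup>2)"
    by (simp add: sector_x_def sector_y_def power2_eq_square algebra_simps)
  also have "(s * cos \<phi> - r)\<^sup>2 + (s * sin \<phi>)\<^sup>2 = cosine_law r s \<phi>"
    by (simp add: cosine_law_def power2_diff power_mult_distrib cos_squared_eq algebra_simps)
  finally show "cosine_law (R t) (R t') (A t' - A t) = (t' - t)\<^sup>2 * cosine_law r s \<phi>" .
  have "R t * R t' * sin (A t' - A t) = (R t * cos (A t)) * (R t' * sin (A t')) - (R t' * cos (A t')) * (R t * sin (A t))"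
    by (simp add: sin_diff algebra_simps)
  also have "\<dots> = (t' - t) * (r * s * sin \<phi>)"
    unfolding c s by (simp add: sector_x_def sector_y_def algebra_simps)
  finally show "R t * R t' * sin (A t' - A t) = (t' - t) * (r * s * sin \<phi>)" .
qed

text \<open>The signed area of the triangle between the two points and the origin is positive, hence
  so is the sine of the angle difference, which lies between \<open>-pi\<close> and
  \<open>pi\<close>.\<close>

lemma sector_angle_mono:
  assumes "r > 0" "s > 0" "0 < \<phi>" "\<phi> < pi" "0 \<le> t" "t < t'" "t' \<le> 1"
  shows "sector_angle r s \<phi> t < sector_angle r s \<phi> t'"
proof (rule ccontr)
  let ?A = "sector_angle r s \<phi>"
  assume "\<not> ?A t < ?A t'"
  then have "sin (?A t - ?A t') \<ge> 0"
    using assms sector_angle_bounds[of r s \<phi> t] sector_angle_bounds[of r s \<phi> t'] by (intro sin_ge_zero) auto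
  then have "sin (?A t' - ?A t) \<le> 0" by (metis minus_diff_eq neg_le_0_iff_le sin_minus)
  then have "sector_radius r s \<phi> t * sector_radius r s \<phi> t' * sin (?A t' - ?A t) \<le> 0"
    using assms sector_radius_pos[of r s \<phi>] by (intro mult_nonneg_nonpos) (auto intro!: mult_nonneg_nonneg less_imp_le)
  moreover have "(t' - t) * (r * s * sin \<phi>) > 0"
    using assms by (auto intro!: mult_pos_pos sin_gt_zero)
  ultimately show False using assms by (simp add: sector_area)
qed

lemma sin_ge_half:
  assumes "0 \<le> x" "x \<le> (1::real)"
  shows "x / 2 \<le> sin x"
proof -
  have "sin 0 - 0 / 2 \<le> sin x - x / 2"
  proof (rule DERIV_nonneg_imp_nondecreasing[OF assms(1)])
    fix y assume y: "0 \<le> y" "y \<le> x"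
    have "cos (pi / 3) \<le> cos y"
      using y assms pi_gt3 by (intro cos_monotone_0_pi_le) auto
    then have "0 \<le> cos y - 1/2" by (simp add: cos_60)
    moreover have "((\<lambda>x. sin x - x / 2) has_real_derivative cos y - 1/2) (at y)"
      by (auto intro!: derivative_eq_intros)
    ultimately show "\<exists>d. ((\<lambda>x. sin x - x / 2) has_real_derivative d) (at y) \<and> 0 \<le> d" by blast
  qed
  then show ?thesis by simp
qed

text \<open>For \<open>k \<le> 1\<close> monotonicity of the cosine leaves nothing to pay. Otherwise
  the product formula and \<open>|sin y| \<le> |y|\<close> give a bound that is quadratic in the
  angle, which is the order needed to sum over a subdivision.\<close>

lemma cos_diff_scaled:
  assumes "0 \<le> x" "0 \<le> k" "k * x \<le> pi" "x \<le> pi"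
  shows "cos x - cos (k * x) \<le> max 0 (k\<^sup>2 - 1) * (x\<^sup>2 / 2)"
proof (cases "k \<le> 1")
  case True
  have "cos x \<le> cos (k * x)"
    using assms True mult_right_mono[of k 1 x] by (intro cos_monotone_0_pi_le) auto
  moreover have "0 \<le> max 0 (k\<^sup>2 - 1) * (x\<^sup>2 / 2)" by simp
  ultimately show ?thesis by linarith
next
  case False
  have "cos x - cos (k * x) = 2 * (sin ((x + k * x) / 2) * sin ((k * x - x) / 2))"
    by (simp add: cos_diff_cos)
  also have "sin ((x + k * x) / 2) * sin ((k * x - x) / 2) \<le> \<bar>sin ((x + k * x) / 2)\<bar> * \<bar>sin ((k * x - x) / 2)\<bar>"
    unfolding abs_mult[symmetric] by simp
  also have "\<dots> \<le> \<bar>(x + k * x) / 2\<bar> * \<bar>(k * x - x) / 2\<bar>"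
    by (intro mult_mono abs_sin_x_le_abs_x) auto
  also have "\<dots> = ((x + k * x) / 2) * ((k * x - x) / 2)"
    using False assms mult_right_mono[of 1 k x] by simp
  also have "2 * \<dots> = (k\<^sup>2 - 1) * (x\<^sup>2 / 2)"
    by (simp add: power2_eq_square field_simps)
  finally show ?thesis using one_le_power[of k 2] False by simp
qed

text \<open>
  The angle along the chord is stretched by the factor \<open>k\<close>. Consecutive subdivision points span triangles of
  equal area \<open>r s sin \<phi> / (2 N)\<close>; this makes the cost of stretching small when \<open>\<phi>\<close> is close to \<open>\<pi>\<close>.
\<close>

lemma sector_sum:
  assumes "r > 0" "s > 0" "0 < \<phi>" "\<phi> < pi" "0 \<le> k" "N > 0"
  defines "R \<equiv> \<lambda>i. sector_radius r s \<phi> (real i / real N)" and "A \<equiv> \<lambda>i. sector_angle r s \<phi> (real i / real N)"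
  assumes small: "\<And>i. i < N \<Longrightarrow> A (Suc i) - A i \<le> 1 \<and> k * (A (Suc i) - A i) \<le> pi"
  shows "real N * (\<Sum>i<N. cosine_law (R i) (R (Suc i)) (k * (A (Suc i) - A i)))
    \<le> cosine_law r s \<phi> + max 0 (k\<^sup>2 - 1) * (2 * (r * s * sin \<phi>) * \<phi>)"
proof -
  define K where "K = max 0 (k\<^sup>2 - 1)"
  define S where "S = r * s * sin \<phi>"
  have each: "cosine_law (R i) (R (Suc i)) (k * (A (Suc i) - A i))
      \<le> cosine_law r s \<phi> / (real N)\<^sup>2 + K * 2 * S / real N * (A (Suc i) - A i)" if i: "i < N" for i
  proof -
    define x where "x = A (Suc i) - A i"
    have t: "0 \<le> real i / real N" "real i / real N < real (Suc i) / real N" "real (Suc i) / real N \<le> 1"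
      using i by (auto simp: field_simps)
    have x0: "0 \<le> x" using sector_angle_mono[OF assms(1-4) t] by (simp add: x_def A_def)
    have x1: "x \<le> 1" "k * x \<le> pi" using small[OF i] by (simp_all add: x_def)
    have d: "real (Suc i) / real N - real i / real N = 1 / real N" by (simp add: diff_divide_distrib[symmetric])
    have R: "0 < R i * R (Suc i)"
      unfolding R_def using t assms by (intro mult_pos_pos sector_radius_pos) auto
    note t' = t(1) order.trans[OF less_imp_le[OF t(2)] t(3)] order.trans[OF t(1) less_imp_le[OF t(2)]] t(3)
    have law: "cosine_law (R i) (R (Suc i)) x = cosine_law r s \<phi> / (real N)\<^sup>2"
      unfolding R_def x_def A_def sector_cosine_law[OF assms(1-4) t'] d by (simp add: power_divide)
    have area: "R i * R (Suc i) * sin x = S / real N"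
      unfolding R_def x_def A_def sector_area[OF assms(1-4) t'] d by (simp add: S_def)
    have "cosine_law (R i) (R (Suc i)) (k * x) = cosine_law (R i) (R (Suc i)) x + 2 * (R i * R (Suc i)) * (cos x - cos (k * x))"
      by (simp add: cosine_law_def algebra_simps)
    also have "2 * (R i * R (Suc i)) * (cos x - cos (k * x)) \<le> 2 * (R i * R (Suc i)) * (K * (x\<^sup>2 / 2))"
      unfolding K_def using R x0 x1 assms(5) pi_gt3 by (intro mult_left_mono cos_diff_scaled) auto
    \<comment> \<open>Of the two factors \<open>x\<close>, one becomes \<open>sin x\<close> and
      joins the radii to form the constant \<open>S / real N\<close>; the other remains and
      telescopes to \<open>\<phi>\<close> in the sum.\<close>
    also have "\<dots> \<le> 2 * (R i * R (Suc i)) * (K * (x * sin x))"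
    proof (intro mult_left_mono)
      show "x\<^sup>2 / 2 \<le> x * sin x"
        using mult_left_mono[OF sin_ge_half[OF x0 x1(1)] x0] by (simp add: power2_eq_square)
    qed (use R in \<open>auto simp: K_def\<close>)
    also have "\<dots> = K * 2 * (R i * R (Suc i) * sin x) * x" by simp
    finally show ?thesis unfolding law area unfolding x_def by simp
  qed
  have "(\<Sum>i<N. cosine_law (R i) (R (Suc i)) (k * (A (Suc i) - A i)))
      \<le> (\<Sum>i<N. cosine_law r s \<phi> / (real N)\<^sup>2 + K * 2 * S / real N * (A (Suc i) - A i))"
    by (rule sum_mono) (use each in auto)
  also have "\<dots> = real N * (cosine_law r s \<phi> / (real N)\<^sup>2) + K * 2 * S / real N * (\<Sum>i<N. A (Suc i) - A i)"
    by (simp only: sum.distrib sum_distrib_left sum_constant card_lessThan)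
  also have "(\<Sum>i<N. A (Suc i) - A i) = \<phi>"
    using sector_endpoints[OF assms(1-4)] assms(6) by (subst sum_lessThan_telescope) (simp add: A_def)
  finally have "real N * (\<Sum>i<N. cosine_law (R i) (R (Suc i)) (k * (A (Suc i) - A i)))
    \<le> real N * (real N * (cosine_law r s \<phi> / (real N)\<^sup>2) + K * 2 * S / real N * \<phi>)"
    by (rule mult_left_mono) simp
  also have "\<dots> = cosine_law r s \<phi> + K * (2 * S * \<phi>)"
    using assms(6) by (simp add: field_simps power2_eq_square)
  finally show ?thesis by (simp add: K_def S_def)
qed

text \<open>
  For parallel vectors the second summand vanishes because of \<open>x / 0 = 0\<close>.
\<close>

definition slerp :: "'a::real_inner \<Rightarrow> 'a \<Rightarrow> real \<Rightarrow> 'a" where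
  "slerp v w \<alpha> = cos \<alpha> *\<^sub>R (v /\<^sub>R norm v)
     + sin \<alpha> *\<^sub>R ((w /\<^sub>R norm w - cos (vang v w) *\<^sub>R (v /\<^sub>R norm v)) /\<^sub>R sin (vang v w))"

lemma slerp_frame:
  fixes v w :: "'a::real_inner"
  assumes "v \<noteq> 0" "w \<noteq> 0"
  defines "x \<equiv> v /\<^sub>R norm v" and "e \<equiv> (w /\<^sub>R norm w - cos (vang v w) *\<^sub>R (v /\<^sub>R norm v)) /\<^sub>R sin (vang v w)"
  shows "x \<bullet> x = 1" "x \<bullet> e = 0" "sin (vang v w) \<noteq> 0 \<Longrightarrow> e \<bullet> e = 1" "sin (vang v w) = 0 \<Longrightarrow> e = 0"
proof -
  define y where "y = w /\<^sub>R norm w"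
  have n: "norm x = 1" "norm y = 1" using assms by (simp_all add: x_def y_def)
  show xx: "x \<bullet> x = 1" using n by (simp add: dot_square_norm)
  have c: "cos (vang v w) = y \<bullet> x"
    by (simp add: cos_vang x_def y_def inner_commute inverse_eq_divide)
  have e: "e = (y - (y \<bullet> x) *\<^sub>R x) /\<^sub>R sin (vang v w)"
    unfolding e_def y_def[symmetric] x_def[symmetric] c ..
  show "x \<bullet> e = 0" unfolding e by (simp add: inner_diff_right xx inner_commute)
  have zz: "(y - (y \<bullet> x) *\<^sub>R x) \<bullet> (y - (y \<bullet> x) *\<^sub>R x) = (sin (vang v w))\<^sup>2"
    unfolding power2_norm_eq_inner[symmetric] norm_minus_projection[OF n(2,1)] by (simp add: sin_squared_eq c)
  have "e \<bullet> e = (sin (vang v w))\<^sup>2 / (sin (vang v w))\<^sup>2"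
    unfolding e inner_scaleR_left inner_scaleR_right zz by (simp add: power2_eq_square field_simps)
  then show "sin (vang v w) \<noteq> 0 \<Longrightarrow> e \<bullet> e = 1" by simp
  show "sin (vang v w) = 0 \<Longrightarrow> e = 0" unfolding e by simp
qed

text \<open>The arc has unit speed in the orthonormal frame of \<open>slerp_frame\<close>. If
  \<open>v\<close> and \<open>w\<close> are parallel the second frame vector is 0, but then the
  bounds force \<open>\<alpha> = \<beta> = 0\<close>.\<close>

lemma slerp_inner:
  fixes v w :: "'a::real_inner"
  assumes "v \<noteq> 0" "w \<noteq> 0" "vang v w < pi" "0 \<le> \<alpha>" "\<alpha> \<le> vang v w" "0 \<le> \<beta>" "\<beta> \<le> vang v w"
  shows "slerp v w \<alpha> \<bullet> slerp v w \<beta> = cos (\<alpha> - \<beta>)"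
proof -
  define x e where "x = v /\<^sub>R norm v" and "e = (w /\<^sub>R norm w - cos (vang v w) *\<^sub>R (v /\<^sub>R norm v)) /\<^sub>R sin (vang v w)"
  note f = slerp_frame[OF assms(1,2), folded x_def e_def]
  have *: "slerp v w \<alpha> \<bullet> slerp v w \<beta> = cos \<alpha> * cos \<beta> + sin \<alpha> * sin \<beta> * (e \<bullet> e)"
    unfolding slerp_def unfolding e_def[symmetric] unfolding x_def[symmetric]
    using f(1,2) by (simp add: inner_add_left inner_add_right inner_commute)
  show ?thesis
  proof (cases "vang v w = 0")
    case True
    then show ?thesis using assms * by simp
  next
    case False
    then have "sin (vang v w) > 0" using assms vang_bounds[of v w] by (intro sin_gt_zero) auto
    then show ?thesis using * f(3) by (simp add: cos_diff)
  qed
qed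

lemma slerp_norm:
  fixes v w :: "'a::real_inner"
  assumes "v \<noteq> 0" "w \<noteq> 0" "vang v w < pi" "0 \<le> \<alpha>" "\<alpha> \<le> vang v w"
  shows "norm (slerp v w \<alpha>) = 1"
  using slerp_inner[OF assms assms(4,5)] by (simp add: norm_eq_sqrt_inner)

lemma slerp_0: "slerp v w 0 = v /\<^sub>R norm v"
  by (simp add: slerp_def)

lemma slerp_end:
  fixes v w :: "'a::real_inner"
  assumes "v \<noteq> 0" "w \<noteq> 0" "vang v w < pi"
  shows "slerp v w (vang v w) = w /\<^sub>R norm w"
proof (cases "vang v w = 0")
  case True
  then have "(v \<bullet> w) / (norm v * norm w) = 1" unfolding cos_vang[symmetric] by simp
  moreover have "norm v * norm w \<noteq> 0" using assms by simp
  ultimately have "v \<bullet> w = norm v * norm w" by (metis eq_divide_eq_1)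
  then have "norm v *\<^sub>R w = norm w *\<^sub>R v" by (simp add: norm_cauchy_schwarz_eq)
  moreover have "v /\<^sub>R norm v = (norm w *\<^sub>R v) /\<^sub>R (norm v * norm w)" "w /\<^sub>R norm w = (norm v *\<^sub>R w) /\<^sub>R (norm v * norm w)"
    using assms by simp_all
  ultimately have "v /\<^sub>R norm v = w /\<^sub>R norm w" by simp
  then show ?thesis using True by (simp add: slerp_0)
next
  case False
  then have "sin (vang v w) > 0" using assms vang_bounds[of v w] by (intro sin_gt_zero) auto
  then show ?thesis by (simp add: slerp_def)
qed

text \<open>
  The geodesic of the cone is a chord in a planar sector of angle \<open>lam * vang v w\<close>. Clamping this angle to
  \<open>[\<eta>, \<pi> - \<eta>]\<close> and rescaling it afterwards keeps the path continuous in \<open>v\<close> and \<open>w\<close> where they become parallel, and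
  off the vertex where the geodesic would pass through it; the cost is of order \<open>\<eta>\<close>.
\<close>

definition clamp :: "real \<Rightarrow> real \<Rightarrow> real" where
  "clamp \<eta> x = max \<eta> (min (pi - \<eta>) x)"

definition cone_path :: "real \<Rightarrow> real \<Rightarrow> 'a::real_inner \<Rightarrow> 'a \<Rightarrow> real \<Rightarrow> 'a" where
  "cone_path lam \<eta> v w t =
    (let r = sqrt (norm v); s = sqrt (norm w); \<phi> = clamp \<eta> (lam * vang v w)
     in (sector_radius r s \<phi> t)\<^sup>2 *\<^sub>R slerp v w (sector_angle r s \<phi> t * vang v w / \<phi>))"

context
  fixes lam \<eta> :: real and v w :: "'a::real_inner"
  assumes lam: "lam > 0" and eta: "0 < \<eta>" "\<eta> < pi / 2" and v: "v \<noteq> 0" and w: "w \<noteq> 0" and ang: "vang v w < pi"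
begin

private abbreviation (input) "r \<equiv> sqrt (norm v)"
private abbreviation (input) "s \<equiv> sqrt (norm w)"
private abbreviation (input) "\<phi> \<equiv> clamp \<eta> (lam * vang v w)"

lemma clamp_bounds: "0 < \<phi>" "\<phi> < pi"
  using eta by (auto simp: clamp_def)

lemma sqrt_norm_pos: "r > 0" "s > 0"
  using v w by auto

lemma scaled_angle_bounds:
  assumes "0 \<le> t" "t \<le> 1"
  shows "0 \<le> sector_angle r s \<phi> t * vang v w / \<phi>" "sector_angle r s \<phi> t * vang v w / \<phi> \<le> vang v w"
proof -
  have A: "0 \<le> sector_angle r s \<phi> t" using sector_angle_bounds[OF sqrt_norm_pos clamp_bounds assms] by simp
  have "sector_angle r s \<phi> t \<le> sector_angle r s \<phi> 1"
    using sector_angle_mono[OF sqrt_norm_pos clamp_bounds assms(1), of 1] assms(2) by (cases "t = 1") auto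
  then have B: "sector_angle r s \<phi> t \<le> \<phi>" using sector_endpoints(4)[OF sqrt_norm_pos clamp_bounds] by simp
  show "0 \<le> sector_angle r s \<phi> t * vang v w / \<phi>"
    using A vang_bounds(1)[of v w] clamp_bounds by (intro divide_nonneg_nonneg mult_nonneg_nonneg) auto
  have "sector_angle r s \<phi> t * vang v w \<le> \<phi> * vang v w"
    using B vang_bounds(1)[of v w] by (rule mult_right_mono)
  then show "sector_angle r s \<phi> t * vang v w / \<phi> \<le> vang v w"
    using clamp_bounds by (simp add: divide_le_eq mult.commute)
qed

lemma norm_cone_path:
  assumes "0 \<le> t" "t \<le> 1"
  shows "norm (cone_path lam \<eta> v w t) = (sector_radius r s \<phi> t)\<^sup>2"
  unfolding cone_path_def Let_def using slerp_norm[OF v w ang scaled_angle_bounds[OF assms]] by simp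

lemma cone_path_nonzero:
  assumes "0 \<le> t" "t \<le> 1"
  shows "cone_path lam \<eta> v w t \<noteq> 0"
  using norm_cone_path[OF assms] sector_radius_pos[OF sqrt_norm_pos clamp_bounds assms] by auto

lemma cone_path_endpoints: "cone_path lam \<eta> v w 0 = v" "cone_path lam \<eta> v w 1 = w"
  using v w clamp_bounds sector_endpoints[OF sqrt_norm_pos clamp_bounds]
  by (simp_all add: cone_path_def Let_def slerp_0 slerp_end[OF v w ang])

lemma vang_cone_path:
  assumes "0 \<le> t" "t \<le> t'" "t' \<le> 1"
  shows "vang (cone_path lam \<eta> v w t) (cone_path lam \<eta> v w t')
    = (sector_angle r s \<phi> t' - sector_angle r s \<phi> t) * vang v w / \<phi>"
proof -
  let ?\<alpha> = "\<lambda>t. sector_angle r s \<phi> t * vang v w / \<phi>"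
  have t: "0 \<le> t'" "t \<le> 1" using assms by auto
  have R: "sector_radius r s \<phi> t > 0" "sector_radius r s \<phi> t' > 0"
    using sector_radius_pos[OF sqrt_norm_pos clamp_bounds] assms t by auto
  have "?\<alpha> t \<le> ?\<alpha> t'"
  proof (cases "t = t'")
    case False
    then have "sector_angle r s \<phi> t \<le> sector_angle r s \<phi> t'"
      using sector_angle_mono[OF sqrt_norm_pos clamp_bounds assms(1) _ assms(3)] assms(2) by fastforce
    then show ?thesis using vang_bounds(1)[of v w] clamp_bounds by (intro divide_right_mono mult_right_mono) auto
  qed simp
  then have a: "0 \<le> ?\<alpha> t' - ?\<alpha> t" "?\<alpha> t' - ?\<alpha> t \<le> pi"
    using scaled_angle_bounds[OF assms(1) t(2)] scaled_angle_bounds[OF t(1) assms(3)] ang by linarith+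
  have "(cone_path lam \<eta> v w t \<bullet> cone_path lam \<eta> v w t')
     / (norm (cone_path lam \<eta> v w t) * norm (cone_path lam \<eta> v w t')) = cos (?\<alpha> t - ?\<alpha> t')"
    using R unfolding norm_cone_path[OF assms(1) t(2)] norm_cone_path[OF t(1) assms(3)]
    by (simp add: cone_path_def Let_def slerp_inner[OF v w ang scaled_angle_bounds[OF assms(1) t(2)] scaled_angle_bounds[OF t(1) assms(3)]])
  also have "\<dots> = cos (?\<alpha> t' - ?\<alpha> t)" by (metis cos_minus minus_diff_eq)
  finally show ?thesis
    unfolding vang_def[of "cone_path lam \<eta> v w t"] using a by (simp add: arccos_cos left_diff_distrib diff_divide_distrib)
qed

text \<open>There are two sources of error. Replacing the angle
  \<open>min (lam * vang v w) pi\<close> by its clamped value moves it by at most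
  \<open>\<eta>\<close>, which costs \<open>2 * sqrt (norm v * norm w) * \<eta>\<close>. Stretching
  the clamped angle back by the factor \<open>k\<close> costs something only if
  \<open>k > 1\<close>; then the upper clamp is active and
  \<open>sin \<phi> = sin \<eta> \<le> \<eta>\<close>, which with
  \<open>k\<^sup>2 \<le> 4 * lam\<^sup>2\<close> and \<open>\<phi> \<le> pi\<close> accounts for
  \<open>8 * lam\<^sup>2 * pi\<close>.\<close>

lemma cone_path_sum:
  assumes "N > 0"
    and small: "\<And>i. i < N \<Longrightarrow> sector_angle r s \<phi> (real (Suc i) / real N) - sector_angle r s \<phi> (real i / real N) \<le> 1 / (1 + 2 * lam)"
  shows "real N * (\<Sum>i<N. cone_dist2 lam (cone_path lam \<eta> v w (real i / real N)) (cone_path lam \<eta> v w (real (Suc i) / real N)))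
    \<le> cone_dist2 lam v w + (2 + 8 * lam\<^sup>2 * pi) * sqrt (norm v * norm w) * \<eta>"
proof -
  let ?A = "\<lambda>i. sector_angle r s \<phi> (real i / real N)" and ?R = "\<lambda>i. sector_radius r s \<phi> (real i / real N)"
    and ?P = "\<lambda>i. cone_path lam \<eta> v w (real i / real N)"
  define k where "k = lam * vang v w / \<phi>"
  have k0: "0 \<le> k" using scaled_vang_nonneg[OF lam, of v w] clamp_bounds by (simp add: k_def)
  \<comment> \<open>A stretch by more than 1 can come only from the upper clamp. There
    \<open>\<phi> > pi / 2\<close>, while the angle of two vectors is at most
    \<open>pi\<close>.\<close>
  have big: "\<phi> = pi - \<eta> \<and> k \<le> 2 * lam" if "k > 1"
  proof -
    have *: "\<phi> < lam * vang v w" using that clamp_bounds by (simp add: k_def)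
    then have "\<phi> = pi - \<eta>" using eta by (auto simp: clamp_def max_def min_def split: if_splits)
    moreover have "lam * vang v w \<le> lam * pi" using lam vang_bounds[of v w] by simp
    moreover have "lam * pi \<le> 2 * lam * (pi - \<eta>)"
      using lam eta mult_left_mono[of pi "2 * (pi - \<eta>)" lam] by simp
    ultimately show ?thesis using clamp_bounds by (simp add: k_def divide_le_eq)
  qed
  have k1: "k \<le> 1 + 2 * lam" using big lam by (cases "k > 1") auto
  \<comment> \<open>The threshold \<open>1 / (1 + 2 * lam)\<close> bounds the angular steps by 1
    both before and after stretching, because \<open>k \<le> 1 + 2 * lam\<close>.\<close>
  have small': "?A (Suc i) - ?A i \<le> 1 \<and>
     k * (?A (Suc i) - ?A i) \<le> 1" if i: "i < N" for i
  proof
    let ?d = "?A (Suc i) - ?A i"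
    show "?d \<le> 1" using small[OF i] lam by (intro order.trans[OF small[OF i]]) simp
    have "k * ?d \<le> k * (1 / (1 + 2 * lam))" by (rule mult_left_mono[OF small[OF i] k0])
    also have "\<dots> \<le> 1" using k1 lam by (simp add: divide_le_eq)
    finally show "k * ?d \<le> 1" .
  qed
  have eq: "cone_dist2 lam (?P i) (?P (Suc i))
     = cosine_law (?R i) (?R (Suc i))
        (k * (?A (Suc i) - ?A i))" if i: "i < N" for i
  proof -
    have t: "0 \<le> real i / real N" "real i / real N \<le> real (Suc i) / real N" "real (Suc i) / real N \<le> 1"
      using i by (auto simp: field_simps)
    have t': "real i / real N \<le> 1" "0 \<le> real (Suc i) / real N" using t by linarith+
    have R: "?R i > 0" "?R (Suc i) > 0"
      using sector_radius_pos[OF sqrt_norm_pos clamp_bounds] t t' by blast+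
    have "lam * vang (?P i) (?P (Suc i))
      = k * (?A (Suc i) - ?A i)"
      unfolding vang_cone_path[OF t] k_def by simp
    moreover have "k * (?A (Suc i) - ?A i) \<le> pi"
      using small'[OF i] pi_gt3 by linarith
    ultimately show ?thesis
      unfolding cone_dist2_cosine_law norm_cone_path[OF t(1) t'(1)] norm_cone_path[OF t'(2) t(3)]
      using R by (simp add: min_absorb1)
  qed
  have small'': "?A (Suc i) - ?A i \<le> 1 \<and>
     k * (?A (Suc i) - ?A i) \<le> pi" if "i < N" for i
    using small'[OF that] pi_gt3 by linarith
  have sum_eq: "(\<Sum>i<N. cone_dist2 lam (?P i) (?P (Suc i)))
     = (\<Sum>i<N. cosine_law (?R i) (?R (Suc i))
        (k * (?A (Suc i) - ?A i)))"
    by (rule sum.cong) (use eq in auto)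
  have "real N * (\<Sum>i<N. cone_dist2 lam (?P i) (?P (Suc i)))
    \<le> cosine_law r s \<phi> + max 0 (k\<^sup>2 - 1) * (2 * (r * s * sin \<phi>) * \<phi>)"
    unfolding sum_eq by (rule sector_sum[OF sqrt_norm_pos clamp_bounds k0 assms(1) small''])
  moreover have "cosine_law r s \<phi> \<le> cone_dist2 lam v w + 2 * (r * s) * \<eta>"
  proof -
    define \<psi> where "\<psi> = min (lam * vang v w) pi"
    have "\<bar>\<phi> - \<psi>\<bar> \<le> \<eta>"
      using eta scaled_vang_nonneg[OF lam, of v w] by (auto simp: clamp_def \<psi>_def)
    moreover have "\<bar>cos \<psi> - cos \<phi>\<bar> \<le> \<bar>\<phi> - \<psi>\<bar>"
    proof -
      have "\<bar>cos \<psi> - cos \<phi>\<bar> = 2 * (\<bar>sin ((\<psi> + \<phi>) / 2)\<bar> * \<bar>sin ((\<phi> - \<psi>) / 2)\<bar>)"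
        by (simp add: cos_diff_cos abs_mult)
      also have "\<dots> \<le> 2 * (1 * \<bar>(\<phi> - \<psi>) / 2\<bar>)"
        by (intro mult_left_mono mult_mono abs_sin_x_le_abs_x abs_sin_le_one) auto
      finally show ?thesis by simp
    qed
    ultimately have "cos \<psi> - cos \<phi> \<le> \<eta>" by linarith
    then have "2 * (r * s) * (cos \<psi> - cos \<phi>) \<le> 2 * (r * s) * \<eta>"
      using sqrt_norm_pos by (intro mult_left_mono) auto
    then show ?thesis
      by (simp add: cone_dist2_cosine_law cosine_law_def \<psi>_def[symmetric] algebra_simps)
  qed
  moreover have "max 0 (k\<^sup>2 - 1) * (2 * (r * s * sin \<phi>) * \<phi>) \<le> 8 * lam\<^sup>2 * pi * (r * s) * \<eta>"
  proof (cases "k > 1")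
    case False
    then have "k\<^sup>2 \<le> 1" using k0 by (simp add: power_le_one)
    then show ?thesis using sqrt_norm_pos eta by (simp add: max_def)
  next
    case True
    then have phi: "\<phi> = pi - \<eta>" "k \<le> 2 * lam" using big by auto
    have "k\<^sup>2 \<le> (2 * lam)\<^sup>2" using phi(2) k0 by (rule power_mono)
    then have "max 0 (k\<^sup>2 - 1) \<le> 4 * lam\<^sup>2" by (simp add: power_mult_distrib)
    moreover have "sin \<phi> \<le> \<eta>" "0 \<le> sin \<phi>" using eta clamp_bounds unfolding phi by (auto intro: sin_x_le_x sin_ge_zero)
    ultimately have "max 0 (k\<^sup>2 - 1) * (2 * (r * s * sin \<phi>) * \<phi>) \<le> (4 * lam\<^sup>2) * (2 * (r * s * \<eta>) * pi)"
      using clamp_bounds sqrt_norm_pos by (intro mult_mono mult_left_mono mult_nonneg_nonneg) auto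
    then show ?thesis by (simp add: algebra_simps)
  qed
  ultimately show ?thesis by (simp add: real_sqrt_mult algebra_simps)
qed

end

section \<open>Continuity of the connecting paths in their end points\<close>

lemma continuous_on_vanishing:
  fixes h :: "'a::t2_space \<Rightarrow> 'b::real_normed_vector" and T :: "'a \<Rightarrow> real"
  assumes T: "continuous_on S T" and le: "\<And>x. x \<in> S \<Longrightarrow> norm (h x) \<le> \<bar>T x\<bar>"
    and h: "continuous_on {x \<in> S. T x \<noteq> 0} h"
  shows "continuous_on S h"
  unfolding continuous_on_def
proof
  fix x assume x: "x \<in> S"
  show "(h \<longlongrightarrow> h x) (at x within S)"
  proof (cases "T x = 0")
    case True
    then have "h x = 0" using le[OF x] by simp
    have "(T \<longlongrightarrow> 0) (at x within S)"
      using T x True by (auto simp: continuous_on_def)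
    then have "((\<lambda>x. \<bar>T x\<bar>) \<longlongrightarrow> 0) (at x within S)"
      by (rule tendsto_rabs_zero)
    then have "(h \<longlongrightarrow> 0) (at x within S)"
      by (rule Lim_null_comparison[rotated]) (use le in \<open>auto simp: eventually_at_filter\<close>)
    then show ?thesis by (simp add: \<open>h x = 0\<close>)
  next
    case False
    have "openin (top_of_set S) (S \<inter> T -` (- {0}))"
      using T by (intro continuous_openin_preimage_gen) auto
    then obtain U where U: "open U" "S \<inter> T -` (- {0}) = S \<inter> U" by (auto simp: openin_open)
    then have eq: "{x \<in> S. T x \<noteq> 0} = S \<inter> U" by auto
    have "x \<in> U" using U(2) x False by auto
    then have "at x within S = at x within {x \<in> S. T x \<noteq> 0}"
      unfolding eq using U(1) by (intro at_within_nhd[of x U]) auto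
    then show ?thesis using h x False by (auto simp: continuous_on_def)
  qed
qed

text \<open>The frame vector \<open>e\<close> may jump where \<open>f\<close> and \<open>g\<close>
  become parallel. Its coefficient is at most \<open>\<alpha>\<close>, hence at most the angle,
  which tends to 0 there; \<open>continuous_on_vanishing\<close> turns this into continuity of the
  product.\<close>

lemma continuous_on_slerp:
  fixes f g :: "'b::t2_space \<Rightarrow> 'a::real_inner"
  assumes f: "continuous_on S f" "\<And>x. x \<in> S \<Longrightarrow> f x \<noteq> 0" and g: "continuous_on S g" "\<And>x. x \<in> S \<Longrightarrow> g x \<noteq> 0"
    and \<alpha>: "continuous_on S \<alpha>" "\<And>x. x \<in> S \<Longrightarrow> 0 \<le> \<alpha> x \<and> \<alpha> x \<le> vang (f x) (g x)"
    and ang: "\<And>x. x \<in> S \<Longrightarrow> vang (f x) (g x) < pi"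
  shows "continuous_on S (\<lambda>x. slerp (f x) (g x) (\<alpha> x))"
proof -
  have T: "continuous_on S (\<lambda>x. vang (f x) (g x))"
    unfolding vang_def using f g
    by (intro continuous_intros ballI conjI inner_quotient_bound) auto
  define e where "e x = (g x /\<^sub>R norm (g x) - cos (vang (f x) (g x)) *\<^sub>R (f x /\<^sub>R norm (f x))) /\<^sub>R sin (vang (f x) (g x))" for x
  have "continuous_on S (\<lambda>x. sin (\<alpha> x) *\<^sub>R e x)"
  proof (rule continuous_on_vanishing[OF T])
    fix x assume x: "x \<in> S"
    note fr = slerp_frame[OF f(2)[OF x] g(2)[OF x], folded e_def]
    have "norm (e x) \<le> 1"
      using fr(3,4) by (cases "sin (vang (f x) (g x)) = 0") (auto simp: norm_eq_sqrt_inner)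
    then have "norm (sin (\<alpha> x) *\<^sub>R e x) \<le> \<bar>sin (\<alpha> x)\<bar>" using mult_left_le by fastforce
    also have "\<dots> \<le> \<bar>vang (f x) (g x)\<bar>" using abs_sin_x_le_abs_x[of "\<alpha> x"] \<alpha>(2)[OF x] by auto
    finally show "norm (sin (\<alpha> x) *\<^sub>R e x) \<le> \<bar>vang (f x) (g x)\<bar>" .
  next
    let ?S' = "{x \<in> S. vang (f x) (g x) \<noteq> 0}"
    have nz: "sin (vang (f x) (g x)) \<noteq> 0" if "x \<in> ?S'" for x
      using that ang vang_bounds(1)[of "f x" "g x"] sin_gt_zero[of "vang (f x) (g x)"] by force
    have sub: "?S' \<subseteq> S" by auto
    show "continuous_on ?S' (\<lambda>x. sin (\<alpha> x) *\<^sub>R e x)"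
      unfolding e_def using nz f(2) g(2)
      by (intro continuous_intros continuous_on_subset[OF f(1) sub] continuous_on_subset[OF g(1) sub]
          continuous_on_subset[OF T sub] continuous_on_subset[OF \<alpha>(1) sub]) auto
  qed
  moreover have "continuous_on S (\<lambda>x. cos (\<alpha> x) *\<^sub>R (f x /\<^sub>R norm (f x)))"
    using f \<alpha>(1) by (intro continuous_intros) auto
  ultimately show ?thesis
    unfolding slerp_def e_def[symmetric] by (intro continuous_on_add)
qed

lemma continuous_on_sector_angle:
  fixes f g \<phi> t :: "'b::t2_space \<Rightarrow> real"
  assumes "continuous_on S f" "continuous_on S g" "continuous_on S \<phi>" "continuous_on S t"
    "\<And>x. x \<in> S \<Longrightarrow> f x > 0 \<and> g x > 0 \<and> 0 < \<phi> x \<and> \<phi> x < pi \<and> 0 \<le> t x \<and> t x \<le> 1"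
  shows "continuous_on S (\<lambda>x. sector_angle (f x) (g x) (\<phi> x) (t x))"
proof -
  have nz: "sector_radius (f x) (g x) (\<phi> x) (t x) \<noteq> 0" if "x \<in> S" for x
    using sector_radius_pos[of "f x" "g x" "\<phi> x" "t x"] assms(5)[OF that] by simp
  have "continuous_on S (\<lambda>x. sector_x (f x) (g x) (\<phi> x) (t x) / sector_radius (f x) (g x) (\<phi> x) (t x))"
    using nz unfolding sector_radius_def sector_x_def sector_y_def by (intro continuous_intros assms) auto
  then show ?thesis
    unfolding sector_angle_def
    using sector_quotient_bounds[OF _ _ _ _ _ _] assms(5) by (intro continuous_on_arccos ballI conjI) auto
qed

lemma continuous_on_cone_path:
  fixes f g :: "'b::t2_space \<Rightarrow> 'a::real_inner"
  assumes lam: "lam > 0" and eta: "0 < \<eta>" "\<eta> < pi / 2"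
    and f: "continuous_on S f" "\<And>x. x \<in> S \<Longrightarrow> f x \<noteq> 0" and g: "continuous_on S g" "\<And>x. x \<in> S \<Longrightarrow> g x \<noteq> 0"
    and t: "continuous_on S t" "\<And>x. x \<in> S \<Longrightarrow> 0 \<le> t x \<and> t x \<le> 1"
    and ang: "\<And>x. x \<in> S \<Longrightarrow> vang (f x) (g x) < pi"
  shows continuous_on_cone_angle: "continuous_on S (\<lambda>x. sector_angle (sqrt (norm (f x))) (sqrt (norm (g x)))
          (clamp \<eta> (lam * vang (f x) (g x))) (t x))" (is "continuous_on S ?A")
    and "continuous_on S (\<lambda>x. cone_path lam \<eta> (f x) (g x) (t x))"
proof -
  have T: "continuous_on S (\<lambda>x. vang (f x) (g x))"
    unfolding vang_def using f g
    by (intro continuous_intros ballI conjI inner_quotient_bound) auto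
  have phi: "continuous_on S (\<lambda>x. clamp \<eta> (lam * vang (f x) (g x)))" (is "continuous_on S ?\<phi>")
    unfolding clamp_def by (intro continuous_intros T)
  have phib: "0 < clamp \<eta> y" "clamp \<eta> y < pi" for y using eta by (auto simp: clamp_def)
  show A: "continuous_on S ?A"
    using f g t phi phib by (intro continuous_on_sector_angle continuous_intros) auto
  have "continuous_on S (\<lambda>x. slerp (f x) (g x) (?A x * vang (f x) (g x) / ?\<phi> x))"
  proof (rule continuous_on_slerp[OF f g _ _ ang])
    show "continuous_on S (\<lambda>x. ?A x * vang (f x) (g x) / ?\<phi> x)"
      using phib by (intro continuous_intros A T phi) (auto simp: less_imp_neq[THEN not_sym])
    fix x assume x: "x \<in> S"
    show "0 \<le> ?A x * vang (f x) (g x) / ?\<phi> x \<and> ?A x * vang (f x) (g x) / ?\<phi> x \<le> vang (f x) (g x)"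
      using scaled_angle_bounds[OF lam eta f(2)[OF x] g(2)[OF x] ang[OF x], of "t x"] t(2)[OF x] by simp
  qed
  then show "continuous_on S (\<lambda>x. cone_path lam \<eta> (f x) (g x) (t x))"
    unfolding cone_path_def Let_def sector_radius_def sector_x_def sector_y_def
    by (intro continuous_intros f g t phi)
qed

section \<open>Lower bound for the length of a path\<close>

lemma tendsto_integral_Ck_lim:
  assumes "Ck_lim 0 X l F"
  shows "((\<lambda>i. integral {0..1} (ev (X i :: real smooth_map))) \<longlongrightarrow> integral {0..1} (ev l)) F"
proof -
  have "uniform_limit {0..1} (\<lambda>i. ev (antideriv (X i))) (ev (antideriv l)) F"
    using Ck_lim_antideriv[OF assms] by (simp add: Ck_lim_0)
  then have "((\<lambda>i. ev (antideriv (X i)) 1) \<longlongrightarrow> ev (antideriv l) 1) F"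
    by (rule tendsto_uniform_limitI) simp
  then show ?thesis by (simp add: antideriv.rep_eq)
qed

text \<open>\<open>elastic_form\<close> rewritten as a combination of pointwise products and powers
  of the norm, so that the limit theorems for \<open>Ck_lim\<close> apply to it.\<close>

definition elastic_map :: "real \<Rightarrow> real \<Rightarrow> 'a::real_inner smooth_map \<Rightarrow> 'a smooth_map \<Rightarrow> real smooth_map" where
  "elastic_map a b v x = a\<^sup>2 *\<^sub>R pointwise (*) (pointwise (\<bullet>) x x) (npow (-1) v)
     + (b\<^sup>2 - a\<^sup>2) *\<^sub>R pointwise (*) (pointwise (*) (pointwise (\<bullet>) v x) (pointwise (\<bullet>) v x)) (npow (-3) v)"

lemma ev_elastic_map:
  assumes "v \<in> nonvanishing_maps" "u \<in> {0..1}"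
  shows "ev (elastic_map a b v x) u = elastic_form a b (ev v u) (ev x u)"
proof -
  have "norm (ev v u) > 0" using nonvanishing_mapsD[OF assms] by simp
  then show ?thesis
    using assms(1)
    by (simp add: elastic_map_def elastic_form_def ev_sbil bounded_bilinear_mult bounded_bilinear_inner ev_npow
        powr_minus dot_square_norm field_simps eval_nat_numeral)
qed

lemma integral_elastic_map:
  assumes "v \<in> nonvanishing_maps"
  shows "integral {0..1} (ev (elastic_map a b v x)) = integral {0..1} (\<lambda>u. elastic_form a b (ev v u) (ev x u))"
  by (rule integral_cong) (simp add: ev_elastic_map assms)

lemma Ck_lim_elastic_map:
  assumes "Ck_lim k V v F" "Ck_lim k X x F" "v \<in> nonvanishing_maps"
  shows "Ck_lim k (\<lambda>i. elastic_map a b (V i) (X i)) (elastic_map a b v x) F"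
  unfolding elastic_map_def using assms
  by (intro Ck_lim_add Ck_lim_scaleR Ck_lim_bilinear Ck_lim_npow bounded_bilinear_mult bounded_bilinear_inner tendsto_const)

lemma elastic_metric_form:
  assumes "c \<in> immersions0"
  shows "elastic_metric a b c h h = integral {0..1} (\<lambda>u. elastic_form a b (ev (D\<^sub>u c) u) (ev (D\<^sub>u h) u))"
  unfolding elastic_metric_eq[OF assms] elastic_inner_def elastic_form_def
  by (simp add: dot_square_norm power2_eq_square)

lemma elastic_metric_map:
  assumes "c \<in> immersions0"
  shows "elastic_metric a b c h h = integral {0..1} (ev (elastic_map a b (D\<^sub>u c) (D\<^sub>u h)))"
  by (simp add: elastic_metric_form assms integral_elastic_map D\<^sub>u_immersion)

lemma elastic_metric_nonneg: "c \<in> immersions0 \<Longrightarrow> 0 \<le> elastic_metric a b c h h"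
  unfolding elastic_metric_form
  by (cases "(\<lambda>u. elastic_form a b (ev (D\<^sub>u c) u) (ev (D\<^sub>u h) u)) integrable_on {0..1}")
    (auto intro: integral_nonneg elastic_form_nonneg simp: not_integrable_integral)

lemma elastic_form_scaleR: "elastic_form a b v (r *\<^sub>R x) = r\<^sup>2 * elastic_form a b v x"
  by (simp add: elastic_form_def power_mult_distrib algebra_simps add_divide_distrib diff_divide_distrib)

lemma continuous_elastic_form:
  assumes "v \<in> nonvanishing_maps"
  shows "continuous_on {0..1} (\<lambda>u. elastic_form a b (ev v u) (ev x u))"
  unfolding elastic_form_def using nonvanishing_mapsD[OF assms] by (intro continuous_intros) auto

section \<open>The integrated distance\<close>

definition cone_energy :: "real \<Rightarrow> 'a::real_inner smooth_map \<Rightarrow> 'a smooth_map \<Rightarrow> real" where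
  "cone_energy lam v w = integral {0..1} (\<lambda>u. cone_dist2 lam (ev v u) (ev w u))"

lemma continuous_cone_dist2_ev:
  assumes "v \<in> nonvanishing_maps" "w \<in> nonvanishing_maps"
  shows "continuous_on {0..1} (\<lambda>u. cone_dist2 lam (ev v u) (ev w u))"
  using nonvanishing_mapsD[OF assms(1)] nonvanishing_mapsD[OF assms(2)]
  by (intro continuous_on_cone_dist2 continuous_ev) auto

lemma cone_energy_nonneg:
  assumes "v \<in> nonvanishing_maps" "w \<in> nonvanishing_maps"
  shows "0 \<le> cone_energy lam v w"
  unfolding cone_energy_def
  by (intro integral_nonneg integrable_continuous_real continuous_cone_dist2_ev assms cone_dist2_nonneg)

lemma Minkowski_integral:
  fixes f g :: "real \<Rightarrow> real"
  assumes f: "continuous_on {0..1} f" and g: "continuous_on {0..1} g"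
  shows "sqrt (integral {0..1} (\<lambda>u. (f u + g u)\<^sup>2)) \<le> sqrt (integral {0..1} (\<lambda>u. (f u)\<^sup>2)) + sqrt (integral {0..1} (\<lambda>u. (g u)\<^sup>2))"
proof -
  define A B P where "A = integral {0..1} (\<lambda>u. (f u)\<^sup>2)" and "B = integral {0..1} (\<lambda>u. (g u)\<^sup>2)"
    and "P = integral {0..1} (\<lambda>u. f u * g u)"
  have hi: "((\<lambda>u. (f u)\<^sup>2) has_integral A) {0..1}" "((\<lambda>u. (g u)\<^sup>2) has_integral B) {0..1}"
    "((\<lambda>u. f u * g u) has_integral P) {0..1}"
    unfolding A_def B_def P_def
    by (intro integrable_integral integrable_continuous_real continuous_intros f g)+
  have AB: "A \<ge> 0" "B \<ge> 0" using hi by (auto intro: has_integral_nonneg)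
  have q: "((\<lambda>u. (r * f u + t * g u)\<^sup>2) has_integral r\<^sup>2 * A + 2 * r * t * P + t\<^sup>2 * B) {0..1}" for r t
  proof -
    have "((\<lambda>u. r\<^sup>2 * (f u)\<^sup>2 + 2 * r * t * (f u * g u) + t\<^sup>2 * (g u)\<^sup>2) has_integral r\<^sup>2 * A + 2 * r * t * P + t\<^sup>2 * B) {0..1}"
      by (intro has_integral_add has_integral_mult_right hi)
    then show ?thesis by (simp add: power2_eq_square algebra_simps)
  qed
  have "0 \<le> r\<^sup>2 * A + 2 * r * t * P + t\<^sup>2 * B" for r t
    by (rule has_integral_nonneg[OF q]) simp
  note nn = this
  have "P\<^sup>2 \<le> A * B"
  proof (cases "B = 0")
    case True
    have "P = 0"
    proof (rule ccontr)
      assume "P \<noteq> 0"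
      \<comment> \<open>With \<open>A + 2 * t * P\<close> left over, this \<open>t\<close> gives the
        value -1 to a form that is nonnegative.\<close>
      then show False using nn[of 1 "- (A + 1) / (2 * P)"] True by (simp add: field_simps)
    qed
    then show ?thesis using True by simp
  next
    case False
    \<comment> \<open>At \<open>(B, -P)\<close> the form is \<open>B\<close> times the discriminant
      \<open>A * B - P\<^sup>2\<close>.\<close>
    then have "0 \<le> B * (A * B - P\<^sup>2)"
      using nn[of B "-P"] by (simp add: power2_eq_square algebra_simps)
    then show ?thesis using False AB by (simp add: zero_le_mult_iff)
  qed
  then have "P \<le> sqrt (A * B)" by (rule real_le_rsqrt)
  moreover have "integral {0..1} (\<lambda>u. (f u + g u)\<^sup>2) = A + 2 * P + B"
    using integral_unique[OF q[of 1 1]] by simp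
  ultimately have "integral {0..1} (\<lambda>u. (f u + g u)\<^sup>2) \<le> (sqrt A + sqrt B)\<^sup>2"
    using AB by (simp add: power2_sum real_sqrt_mult)
  then show ?thesis
    unfolding A_def[symmetric] B_def[symmetric] using AB by (intro real_le_lsqrt) auto
qed

lemma cone_energy_triangle:
  assumes "lam > 0" "v1 \<in> nonvanishing_maps" "v2 \<in> nonvanishing_maps" "v3 \<in> nonvanishing_maps"
  shows "sqrt (cone_energy lam v1 v3) \<le> sqrt (cone_energy lam v1 v2) + sqrt (cone_energy lam v2 v3)"
proof -
  let ?d = "\<lambda>v w u. sqrt (cone_dist2 lam (ev v u) (ev w u))"
  have c: "continuous_on {0..1} (?d v1 v2)" "continuous_on {0..1} (?d v2 v3)"
    by (intro continuous_on_real_sqrt continuous_cone_dist2_ev assms)+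
  have "cone_energy lam v1 v3 \<le> integral {0..1} (\<lambda>u. (?d v1 v2 u + ?d v2 v3 u)\<^sup>2)"
    unfolding cone_energy_def
  proof (intro integral_le integrable_continuous_real continuous_intros c continuous_cone_dist2_ev assms)
    fix u :: real assume u: "u \<in> {0..1}"
    have "?d v1 v3 u \<le> ?d v1 v2 u + ?d v2 v3 u"
      using u assms nonvanishing_mapsD by (intro cone_dist_triangle) blast+
    then have "(?d v1 v3 u)\<^sup>2 \<le> (?d v1 v2 u + ?d v2 v3 u)\<^sup>2"
      by (intro power_mono) (simp_all add: cone_dist2_nonneg)
    then show "cone_dist2 lam (ev v1 u) (ev v3 u) \<le> (?d v1 v2 u + ?d v2 v3 u)\<^sup>2"
      by (simp add: cone_dist2_nonneg)
  qed
  then have "sqrt (cone_energy lam v1 v3) \<le> sqrt (integral {0..1} (\<lambda>u. (?d v1 v2 u + ?d v2 v3 u)\<^sup>2))"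
    by (rule real_sqrt_le_mono)
  also have "\<dots> \<le> sqrt (cone_energy lam v1 v2) + sqrt (cone_energy lam v2 v3)"
    using Minkowski_integral[OF c] by (simp add: cone_energy_def cone_dist2_nonneg)
  finally show ?thesis .
qed

definition cone_distance :: "real \<Rightarrow> real \<Rightarrow> 'a::real_inner smooth_map \<Rightarrow> 'a smooth_map \<Rightarrow> real" where
  "cone_distance a b c c' = 2 * b * sqrt (cone_energy (a / (2 * b)) (D\<^sub>u c) (D\<^sub>u c'))"

lemma cone_distance_triangle:
  assumes "a > 0" "b > 0" "c1 \<in> immersions0" "c2 \<in> immersions0" "c3 \<in> immersions0"
  shows "cone_distance a b c1 c3 \<le> cone_distance a b c1 c2 + cone_distance a b c2 c3"
proof -
  have "sqrt (cone_energy (a / (2 * b)) (D\<^sub>u c1) (D\<^sub>u c3))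
    \<le> sqrt (cone_energy (a / (2 * b)) (D\<^sub>u c1) (D\<^sub>u c2)) + sqrt (cone_energy (a / (2 * b)) (D\<^sub>u c2) (D\<^sub>u c3))"
    using assms by (intro cone_energy_triangle) (auto simp: D\<^sub>u_immersion)
  then show ?thesis
    unfolding cone_distance_def using assms(2) by (simp flip: distrib_left)
qed

lemma cone_distance_self: "cone_distance a b c c = 0"
proof -
  have "cone_dist2 lam v v = 0" for lam and v :: 'a
  proof (cases "v = 0")
    case False
    then have "vang v v = 0" by (simp add: vang_def dot_square_norm power2_eq_square)
    then show ?thesis by (simp add: cone_dist2_def min_def)
  qed (simp add: cone_dist2_def)
  then show ?thesis by (simp add: cone_distance_def cone_energy_def)
qed

lemma cone_distance_commute: "cone_distance a b c c' = cone_distance a b c' c"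
  by (simp add: cone_distance_def cone_energy_def cone_dist2_def vang_commute add.commute mult.commute)

section \<open>Distance and length along a smooth piece\<close>

lemma path_differentiable_Ck_lim:
  assumes "((\<lambda>s. (\<gamma> s - \<gamma> t) /\<^sub>R (s - t)) \<longlongrightarrow> d) (at t within S)"
  shows "Ck_lim k \<gamma> (\<gamma> t) (at t within S)" "Ck_lim k (\<lambda>s. D\<^sub>u (\<gamma> s)) (D\<^sub>u (\<gamma> t)) (at t within S)"
    "Ck_lim k (\<lambda>s. D\<^sub>u ((\<gamma> s - \<gamma> t) /\<^sub>R (s - t))) (D\<^sub>u d) (at t within S)"
proof -
  have q: "\<forall>k. Ck_lim k (\<lambda>s. (\<gamma> s - \<gamma> t) /\<^sub>R (s - t)) d (at t within S)"
    using assms by (simp add: tendsto_iff_Ck_lim)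
  have *: "Ck_lim k \<gamma> (\<gamma> t) (at t within S)" for k
  proof -
    have "((\<lambda>s. s - t) \<longlongrightarrow> 0) (at t within S)" by (auto intro!: tendsto_eq_intros)
    then have "Ck_lim k (\<lambda>s. \<gamma> t + (s - t) *\<^sub>R ((\<gamma> s - \<gamma> t) /\<^sub>R (s - t))) (\<gamma> t + 0 *\<^sub>R d) (at t within S)"
      using q by (intro Ck_lim_add Ck_lim_const Ck_lim_scaleR) auto
    moreover have "\<forall>\<^sub>F s in at t within S. \<gamma> t + (s - t) *\<^sub>R ((\<gamma> s - \<gamma> t) /\<^sub>R (s - t)) = \<gamma> s"
      by (auto simp: eventually_at intro!: exI[of _ 1])
    ultimately show ?thesis using Ck_lim_cong by fastforce
  qed
  then show "Ck_lim k \<gamma> (\<gamma> t) (at t within S)" by blast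
  show "Ck_lim k (\<lambda>s. D\<^sub>u (\<gamma> s)) (D\<^sub>u (\<gamma> t)) (at t within S)"
    using *[of "Suc k"] by (simp add: Ck_lim_Suc)
  show "Ck_lim k (\<lambda>s. D\<^sub>u ((\<gamma> s - \<gamma> t) /\<^sub>R (s - t))) (D\<^sub>u d) (at t within S)"
    using q[rule_format, of "Suc k"] by (simp add: Ck_lim_Suc)
qed

lemma velocity_eq:
  assumes "((\<lambda>s. (\<gamma> s - \<gamma> t) /\<^sub>R (s - t)) \<longlongrightarrow> d) (at t within {p..q})" "p < t" "t < q" "{p..q} \<subseteq> {0..1}"
  shows "velocity \<gamma> t = d"
proof -
  have "{p<..<q} \<subseteq> {0..1}" using assms(4) by force
  then have "at t within {0..1} = at t" "at t within {p..q} = at t"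
    using assms(2,3) by (auto intro!: at_within_open_subset[of t "{p<..<q}"])
  then show ?thesis
    unfolding velocity_def using assms(1) by (intro tendsto_Lim) auto
qed

context
  fixes a b :: real and \<gamma> d e :: "real \<Rightarrow> 'a::euclidean_space smooth_map" and p q :: real
  assumes a: "a > 0" and b: "b > 0" and pq: "p < q"
    and imm: "\<And>t. t \<in> {p..q} \<Longrightarrow> \<gamma> t \<in> immersions0"
    and d: "\<And>t. t \<in> {p..q} \<Longrightarrow> ((\<lambda>s. (\<gamma> s - \<gamma> t) /\<^sub>R (s - t)) \<longlongrightarrow> d t) (at t within {p..q})"
    and e: "\<And>t. t \<in> {p..q} \<Longrightarrow> ((\<lambda>s. (d s - d t) /\<^sub>R (s - t)) \<longlongrightarrow> e t) (at t within {p..q})"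
begin

text \<open>The second derivative \<open>e\<close> enters because it makes the first derivative
  \<open>d\<close> continuous in \<open>t\<close>.\<close>

lemma continuous_on_speed: "continuous_on {p..q} (\<lambda>t. sqrt (elastic_metric a b (\<gamma> t) (d t) (d t)))"
proof (intro continuous_on_real_sqrt)
  have "continuous_on {p..q} (\<lambda>t. integral {0..1} (ev (elastic_map a b (D\<^sub>u (\<gamma> t)) (D\<^sub>u (d t)))))"
    unfolding continuous_on_def
    by (intro ballI tendsto_integral_Ck_lim Ck_lim_elastic_map path_differentiable_Ck_lim(2)[OF d]
        path_differentiable_Ck_lim(2)[OF e] D\<^sub>u_immersion imm)
  then show "continuous_on {p..q} (\<lambda>t. elastic_metric a b (\<gamma> t) (d t) (d t))"
    by (rule continuous_on_eq) (simp add: elastic_metric_map imm)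
qed

text \<open>By \<open>cone_dist2_local\<close> the pointwise distance from \<open>\<gamma> t\<close>
  to \<open>\<gamma> s\<close> is almost the tensor of the increment, uniformly in \<open>u\<close>.
  Squaring and integrating yields the metric of the difference quotient, which converges to that of
  \<open>d t\<close>.\<close>

lemma cone_distance_local_speed:
  assumes t: "t \<in> {p..q}" and "\<epsilon> > 0"
  shows "\<exists>r>0. \<forall>s\<in>{p..q}. \<bar>s - t\<bar> < r \<longrightarrow>
    cone_distance a b (\<gamma> t) (\<gamma> s) \<le> (sqrt (elastic_metric a b (\<gamma> t) (d t) (d t)) + \<epsilon>) * \<bar>s - t\<bar>"
proof -
  define \<sigma> where "\<sigma> = sqrt (elastic_metric a b (\<gamma> t) (d t) (d t))"
  have \<sigma>: "\<sigma> \<ge> 0" using elastic_metric_nonneg[OF imm[OF t]] by (simp add: \<sigma>_def)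
  \<comment> \<open>Small enough for
    \<open>(1 + x) * (\<sigma> + x) \<le> \<sigma> + \<epsilon>\<close>: the first factor is the
    error of the local comparison, the second that of the difference quotient.\<close>
  define x where "x = min 1 (\<epsilon> / (2 + \<sigma>))"
  have "x \<le> \<epsilon> / (2 + \<sigma>)" by (simp add: x_def)
  then have x: "0 < x" "x \<le> 1" "x * (2 + \<sigma>) \<le> \<epsilon>"
    using assms(2) \<sigma> by (simp_all add: pos_le_divide_eq) (simp_all add: x_def)
  have x': "(1 + x) * (\<sigma> + x) \<le> \<sigma> + \<epsilon>"
  proof -
    have "x * x \<le> x" using x by (simp add: mult_left_le)
    then show ?thesis using x(3) by (simp add: algebra_simps)
  qed
  define v where "v = D\<^sub>u (\<gamma> t)"
  have v: "v \<in> nonvanishing_maps" using D\<^sub>u_immersion[OF imm[OF t]] by (simp add: v_def)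
  obtain m M where m: "0 < m" "\<And>u. u \<in> {0..1} \<Longrightarrow> m \<le> norm (ev v u) \<and> norm (ev v u) \<le> M"
    using nonvanishing_bounds[OF v] by blast
  obtain k where k: "0 < k" "k < 1" "\<And>v w :: 'a. v \<noteq> 0 \<Longrightarrow> norm (w - v) \<le> k * norm v \<Longrightarrow>
     2 * b * sqrt (cone_dist2 (a / (2 * b)) v w) \<le> (1 + x) * sqrt (elastic_form a b v (w - v))"
    using cone_dist2_local[OF x(1) a b refl] by metis
  let ?F = "at t within {p..q}"
  let ?Q = "\<lambda>s. D\<^sub>u ((\<gamma> s - \<gamma> t) /\<^sub>R (s - t))"
  have "uniform_limit {0..1} (\<lambda>s. ev (D\<^sub>u (\<gamma> s))) (ev v) ?F"
    unfolding v_def by (rule Ck_lim_uniform_limit[OF path_differentiable_Ck_lim(2)[OF d[OF t]]])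
  then have "\<forall>\<^sub>F s in ?F. \<forall>u\<in>{0..1}. dist (ev (D\<^sub>u (\<gamma> s)) u) (ev v u) < k * m"
    using k(1) m(1) by (intro uniform_limitD) auto
  moreover have "((\<lambda>s. sqrt (integral {0..1} (ev (elastic_map a b v (?Q s))))) \<longlongrightarrow> \<sigma>) ?F"
    unfolding \<sigma>_def elastic_metric_map[OF imm[OF t]] v_def[symmetric]
    by (intro tendsto_real_sqrt tendsto_integral_Ck_lim Ck_lim_elastic_map Ck_lim_const v path_differentiable_Ck_lim(3)[OF d[OF t]])
  then have "\<forall>\<^sub>F s in ?F. sqrt (integral {0..1} (ev (elastic_map a b v (?Q s)))) < \<sigma> + x"
    using x(1) by (intro order_tendstoD(2)) auto
  ultimately have "\<forall>\<^sub>F s in ?F. (\<forall>u\<in>{0..1}. dist (ev (D\<^sub>u (\<gamma> s)) u) (ev v u) < k * m)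
      \<and> sqrt (integral {0..1} (ev (elastic_map a b v (?Q s)))) < \<sigma> + x"
    by eventually_elim auto
  then obtain r where r: "r > 0" "\<And>s. s \<in> {p..q} \<Longrightarrow> s \<noteq> t \<Longrightarrow> dist s t < r \<Longrightarrow>
      (\<forall>u\<in>{0..1}. dist (ev (D\<^sub>u (\<gamma> s)) u) (ev v u) < k * m)
      \<and> sqrt (integral {0..1} (ev (elastic_map a b v (?Q s)))) < \<sigma> + x"
    unfolding eventually_at by blast
  show ?thesis
  proof (intro exI[of _ r] conjI ballI impI r(1))
    fix s assume s: "s \<in> {p..q}" "\<bar>s - t\<bar> < r"
    show "cone_distance a b (\<gamma> t) (\<gamma> s) \<le> (sqrt (elastic_metric a b (\<gamma> t) (d t) (d t)) + \<epsilon>) * \<bar>s - t\<bar>"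
    proof (cases "s = t")
      case True
      then show ?thesis by (simp add: cone_distance_self)
    next
      case False
      define w where "w = D\<^sub>u (\<gamma> s)"
      have w: "w \<in> nonvanishing_maps" using D\<^sub>u_immersion[OF imm[OF s(1)]] by (simp add: w_def)
      have close: "\<And>u. u \<in> {0..1} \<Longrightarrow> dist (ev w u) (ev v u) < k * m"
        and speed: "sqrt (integral {0..1} (ev (elastic_map a b v (?Q s)))) < \<sigma> + x"
        using r(2)[OF s(1) False] s(2) by (auto simp: w_def dist_real_def)
      have wv: "ev w u - ev v u = (s - t) *\<^sub>R ev (?Q s) u" for u
        using False by (simp add: w_def v_def D\<^sub>u_scaleR D\<^sub>u_diff)
      have "(2 * b)\<^sup>2 * cone_energy (a / (2 * b)) v w = integral {0..1} (\<lambda>u. (2 * b)\<^sup>2 * cone_dist2 (a / (2 * b)) (ev v u) (ev w u))"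
        by (simp add: cone_energy_def)
      also have "\<dots> \<le> integral {0..1} (\<lambda>u. ((1 + x) * (s - t))\<^sup>2 * elastic_form a b (ev v u) (ev (?Q s) u))"
      proof (intro integral_le integrable_continuous_real continuous_intros continuous_cone_dist2_ev continuous_elastic_form v w)
        fix u :: real assume u: "u \<in> {0..1}"
        have "norm (ev w u - ev v u) \<le> k * m" using close[OF u] by (simp add: dist_norm)
        also have "\<dots> \<le> k * norm (ev v u)" using m(2)[OF u] k(1) by simp
        finally have "2 * b * sqrt (cone_dist2 (a / (2 * b)) (ev v u) (ev w u))
            \<le> (1 + x) * sqrt (elastic_form a b (ev v u) (ev w u - ev v u))"
          using k(3) nonvanishing_mapsD[OF v u] by blast
        then have "(2 * b * sqrt (cone_dist2 (a / (2 * b)) (ev v u) (ev w u)))\<^sup>2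
            \<le> ((1 + x) * sqrt (elastic_form a b (ev v u) (ev w u - ev v u)))\<^sup>2"
          using b by (intro power_mono) (simp_all add: cone_dist2_nonneg)
        then show "(2 * b)\<^sup>2 * cone_dist2 (a / (2 * b)) (ev v u) (ev w u)
            \<le> ((1 + x) * (s - t))\<^sup>2 * elastic_form a b (ev v u) (ev (?Q s) u)"
          unfolding wv elastic_form_scaleR power_mult_distrib
          by (simp add: cone_dist2_nonneg elastic_form_nonneg mult.assoc)
      qed
      also have "\<dots> = ((1 + x) * (s - t))\<^sup>2 * integral {0..1} (ev (elastic_map a b v (?Q s)))"
        by (simp add: integral_elastic_map[OF v])
      finally have "sqrt ((2 * b)\<^sup>2 * cone_energy (a / (2 * b)) v w)
        \<le> sqrt (((1 + x) * (s - t))\<^sup>2 * integral {0..1} (ev (elastic_map a b v (?Q s))))"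
        by (rule real_sqrt_le_mono)
      then have "cone_distance a b (\<gamma> t) (\<gamma> s) \<le> (1 + x) * \<bar>s - t\<bar> * sqrt (integral {0..1} (ev (elastic_map a b v (?Q s))))"
        unfolding cone_distance_def v_def[symmetric] w_def[symmetric]
        using b x by (simp add: real_sqrt_mult abs_mult)
      also have "\<dots> \<le> (1 + x) * \<bar>s - t\<bar> * (\<sigma> + x)"
        using speed x(1) by (intro mult_left_mono) auto
      also have "\<dots> = (1 + x) * (\<sigma> + x) * \<bar>s - t\<bar>" by simp
      also have "\<dots> \<le> (\<sigma> + \<epsilon>) * \<bar>s - t\<bar>" using x' by (rule mult_right_mono) simp
      finally show ?thesis by (simp add: \<sigma>_def)
    qed
  qed
qed

text \<open>With an error \<open>\<epsilon> * (t - s)\<close> the inequality is preserved when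
  adjacent intervals are joined, by the triangle inequality, and it holds on all short intervals
  around a given point. Bisection then yields it on the whole piece, without any differentiability
  of the distance.\<close>

lemma cone_distance_le_length:
  "cone_distance a b (\<gamma> p) (\<gamma> q) \<le> integral {p..q} (\<lambda>t. sqrt (elastic_metric a b (\<gamma> t) (d t) (d t)))"
proof (rule field_le_epsilon)
  fix y :: real assume "y > 0"
  define \<epsilon> where "\<epsilon> = y / (q - p)"
  have \<epsilon>: "\<epsilon> > 0" using \<open>y > 0\<close> pq by (simp add: \<epsilon>_def)
  define \<sigma> where "\<sigma> t = sqrt (elastic_metric a b (\<gamma> t) (d t) (d t))" for t
  have cont: "continuous_on {p..q} \<sigma>" using continuous_on_speed by (simp add: \<sigma>_def)
  have integ: "\<sigma> integrable_on {s..t}" if "p \<le> s" "t \<le> q" for s t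
    using that by (intro integrable_continuous_real continuous_on_subset[OF cont]) auto
  define P where "P s t \<longleftrightarrow> (p \<le> s \<and> s \<le> t \<and> t \<le> q \<longrightarrow> cone_distance a b (\<gamma> s) (\<gamma> t) \<le> integral {s..t} \<sigma> + \<epsilon> * (t - s))" for s t
  have "P p q"
  proof (induction rule: Bolzano[OF less_imp_le[OF pq]])
    case (1 s t r)
    show ?case unfolding P_def
    proof (intro impI)
      assume *: "p \<le> s \<and> s \<le> r \<and> r \<le> q"
      have "cone_distance a b (\<gamma> s) (\<gamma> r) \<le> cone_distance a b (\<gamma> s) (\<gamma> t) + cone_distance a b (\<gamma> t) (\<gamma> r)"
        using * 1 a b by (intro cone_distance_triangle imm) auto
      also have "\<dots> \<le> (integral {s..t} \<sigma> + \<epsilon> * (t - s)) + (integral {t..r} \<sigma> + \<epsilon> * (r - t))"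
        using * 1 by (intro add_mono) (auto simp: P_def)
      also have "\<dots> = integral {s..r} \<sigma> + \<epsilon> * (r - s)"
        using Henstock_Kurzweil_Integration.integral_combine[of s t r \<sigma>] 1 * integ[of s r] by (simp add: algebra_simps)
      finally show "cone_distance a b (\<gamma> s) (\<gamma> r) \<le> integral {s..r} \<sigma> + \<epsilon> * (r - s)" .
    qed
  next
    case (2 x)
    then have x: "x \<in> {p..q}" by simp
    obtain r1 where r1: "r1 > 0" "\<forall>s\<in>{p..q}. \<bar>s - x\<bar> < r1 \<longrightarrow>
        cone_distance a b (\<gamma> x) (\<gamma> s) \<le> (\<sigma> x + \<epsilon> / 2) * \<bar>s - x\<bar>"
      using cone_distance_local_speed[OF x, of "\<epsilon>/2"] \<epsilon> by (auto simp: \<sigma>_def)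
    obtain r2 where r2: "r2 > 0" "\<forall>s\<in>{p..q}. \<bar>s - x\<bar> < r2 \<longrightarrow> \<bar>\<sigma> s - \<sigma> x\<bar> < \<epsilon> / 2"
      using cont x \<epsilon> unfolding continuous_on_iff dist_real_def by (metis half_gt_zero)
    show ?case
    proof (intro exI[of _ "min r1 r2"] conjI allI impI)
      show "min r1 r2 > 0" using r1 r2 by simp
      fix s t assume st: "s \<le> x \<and> x \<le> t \<and> t - s < min r1 r2"
      show "P s t" unfolding P_def
      proof (intro impI)
        assume *: "p \<le> s \<and> s \<le> t \<and> t \<le> q"
        have "cone_distance a b (\<gamma> s) (\<gamma> t) \<le> cone_distance a b (\<gamma> s) (\<gamma> x) + cone_distance a b (\<gamma> x) (\<gamma> t)"
          using * st a b by (intro cone_distance_triangle imm) auto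
        also have "cone_distance a b (\<gamma> s) (\<gamma> x) = cone_distance a b (\<gamma> x) (\<gamma> s)"
          by (rule cone_distance_commute)
        also have "cone_distance a b (\<gamma> x) (\<gamma> s) + cone_distance a b (\<gamma> x) (\<gamma> t)
          \<le> (\<sigma> x + \<epsilon> / 2) * \<bar>s - x\<bar> + (\<sigma> x + \<epsilon> / 2) * \<bar>t - x\<bar>"
          using bspec[OF r1(2), of s] bspec[OF r1(2), of t] * st by (intro add_mono) auto
        \<comment> \<open>Half of the error pays for \<open>cone_distance_local_speed\<close>, the
          other half for the oscillation of the speed near \<open>x\<close>.\<close>
        also have "\<dots> = (\<sigma> x - \<epsilon> / 2) * (t - s) + \<epsilon> * (t - s)" using st by (simp add: field_simps)
        also have "(\<sigma> x - \<epsilon> / 2) * (t - s) \<le> integral {s..t} \<sigma>"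
        proof -
          have "integral {s..t} (\<lambda>_. \<sigma> x - \<epsilon> / 2) \<le> integral {s..t} \<sigma>"
          proof (intro integral_le integ)
            fix z assume "z \<in> {s..t}"
            then have "\<bar>\<sigma> z - \<sigma> x\<bar> < \<epsilon> / 2" using r2(2) * st by auto
            then show "\<sigma> x - \<epsilon> / 2 \<le> \<sigma> z" by linarith
          qed (use * in auto)
          then show ?thesis using * by (simp add: mult.commute)
        qed
        finally show "cone_distance a b (\<gamma> s) (\<gamma> t) \<le> integral {s..t} \<sigma> + \<epsilon> * (t - s)" by simp
      qed
    qed
  qed
  then show "cone_distance a b (\<gamma> p) (\<gamma> q) \<le> integral {p..q} (\<lambda>t. sqrt (elastic_metric a b (\<gamma> t) (d t) (d t))) + y"
    using pq by (simp add: P_def \<sigma>_def[abs_def] \<epsilon>_def)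
qed

lemma speed_has_integral:
  assumes "{p..q} \<subseteq> {0..1}"
  shows "((\<lambda>t. sqrt (elastic_metric a b (\<gamma> t) (velocity \<gamma> t) (velocity \<gamma> t))) has_integral
    integral {p..q} (\<lambda>t. sqrt (elastic_metric a b (\<gamma> t) (d t) (d t)))) {p..q}"
proof (rule has_integral_spike_finite[of "{p, q}"])
  show "((\<lambda>t. sqrt (elastic_metric a b (\<gamma> t) (d t) (d t))) has_integral
    integral {p..q} (\<lambda>t. sqrt (elastic_metric a b (\<gamma> t) (d t) (d t)))) {p..q}"
    by (intro integrable_integral integrable_continuous_real continuous_on_speed)
  fix t assume "t \<in> {p..q} - {p, q}"
  then have "velocity \<gamma> t = d t" using velocity_eq[OF d _ _ assms] by auto
  then show "sqrt (elastic_metric a b (\<gamma> t) (velocity \<gamma> t) (velocity \<gamma> t)) = sqrt (elastic_metric a b (\<gamma> t) (d t) (d t))"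
    by simp
qed simp

end

lemma partition_bounds:
  fixes \<tau> :: "nat \<Rightarrow> real"
  assumes "\<tau> 0 = 0" "\<tau> n = 1" "\<And>i. i < n \<Longrightarrow> \<tau> i < \<tau> (Suc i)" "i \<le> n"
  shows "0 \<le> \<tau> i" "\<tau> i \<le> 1"
proof -
  have "\<tau> i \<le> \<tau> j" if "i \<le> j" "j \<le> n" for i j
    using that
  proof (induction j rule: dec_induct)
    case (step m)
    then show ?case using assms(3)[of m] by simp
  qed simp
  from this[of 0 i] this[of i n] show "0 \<le> \<tau> i" "\<tau> i \<le> 1" using assms by auto
qed

lemma has_integral_partition:
  fixes \<tau> I :: "nat \<Rightarrow> real" and f :: "real \<Rightarrow> real"
  assumes "\<tau> 0 = 0" "\<tau> n = 1" "\<And>i. i < n \<Longrightarrow> \<tau> i < \<tau> (Suc i)"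
    and "\<And>i. i < n \<Longrightarrow> (f has_integral I i) {\<tau> i..\<tau> (Suc i)}"
  shows "(f has_integral (\<Sum>i<n. I i)) {0..1}"
proof -
  have "(f has_integral (\<Sum>j<i. I j)) {0..\<tau> i}" if "i \<le> n" for i
    using that
  proof (induction i)
    case 0
    then show ?case using assms(1) by (simp add: has_integral_refl)
  next
    case (Suc i)
    then show ?case
      using partition_bounds(1)[OF assms(1-3), of i] assms(3)[of i] assms(4)[of i]
      by (auto intro!: has_integral_combine[of 0 "\<tau> i"] simp: less_imp_le)
  qed
  from this[of n] show ?thesis using assms(2) by simp
qed

lemma cone_distance_le_path_length:
  fixes \<gamma> :: "real \<Rightarrow> 'a::euclidean_space smooth_map"
  assumes "a > 0" "b > 0" and \<gamma>: "piecewise_smooth_path \<gamma>" and imm: "\<And>t. t \<in> {0..1} \<Longrightarrow> \<gamma> t \<in> immersions0"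
  shows "cone_distance a b (\<gamma> 0) (\<gamma> 1) \<le> path_length (elastic_metric a b) \<gamma>"
proof -
  obtain n \<tau> where \<tau>: "\<tau> 0 = 0" "\<tau> n = 1" "\<And>i. i < n \<Longrightarrow> \<tau> i < \<tau> (Suc i)"
    and smooth: "\<And>i. i < n \<Longrightarrow> smooth_path_on {\<tau> i..\<tau> (Suc i)} \<gamma>"
    using \<gamma> unfolding piecewise_smooth_path_def by auto
  have "\<exists>I. ((\<lambda>t. sqrt (elastic_metric a b (\<gamma> t) (velocity \<gamma> t) (velocity \<gamma> t))) has_integral I) {\<tau> i..\<tau> (Suc i)}
     \<and> cone_distance a b (\<gamma> (\<tau> i)) (\<gamma> (\<tau> (Suc i))) \<le> I" if i: "i < n" for i
  proof -
    let ?S = "{\<tau> i..\<tau> (Suc i)}"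
    obtain D where D0: "\<And>t. t \<in> ?S \<Longrightarrow> D 0 t = \<gamma> t"
      and D: "\<And>k t. t \<in> ?S \<Longrightarrow> ((\<lambda>s. (D k s - D k t) /\<^sub>R (s - t)) \<longlongrightarrow> D (Suc k) t) (at t within ?S)"
      using smooth[OF i] unfolding smooth_path_on_def by blast
    have sub: "?S \<subseteq> {0..1}"
      using partition_bounds[OF \<tau>, of i] partition_bounds[OF \<tau>, of "Suc i"] i by auto
    have d: "((\<lambda>s. (\<gamma> s - \<gamma> t) /\<^sub>R (s - t)) \<longlongrightarrow> D 1 t) (at t within ?S)" if t: "t \<in> ?S" for t
    proof -
      have "\<forall>\<^sub>F s in at t within ?S. (D 0 s - D 0 t) /\<^sub>R (s - t) = (\<gamma> s - \<gamma> t) /\<^sub>R (s - t)"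
        using D0 t by (auto simp: eventually_at_filter)
      with D[OF t, of 0] show ?thesis using Lim_transform_eventually by fastforce
    qed
    have e: "((\<lambda>s. (D 1 s - D 1 t) /\<^sub>R (s - t)) \<longlongrightarrow> D 2 t) (at t within ?S)" if t: "t \<in> ?S" for t
      using D[OF t, of 1] by (simp add: numeral_2_eq_2)
    show ?thesis
      using speed_has_integral[OF assms(1,2) \<tau>(3)[OF i] _ d e sub] cone_distance_le_length[OF assms(1,2) \<tau>(3)[OF i] _ d e]
        imm sub by blast
  qed
  then obtain I where I: "\<And>i. i < n \<Longrightarrow>
    ((\<lambda>t. sqrt (elastic_metric a b (\<gamma> t) (velocity \<gamma> t) (velocity \<gamma> t))) has_integral I i) {\<tau> i..\<tau> (Suc i)}"
    "\<And>i. i < n \<Longrightarrow> cone_distance a b (\<gamma> (\<tau> i)) (\<gamma> (\<tau> (Suc i))) \<le> I i"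
    by metis
  have "cone_distance a b (\<gamma> 0) (\<gamma> (\<tau> i)) \<le> (\<Sum>j<i. I j)" if "i \<le> n" for i
    using that
  proof (induction i)
    case 0
    then show ?case using \<tau>(1) by (simp add: cone_distance_self)
  next
    case (Suc i)
    have "cone_distance a b (\<gamma> 0) (\<gamma> (\<tau> (Suc i))) \<le> cone_distance a b (\<gamma> 0) (\<gamma> (\<tau> i)) + cone_distance a b (\<gamma> (\<tau> i)) (\<gamma> (\<tau> (Suc i)))"
      using partition_bounds[OF \<tau>, of i] partition_bounds[OF \<tau>, of "Suc i"] Suc.prems assms(1,2)
      by (intro cone_distance_triangle imm) auto
    then show ?case using Suc I(2)[of i] by simp
  qed
  from this[of n] have "cone_distance a b (\<gamma> 0) (\<gamma> 1) \<le> (\<Sum>j<n. I j)" using \<tau>(2) by simp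
  also have "\<dots> = path_length (elastic_metric a b) \<gamma>"
    unfolding path_length_def using has_integral_partition[OF \<tau> I(1)] by (simp add: integral_unique)
  finally show ?thesis .
qed

section \<open>Almost minimizing polygons\<close>

text \<open>
  At \<open>t = 1\<close> the index is \<open>N\<close>, but the coefficient of \<open>c (Suc N)\<close> is then 0.
\<close>

definition polygon :: "nat \<Rightarrow> (nat \<Rightarrow> 'a::real_normed_vector smooth_map) \<Rightarrow> real \<Rightarrow> 'a smooth_map" where
  "polygon N c t = (let i = nat \<lfloor>real N * t\<rfloor> in c i + (real N * t - real i) *\<^sub>R (c (Suc i) - c i))"

lemma polygon_eq:
  assumes "N > 0" "t \<in> {real i / real N..real (Suc i) / real N}"
  shows "polygon N c t = c i + (real N * t - real i) *\<^sub>R (c (Suc i) - c i)"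
proof -
  have t: "real i \<le> real N * t" "real N * t \<le> real i + 1"
    using assms by (auto simp: field_simps)
  show ?thesis
  proof (cases "real N * t = real i + 1")
    case True
    then have "nat \<lfloor>real N * t\<rfloor> = Suc i" by (simp add: nat_add_distrib)
    then show ?thesis using True by (simp add: polygon_def Let_def)
  next
    case False
    then have "\<lfloor>real N * t\<rfloor> = int i" using t by (intro floor_unique) auto
    then have "nat \<lfloor>real N * t\<rfloor> = i" by simp
    then show ?thesis by (simp add: polygon_def Let_def)
  qed
qed

lemma polygon_derivative:
  assumes "N > 0" "t \<in> {real i / real N..real (Suc i) / real N}"
  shows "((\<lambda>s. (polygon N c s - polygon N c t) /\<^sub>R (s - t)) \<longlongrightarrow> real N *\<^sub>R (c (Suc i) - c i))
    (at t within {real i / real N..real (Suc i) / real N})"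
proof (rule tendsto_eventually)
  have "(polygon N c s - polygon N c t) /\<^sub>R (s - t) = real N *\<^sub>R (c (Suc i) - c i)"
    if s: "s \<in> {real i / real N..real (Suc i) / real N}" "s \<noteq> t" for s
  proof -
    have "polygon N c s - polygon N c t = (real N * (s - t)) *\<^sub>R (c (Suc i) - c i)"
      unfolding polygon_eq[OF assms] polygon_eq[OF assms(1) s(1)] by (simp add: algebra_simps)
    then show ?thesis using s(2) by simp
  qed
  then show "\<forall>\<^sub>F s in at t within {real i / real N..real (Suc i) / real N}.
     (polygon N c s - polygon N c t) /\<^sub>R (s - t) = real N *\<^sub>R (c (Suc i) - c i)"
    by (auto simp: eventually_at_filter)
qed

lemma smooth_path_on_polygon:
  assumes "N > 0"
  shows "smooth_path_on {real i / real N..real (Suc i) / real N} (polygon N c)"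
  unfolding smooth_path_on_def
proof (intro exI[of _ "\<lambda>k t. if k = 0 then polygon N c t else if k = 1 then real N *\<^sub>R (c (Suc i) - c i) else 0"]
    conjI allI ballI)
  fix k t assume "t \<in> {real i / real N..real (Suc i) / real N}"
  then show "((\<lambda>s. ((if k = 0 then polygon N c s else if k = 1 then real N *\<^sub>R (c (Suc i) - c i) else 0) -
      (if k = 0 then polygon N c t else if k = 1 then real N *\<^sub>R (c (Suc i) - c i) else 0)) /\<^sub>R (s - t)) \<longlongrightarrow>
      (if Suc k = 0 then polygon N c t else if Suc k = 1 then real N *\<^sub>R (c (Suc i) - c i) else 0))
      (at t within {real i / real N..real (Suc i) / real N})"
    using polygon_derivative[OF assms] by (cases "k = 0") (auto simp: if_distrib cong: if_cong)
qed auto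

lemma piecewise_smooth_polygon:
  assumes "N > 0"
  shows "piecewise_smooth_path (polygon N c)"
  unfolding piecewise_smooth_path_def
  using assms smooth_path_on_polygon[OF assms, of _ c]
  by (intro exI[of _ N] exI[of _ "\<lambda>i. real i / real N"]) (auto simp: divide_strict_right_mono)

text \<open>Immersions do not form a convex set; with relative distance below 1, however, no segment
  between the two derivatives reaches 0.\<close>

lemma segment_immersion:
  assumes "c \<in> immersions0" "c' \<in> immersions0" "k < 1" "0 \<le> t" "t \<le> 1"
    and close: "\<And>u. u \<in> {0..1} \<Longrightarrow> norm (ev (D\<^sub>u c') u - ev (D\<^sub>u c) u) \<le> k * norm (ev (D\<^sub>u c) u)"
  shows "c + t *\<^sub>R (c' - c) \<in> immersions0"
proof -
  have "ev (D\<^sub>u c) u + t *\<^sub>R (ev (D\<^sub>u c') u - ev (D\<^sub>u c) u) \<noteq> 0" if u: "u \<in> {0..1}" for u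
  proof
    let ?v = "ev (D\<^sub>u c) u"
    have v: "?v \<noteq> 0" using assms(1) u by (auto simp: immersions0_def)
    assume "?v + t *\<^sub>R (ev (D\<^sub>u c') u - ?v) = 0"
    then have "norm ?v = t * norm (ev (D\<^sub>u c') u - ?v)"
      using assms(4) by (metis abs_of_nonneg add_eq_0_iff norm_minus_cancel norm_scaleR)
    also have "\<dots> \<le> norm (ev (D\<^sub>u c') u - ?v)" using assms(4,5) by (simp add: mult_left_le_one_le)
    also have "\<dots> \<le> k * norm ?v" by (rule close[OF u])
    finally show False using v assms(3) mult_strict_right_mono[of k 1 "norm ?v"] by simp
  qed
  then show ?thesis
    using assms(1,2) by (auto simp: immersions0_def D\<^sub>u_add D\<^sub>u_scaleR D\<^sub>u_diff)
qed

text \<open>On an edge the velocity is constant, and only the base point of the metric moves.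
  \<open>elastic_form_perturb\<close> freezes the base point at the start of the edge, where
  \<open>cone_dist2_local\<close> compares the tensor of the increment with the distance.\<close>

lemma geodesic_dist_polygon:
  fixes a b e :: real
  assumes "e > 0" and a: "a > 0" and b: "b > 0"
  obtains k where "0 < k" "k < 1" "\<And>N (c :: nat \<Rightarrow> 'a::euclidean_space smooth_map). N > 0 \<Longrightarrow>
    (\<And>i. i \<le> N \<Longrightarrow> c i \<in> immersions0) \<Longrightarrow>
    (\<And>i u. i < N \<Longrightarrow> u \<in> {0..1} \<Longrightarrow> norm (ev (D\<^sub>u (c (Suc i))) u - ev (D\<^sub>u (c i)) u) \<le> k * norm (ev (D\<^sub>u (c i)) u)) \<Longrightarrow>
    geodesic_dist immersions0 (elastic_metric a b) (c 0) (c N)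
      \<le> ereal ((1 + e) * (\<Sum>i<N. cone_distance a b (c i) (c (Suc i))))"
proof -
  \<comment> \<open>Chosen so that the loss \<open>1 + e / 2\<close> of freezing the base point and
    the loss \<open>1 / (1 - e2)\<close> of the local comparison multiply to
    \<open>1 + e\<close>.\<close>
  define e2 where "e2 = e / (2 * (1 + e))"
  have e2: "0 < e2" "e2 < 1" "1 + e / 2 = (1 + e) * (1 - e2)"
    using assms(1) by (simp_all add: e2_def field_simps)
  obtain k1 where k1: "0 < k1" "k1 < 1" "\<And>v v' x :: 'a. v \<noteq> 0 \<Longrightarrow> norm (v' - v) \<le> k1 * norm v \<Longrightarrow>
    elastic_form a b v' x \<le> (1 + e / 2) * elastic_form a b v x"
    using elastic_form_perturb[of "e/2" a b] assms by (metis half_gt_zero)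
  obtain k2 where k2: "0 < k2" "k2 < 1" "\<And>v w :: 'a. v \<noteq> 0 \<Longrightarrow> norm (w - v) \<le> k2 * norm v \<Longrightarrow>
     (1 - e2) * sqrt (elastic_form a b v (w - v)) \<le> 2 * b * sqrt (cone_dist2 (a / (2 * b)) v w)"
    using cone_dist2_local[OF e2(1) a b refl] by metis
  define k where "k = min k1 k2"
  have k: "0 < k" "k < 1" using k1 k2 by (auto simp: k_def)
  show thesis
  proof (rule that[OF k])
    fix N and c :: "nat \<Rightarrow> 'a smooth_map"
    assume N: "N > 0" and imm: "\<And>i. i \<le> N \<Longrightarrow> c i \<in> immersions0"
      and close: "\<And>i u. i < N \<Longrightarrow> u \<in> {0..1} \<Longrightarrow> norm (ev (D\<^sub>u (c (Suc i))) u - ev (D\<^sub>u (c i)) u) \<le> k * norm (ev (D\<^sub>u (c i)) u)"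
    let ?\<gamma> = "polygon N c"
    let ?T = "\<lambda>i. {real i / real N..real (Suc i) / real N}"
    let ?s = "\<lambda>t. sqrt (elastic_metric a b (?\<gamma> t) (velocity ?\<gamma> t) (velocity ?\<gamma> t))"
    have T: "0 \<le> real N * t - real i" "real N * t - real i \<le> 1" if "t \<in> ?T i" for t i
      using that N by (auto simp: field_simps)
    have imm_piece: "?\<gamma> t \<in> immersions0" if i: "i < N" and t: "t \<in> ?T i" for i t
      unfolding polygon_eq[OF N t] using i k T[OF t] imm[of i] imm[of "Suc i"] close[OF i]
      by (intro segment_immersion[of _ _ k]) auto
    have cover: "\<exists>i<N. t \<in> ?T i" if t: "t \<in> {0..1}" for t
    proof (cases "t = 1")
      case True
      then show ?thesis using N by (intro exI[of _ "N - 1"]) (auto simp: field_simps of_nat_diff)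
    next
      case False
      have i: "real (nat \<lfloor>real N * t\<rfloor>) \<le> real N * t" "real N * t \<le> real (Suc (nat \<lfloor>real N * t\<rfloor>))"
      proof -
        have "0 \<le> \<lfloor>real N * t\<rfloor>" using t by simp
        then show "real (nat \<lfloor>real N * t\<rfloor>) \<le> real N * t" "real N * t \<le> real (Suc (nat \<lfloor>real N * t\<rfloor>))"
          by linarith+
      qed
      have "real N * t < real N" using False t N by simp
      then have "nat \<lfloor>real N * t\<rfloor> < N" using i(1) by linarith
      then show ?thesis using i N by (intro exI[of _ "nat \<lfloor>real N * t\<rfloor>"]) (auto simp: field_simps)
    qed
    have imm_all: "?\<gamma> t \<in> immersions0" if "t \<in> {0..1}" for t
      using cover[OF that] imm_piece by blast
    have piece: "\<exists>I. (?s has_integral I) (?T i) \<and> I \<le> (1 + e) * cone_distance a b (c i) (c (Suc i))" if i: "i < N" for i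
    proof -
      let ?h = "c (Suc i) - c i"
      have pq: "real i / real N < real (Suc i) / real N" using N by (simp add: divide_strict_right_mono)
      have sub: "?T i \<subseteq> {0..1}" using i N by (auto simp: field_simps)
      have d: "((\<lambda>s. (?\<gamma> s - ?\<gamma> t) /\<^sub>R (s - t)) \<longlongrightarrow> real N *\<^sub>R ?h) (at t within ?T i)" if "t \<in> ?T i" for t
        by (rule polygon_derivative[OF N that])
      have d2: "((\<lambda>s. (real N *\<^sub>R ?h - real N *\<^sub>R ?h) /\<^sub>R (s - t)) \<longlongrightarrow> 0) (at t within ?T i)" for t
        by simp
      let ?\<sigma> = "\<lambda>t. sqrt (elastic_metric a b (?\<gamma> t) (real N *\<^sub>R ?h) (real N *\<^sub>R ?h))"
      have 1: "(?s has_integral integral (?T i) ?\<sigma>) (?T i)"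
        by (rule speed_has_integral[OF a b pq imm_piece[OF i] d d2 sub])
      have bound: "?\<sigma> t \<le> real N * ((1 + e) * cone_distance a b (c i) (c (Suc i)))" if t: "t \<in> ?T i" for t
      proof -
        define v w where "v = D\<^sub>u (c i)" and "w = D\<^sub>u (c (Suc i))"
        have vw: "v \<in> nonvanishing_maps" "w \<in> nonvanishing_maps"
          using imm[of i] imm[of "Suc i"] i by (simp_all add: v_def w_def D\<^sub>u_immersion)
        have v': "D\<^sub>u (?\<gamma> t) \<in> nonvanishing_maps" using D\<^sub>u_immersion[OF imm_piece[OF i t]] .
        have "elastic_metric a b (?\<gamma> t) (real N *\<^sub>R ?h) (real N *\<^sub>R ?h)
          = integral {0..1} (\<lambda>u. elastic_form a b (ev (D\<^sub>u (?\<gamma> t)) u) (ev (D\<^sub>u (real N *\<^sub>R ?h)) u))"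
          by (rule elastic_metric_form[OF imm_piece[OF i t]])
        also have "\<dots> \<le> integral {0..1} (\<lambda>u. (real N)\<^sup>2 * ((1 + e)\<^sup>2 * ((2 * b)\<^sup>2 * cone_dist2 (a / (2 * b)) (ev v u) (ev w u))))"
        proof (intro integral_le integrable_continuous_real continuous_intros continuous_cone_dist2_ev continuous_elastic_form vw v')
          fix u :: real assume u: "u \<in> {0..1}"
          let ?v = "ev v u" and ?w = "ev w u"
          have nz: "?v \<noteq> 0" using nonvanishing_mapsD[OF vw(1) u] .
          have cl: "norm (?w - ?v) \<le> k * norm ?v" using close[OF i u] by (simp add: v_def w_def)
          have \<gamma>': "ev (D\<^sub>u (?\<gamma> t)) u = ?v + (real N * t - real i) *\<^sub>R (?w - ?v)"
            unfolding polygon_eq[OF N t] by (simp add: D\<^sub>u_add D\<^sub>u_scaleR D\<^sub>u_diff v_def w_def)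
          have "norm (ev (D\<^sub>u (?\<gamma> t)) u - ?v) \<le> norm (?w - ?v)"
            unfolding \<gamma>' using T[OF t] by (simp add: mult_left_le_one_le)
          also have "\<dots> \<le> k1 * norm ?v"
            using cl mult_right_mono[of k k1 "norm ?v"] by (simp add: k_def)
          finally have "elastic_form a b (ev (D\<^sub>u (?\<gamma> t)) u) (?w - ?v) \<le> (1 + e / 2) * elastic_form a b ?v (?w - ?v)"
            using k1(3) nz by blast
          also have "\<dots> \<le> (1 + e / 2)\<^sup>2 * elastic_form a b ?v (?w - ?v)"
            using assms(1) by (intro mult_right_mono elastic_form_nonneg) (simp add: power2_eq_square)
          also have "\<dots> = (1 + e)\<^sup>2 * ((1 - e2) * sqrt (elastic_form a b ?v (?w - ?v)))\<^sup>2"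
            unfolding e2(3) by (simp add: power_mult_distrib elastic_form_nonneg)
          also have "\<dots> \<le> (1 + e)\<^sup>2 * (2 * b * sqrt (cone_dist2 (a / (2 * b)) ?v ?w))\<^sup>2"
          proof (intro mult_left_mono power_mono)
            have "norm (?w - ?v) \<le> k2 * norm ?v"
              using cl mult_right_mono[of k k2 "norm ?v"] by (simp add: k_def)
            then show "(1 - e2) * sqrt (elastic_form a b ?v (?w - ?v)) \<le> 2 * b * sqrt (cone_dist2 (a / (2 * b)) ?v ?w)"
              using k2(3) nz by blast
          qed (use e2 in \<open>auto simp: elastic_form_nonneg\<close>)
          also have "\<dots> = (1 + e)\<^sup>2 * ((2 * b)\<^sup>2 * cone_dist2 (a / (2 * b)) ?v ?w)"
            by (simp add: power_mult_distrib cone_dist2_nonneg)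
          finally have "elastic_form a b (ev (D\<^sub>u (?\<gamma> t)) u) (?w - ?v) \<le> (1 + e)\<^sup>2 * ((2 * b)\<^sup>2 * cone_dist2 (a / (2 * b)) ?v ?w)" .
          moreover have "ev (D\<^sub>u (real N *\<^sub>R ?h)) u = real N *\<^sub>R (?w - ?v)"
            by (simp add: D\<^sub>u_scaleR D\<^sub>u_diff v_def w_def)
          ultimately show "elastic_form a b (ev (D\<^sub>u (?\<gamma> t)) u) (ev (D\<^sub>u (real N *\<^sub>R ?h)) u)
            \<le> (real N)\<^sup>2 * ((1 + e)\<^sup>2 * ((2 * b)\<^sup>2 * cone_dist2 (a / (2 * b)) ?v ?w))"
            by (simp add: elastic_form_scaleR mult_left_mono)
        qed
        also have "\<dots> = (real N)\<^sup>2 * ((1 + e)\<^sup>2 * ((2 * b)\<^sup>2 * cone_energy (a / (2 * b)) v w))"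
          by (simp add: cone_energy_def)
        also have "\<dots> = (real N * ((1 + e) * cone_distance a b (c i) (c (Suc i))))\<^sup>2"
          using cone_energy_nonneg[OF vw] by (simp add: cone_distance_def v_def w_def power_mult_distrib)
        finally show ?thesis
          using assms(1) b cone_energy_nonneg[OF vw, of "a / (2 * b)"]
          by (intro real_le_lsqrt) (auto simp: cone_distance_def v_def w_def)
      qed
      have "integral (?T i) ?\<sigma> \<le> integral (?T i) (\<lambda>_. real N * ((1 + e) * cone_distance a b (c i) (c (Suc i))))"
        by (intro integral_le integrable_continuous_real continuous_on_speed[OF a b pq imm_piece[OF i] d d2] bound) auto
      also have "\<dots> = (real (Suc i) / real N - real i / real N) * (real N * ((1 + e) * cone_distance a b (c i) (c (Suc i))))"
        using pq by simp
      also have "real (Suc i) / real N - real i / real N = 1 / real N" by (simp add: diff_divide_distrib[symmetric])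
      also have "1 / real N * (real N * ((1 + e) * cone_distance a b (c i) (c (Suc i)))) = (1 + e) * cone_distance a b (c i) (c (Suc i))"
        using N by simp
      finally show ?thesis using 1 by blast
    qed
    have "\<exists>I. \<forall>i\<in>{..<N}. (?s has_integral I i) (?T i) \<and> I i \<le> (1 + e) * cone_distance a b (c i) (c (Suc i))"
      using piece by (intro bchoice) blast
    then obtain I where "\<forall>i\<in>{..<N}. (?s has_integral I i) (?T i) \<and> I i \<le> (1 + e) * cone_distance a b (c i) (c (Suc i))"
      by (rule exE)
    then have I: "\<And>i. i < N \<Longrightarrow> (?s has_integral I i) (?T i)"
      "\<And>i. i < N \<Longrightarrow> I i \<le> (1 + e) * cone_distance a b (c i) (c (Suc i))"
      by blast+
    have "(?s has_integral (\<Sum>i<N. I i)) {0..1}"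
      using N I(1) by (intro has_integral_partition[of "\<lambda>i. real i / real N"]) (auto simp: divide_strict_right_mono)
    then have "path_length (elastic_metric a b) ?\<gamma> = (\<Sum>i<N. I i)"
      unfolding path_length_def by (simp add: integral_unique)
    also have "\<dots> \<le> (1 + e) * (\<Sum>i<N. cone_distance a b (c i) (c (Suc i)))"
      unfolding sum_distrib_left by (rule sum_mono) (use I in auto)
    finally have len: "ereal (path_length (elastic_metric a b) ?\<gamma>)
      \<le> ereal ((1 + e) * (\<Sum>i<N. cone_distance a b (c i) (c (Suc i))))" by simp
    have ends: "?\<gamma> 0 = c 0" "?\<gamma> 1 = c N" by (simp_all add: polygon_def Let_def)
    show "geodesic_dist immersions0 (elastic_metric a b) (c 0) (c N)
      \<le> ereal ((1 + e) * (\<Sum>i<N. cone_distance a b (c i) (c (Suc i))))"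
      unfolding geodesic_dist_def
      by (rule INF_lower2[where i = ?\<gamma>]) (use piecewise_smooth_polygon[OF N] imm_all ends len in auto)
  qed
qed

section \<open>Chains of smooth maps close to the pointwise paths\<close>

lemma smooth_map_of:
  fixes f :: "real \<Rightarrow> 'a::real_normed_vector"
  assumes "smooth01 f"
  obtains g where "\<And>u. u \<in> {0..1} \<Longrightarrow> ev g u = f u"
proof -
  have "Ck k (\<lambda>u. if u \<in> {0..1} then f u else 0)" for k
    by (rule Ck_cong[of k f]) (use assms smooth01_iff_Ck in auto)
  then have "smooth01 (\<lambda>u. if u \<in> {0..1} then f u else 0)"
    by (simp only: smooth01_iff_Ck) blast
  then show thesis
    by (intro that[of "mk_smooth_map (\<lambda>u. if u \<in> {0..1} then f u else 0)"]) (subst ev_mk; auto)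
qed

lemma smooth01_polynomial_function:
  fixes p :: "real \<Rightarrow> 'a::euclidean_space"
  assumes "polynomial_function p"
  shows "smooth01 p"
proof -
  have "polynomial_function p \<Longrightarrow> Ck k p" for k
  proof (induction k arbitrary: p)
    case 0
    then show ?case by (simp add: continuous_on_polymonial_function)
  next
    case (Suc k)
    obtain p' where "polynomial_function p'" "\<And>x. (p has_vector_derivative p' x) (at x)"
      using has_vector_derivative_polynomial_function[OF Suc.prems] by blast
    then show ?case
      using Suc.IH by (auto intro!: exI[of _ p'] intro: has_vector_derivative_at_within)
  qed
  then show ?thesis using assms by (simp add: smooth01_iff_Ck)
qed

lemma smooth_approximation:
  fixes f :: "real \<Rightarrow> 'a::euclidean_space"
  assumes "continuous_on {0..1} f" "e > 0"
  obtains p where "\<And>u. u \<in> {0..1} \<Longrightarrow> norm (ev p u - f u) < e"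
proof -
  obtain g where g: "polynomial_function g" "\<forall>u\<in>{0..1}. norm (f u - g u) < e"
    using Stone_Weierstrass_polynomial_function[OF compact_Icc assms] by blast
  obtain p where "\<And>u. u \<in> {0..1} \<Longrightarrow> ev p u = g u"
    using smooth_map_of[OF smooth01_polynomial_function[OF g(1)]] by blast
  then show thesis using g(2) by (intro that[of p]) (auto simp: norm_minus_commute)
qed

text \<open>\<open>cone_path\<close> is shown to be continuous in \<open>u\<close>, not smooth, so
  its subdivision points are replaced by polynomials. Uniform closeness suffices, because
  \<open>cone_energy\<close> and the step condition involve values only. The number \<open>N\<close>
  is fixed first, and the approximation is made as fine as \<open>N\<close> requires.\<close>

lemma smooth_chain:
  fixes v w :: "'a::euclidean_space smooth_map"
  assumes lam: "lam > 0" and v: "v \<in> nonvanishing_maps" and w: "w \<in> nonvanishing_maps"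
    and ang: "\<And>u. u \<in> {0..1} \<Longrightarrow> vang (ev v u) (ev w u) < pi"
    and k: "k > 0" and e: "e > 0"
  obtains N p where "N > 0" "p 0 = v" "p N = w" "\<And>i. i \<le> N \<Longrightarrow> p i \<in> nonvanishing_maps"
    "\<And>i u. i < N \<Longrightarrow> u \<in> {0..1} \<Longrightarrow> norm (ev (p (Suc i)) u - ev (p i) u) \<le> k * norm (ev (p i) u)"
    "real N * (\<Sum>i<N. cone_energy lam (p i) (p (Suc i))) \<le> cone_energy lam v w + e"
proof -
  obtain mv Mv where Mv: "\<And>u. u \<in> {0..1} \<Longrightarrow> norm (ev v u) \<le> Mv"
    using nonvanishing_bounds[OF v] by metis
  obtain mw Mw where Mw: "\<And>u. u \<in> {0..1} \<Longrightarrow> norm (ev w u) \<le> Mw"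
    using nonvanishing_bounds[OF w] by metis
  define B where "B = max 1 (max Mv Mw)"
  have B: "B \<ge> 1" "\<And>u. u \<in> {0..1} \<Longrightarrow> sqrt (norm (ev v u) * norm (ev w u)) \<le> B"
  proof -
    show "B \<ge> 1" by (simp add: B_def)
    fix u :: real assume u: "u \<in> {0..1}"
    have "norm (ev v u) * norm (ev w u) \<le> B * B"
      using Mv[OF u] Mw[OF u] by (intro mult_mono) (auto simp: B_def)
    then show "sqrt (norm (ev v u) * norm (ev w u)) \<le> B"
      using \<open>B \<ge> 1\<close> by (intro real_le_lsqrt) (auto simp: power2_eq_square)
  qed
  define C where "C = 2 + 8 * lam\<^sup>2 * pi"
  have C: "C > 0" by (simp add: C_def add_pos_nonneg)
  \<comment> \<open>Makes the clamping error \<open>C * B * \<eta>\<close> of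
    \<open>cone_path_sum\<close> at most \<open>e / 2\<close>, uniformly in
    \<open>u\<close>.\<close>
  define \<eta> where "\<eta> = min (pi / 4) (e / (2 * (C * B)))"
  have \<eta>: "0 < \<eta>" "\<eta> < pi / 2"
  proof -
    show "0 < \<eta>" using C B e by (simp add: \<eta>_def)
    have "\<eta> \<le> pi / 4" by (simp add: \<eta>_def)
    then show "\<eta> < pi / 2" using pi_gt_zero by linarith
  qed
  have \<eta>e: "C * B * \<eta> \<le> e / 2"
  proof -
    have "\<eta> \<le> e / (2 * (C * B))" by (simp add: \<eta>_def)
    then show ?thesis using C B by (simp add: field_simps)
  qed
  define V where "V t u = cone_path lam \<eta> (ev v u) (ev w u) t" for t u
  define A where "A t u = sector_angle (sqrt (norm (ev v u))) (sqrt (norm (ev w u))) (clamp \<eta> (lam * vang (ev v u) (ev w u))) t" for t u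
  let ?S = "{0..1::real} \<times> {0..1::real}"
  have nz: "ev v u \<noteq> 0" "ev w u \<noteq> 0" if "u \<in> {0..1}" for u
    using nonvanishing_mapsD[OF v that] nonvanishing_mapsD[OF w that] by auto
  have cev: "continuous_on ?S (\<lambda>z. ev f (snd z))" for f :: "'a smooth_map"
    by (rule continuous_on_compose2[OF continuous_ev[of "{0..1}"]]) (auto intro: continuous_intros)
  have cont: "continuous_on ?S (\<lambda>z. A (fst z) (snd z))" "continuous_on ?S (\<lambda>z. V (fst z) (snd z))"
    unfolding A_def V_def
    by (intro continuous_on_cone_angle continuous_on_cone_path lam \<eta> cev continuous_intros; use nz ang in auto)+
  have comp: "compact ?S" by (intro compact_Times compact_Icc)
  have V0: "V t u \<noteq> 0" if "t \<in> {0..1}" "u \<in> {0..1}" for t u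
    unfolding V_def using cone_path_nonzero[OF lam \<eta> nz[OF that(2)] ang[OF that(2)]] that by auto
  obtain z1 where z1: "z1 \<in> ?S" "\<And>z. z \<in> ?S \<Longrightarrow> norm (V (fst z1) (snd z1)) \<le> norm (V (fst z) (snd z))"
    using continuous_attains_inf[OF comp _ continuous_on_norm[OF cont(2)]] by auto
  obtain z2 where z2: "z2 \<in> ?S" "\<And>z. z \<in> ?S \<Longrightarrow> norm (V (fst z) (snd z)) \<le> norm (V (fst z2) (snd z2))"
    using continuous_attains_sup[OF comp _ continuous_on_norm[OF cont(2)]] by auto
  define m M where "m = norm (V (fst z1) (snd z1))" and "M = norm (V (fst z2) (snd z2))"
  have m: "m > 0" using V0 z1(1) by (auto simp: m_def)
  have mM: "m \<le> norm (V t u)" "norm (V t u) \<le> M" if "t \<in> {0..1}" "u \<in> {0..1}" for t u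
    using z1(2)[of "(t, u)"] z2(2)[of "(t, u)"] that by (auto simp: m_def M_def)
  \<comment> \<open>The step of the path and its two approximation errors take
    \<open>k * m / 8\<close> each; together they stay below \<open>k * m / 2\<close>, and the
    approximating maps have norm at least \<open>m / 2\<close>.\<close>
  obtain \<delta>1 where \<delta>1: "\<delta>1 > 0" "\<And>z z'. z \<in> ?S \<Longrightarrow> z' \<in> ?S \<Longrightarrow> dist z' z < \<delta>1 \<Longrightarrow>
      dist (V (fst z') (snd z')) (V (fst z) (snd z)) < k * m / 8"
    using compact_uniformly_continuous[OF cont(2) comp] k m
    unfolding uniformly_continuous_on_def by (metis divide_pos_pos mult_pos_pos zero_less_numeral)
  obtain \<delta>2 where \<delta>2: "\<delta>2 > 0" "\<And>z z'. z \<in> ?S \<Longrightarrow> z' \<in> ?S \<Longrightarrow> dist z' z < \<delta>2 \<Longrightarrow>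
      dist (A (fst z') (snd z')) (A (fst z) (snd z)) < 1 / (1 + 2 * lam)"
  proof -
    have "1 / (1 + 2 * lam) > 0" using lam by simp
    then show thesis
      using that compact_uniformly_continuous[OF cont(1) comp] unfolding uniformly_continuous_on_def by metis
  qed
  obtain N where N: "N > 0" "1 / real N < min \<delta>1 \<delta>2"
    using \<delta>1(1) \<delta>2(1) by (metis min_less_iff_conj nat_approx_posE of_nat_0_less_iff zero_less_Suc inverse_eq_divide reals_Archimedean2 real_arch_inverse min_def)
  define t where "t i = real i / real N" for i
  have t: "t i \<in> {0..1}" if "i \<le> N" for i using that N(1) by (auto simp: t_def)
  have dt: "dist (t (Suc i), u) (t i, u) < min \<delta>1 \<delta>2" for i u
  proof -
    have "t (Suc i) - t i = 1 / real N" by (simp add: t_def diff_divide_distrib[symmetric])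
    then show ?thesis using N by (simp add: dist_Pair_Pair dist_real_def)
  qed
  have Vstep: "norm (V (t (Suc i)) u - V (t i) u) < k * m / 8" if "i < N" "u \<in> {0..1}" for i u
    using \<delta>1(2)[of "(t i, u)" "(t (Suc i), u)"] dt[of i u] t[of i] t[of "Suc i"] that by (simp add: dist_norm)
  have Astep: "A (t (Suc i)) u - A (t i) u \<le> 1 / (1 + 2 * lam)" if "i < N" "u \<in> {0..1}" for i u
    using \<delta>2(2)[of "(t i, u)" "(t (Suc i), u)"] dt[of i u] t[of i] t[of "Suc i"] that by (simp add: dist_real_def)
  have Vsum: "real N * (\<Sum>i<N. cone_dist2 lam (V (t i) u) (V (t (Suc i)) u)) \<le> cone_dist2 lam (ev v u) (ev w u) + e / 2"
    if u: "u \<in> {0..1}" for u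
  proof -
    have "real N * (\<Sum>i<N. cone_dist2 lam (V (t i) u) (V (t (Suc i)) u))
      \<le> cone_dist2 lam (ev v u) (ev w u) + C * sqrt (norm (ev v u) * norm (ev w u)) * \<eta>"
      unfolding V_def t_def C_def
      by (rule cone_path_sum[OF lam \<eta> nz[OF u] ang[OF u] N(1)]) (use Astep u in \<open>simp add: A_def t_def\<close>)
    also have "C * sqrt (norm (ev v u) * norm (ev w u)) * \<eta> \<le> C * B * \<eta>"
      using B(2)[OF u] C \<eta> by (intro mult_right_mono mult_left_mono) auto
    finally show ?thesis using \<eta>e by simp
  qed
  \<comment> \<open>A compact shell that avoids 0 and contains the path together with all its
    approximations; on it the distance is uniformly continuous.\<close>
  define K where "K = {x :: 'a. m / 2 \<le> norm x \<and> norm x \<le> M + 1}"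
  have "K = cball 0 (M + 1) \<inter> - ball 0 (m / 2)" by (auto simp: K_def)
  then have "compact K" by (simp add: compact_Int_closed closed_Compl)
  moreover have "continuous_on (K \<times> K) (\<lambda>z. cone_dist2 lam (fst z) (snd z))"
    using m by (intro continuous_on_cone_dist2 continuous_intros) (auto simp: K_def)
  ultimately have "uniformly_continuous_on (K \<times> K) (\<lambda>z. cone_dist2 lam (fst z) (snd z))"
    by (intro compact_uniformly_continuous compact_Times)
  \<comment> \<open>There are \<open>N\<close> summands and a further factor \<open>N\<close> in
    front of the sum, so this tolerance adds up to \<open>e / 2\<close>.\<close>
  moreover have "e / (2 * (real N)\<^sup>2) > 0" using e N by simp
  ultimately obtain \<delta>3 where \<delta>3: "\<delta>3 > 0" "\<And>z z'. z \<in> K \<times> K \<Longrightarrow> z' \<in> K \<times> K \<Longrightarrow> dist z' z < \<delta>3 \<Longrightarrow>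
      dist (cone_dist2 lam (fst z') (snd z')) (cone_dist2 lam (fst z) (snd z)) < e / (2 * (real N)\<^sup>2)"
    unfolding uniformly_continuous_on_def by metis
  define \<zeta> where "\<zeta> = Min {\<delta>3 / 2, k * m / 8, m / 2, 1}"
  have \<zeta>: "\<zeta> > 0" "2 * \<zeta> \<le> \<delta>3" "\<zeta> \<le> k * m / 8" "\<zeta> \<le> m / 2" "\<zeta> \<le> 1"
    using \<delta>3(1) k m by (auto simp: \<zeta>_def)
  have "\<exists>q. \<forall>u\<in>{0..1}. norm (ev q u - V (t i) u) < \<zeta>" if i: "i \<le> N" for i
  proof -
    have "continuous_on {0..1} (V (t i))"
      unfolding V_def using t[OF i] nz ang
      by (intro continuous_on_cone_path lam \<eta> continuous_ev continuous_intros) auto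
    from smooth_approximation[OF this \<zeta>(1)] show ?thesis by metis
  qed
  then obtain q where q: "\<And>i u. i \<le> N \<Longrightarrow> u \<in> {0..1} \<Longrightarrow> norm (ev (q i) u - V (t i) u) < \<zeta>" by metis
  \<comment> \<open>The end points are kept exactly; there the path already equals \<open>v\<close>
    and \<open>w\<close>.\<close>
  define p where "p i = (if i = 0 then v else if i = N then w else q i)" for i
  have ends: "V (t 0) u = ev v u" "V (t N) u = ev w u" if "u \<in> {0..1}" for u
    using cone_path_endpoints[OF lam \<eta> nz[OF that] ang[OF that]] N(1) by (simp_all add: V_def t_def)
  have p: "norm (ev (p i) u - V (t i) u) < \<zeta>" if "i \<le> N" "u \<in> {0..1}" for i u
    using q[OF that] ends[OF that(2)] \<zeta>(1) by (auto simp: p_def)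
  have pK: "ev (p i) u \<in> K" if "i \<le> N" "u \<in> {0..1}" for i u
    using p[OF that] mM[OF t[OF that(1)] that(2)] \<zeta>(4,5)
      norm_triangle_ineq2[of "ev (p i) u" "V (t i) u"] norm_triangle_ineq2[of "V (t i) u" "ev (p i) u"]
    by (simp add: K_def norm_minus_commute)
  have VK: "V (t i) u \<in> K" if "i \<le> N" "u \<in> {0..1}" for i u
    using mM[OF t[OF that(1)] that(2)] m by (simp add: K_def)
  have pnz: "p i \<in> nonvanishing_maps" if "i \<le> N" for i
    using pK[OF that] m by (force simp: nonvanishing_maps_def K_def)
  have pstep: "norm (ev (p (Suc i)) u - ev (p i) u) \<le> k * norm (ev (p i) u)" if i: "i < N" and u: "u \<in> {0..1}" for i u
  proof -
    have "ev (p (Suc i)) u - ev (p i) u = (ev (p (Suc i)) u - V (t (Suc i)) u) + (V (t (Suc i)) u - V (t i) u) + (V (t i) u - ev (p i) u)"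
      by simp
    also have "norm \<dots> \<le> norm (ev (p (Suc i)) u - V (t (Suc i)) u) + norm (V (t (Suc i)) u - V (t i) u) + norm (V (t i) u - ev (p i) u)"
      by (intro norm_triangle_le add_mono order_refl)
    also have "\<dots> \<le> k * m / 8 + k * m / 8 + k * m / 8"
      using p[of "Suc i" u] p[of i u] Vstep[OF i u] i u \<zeta>(3) by (intro add_mono) (auto simp: norm_minus_commute)
    also have "\<dots> \<le> k * (m / 2)" using k m by (simp add: field_simps)
    also have "\<dots> \<le> k * norm (ev (p i) u)" using pK[of i u] i u k by (intro mult_left_mono) (auto simp: K_def)
    finally show ?thesis .
  qed
  have psum: "real N * (\<Sum>i<N. cone_dist2 lam (ev (p i) u) (ev (p (Suc i)) u)) \<le> cone_dist2 lam (ev v u) (ev w u) + e"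
    if u: "u \<in> {0..1}" for u
  proof -
    have "cone_dist2 lam (ev (p i) u) (ev (p (Suc i)) u) \<le> cone_dist2 lam (V (t i) u) (V (t (Suc i)) u) + e / (2 * (real N)\<^sup>2)"
      if i: "i < N" for i
    proof -
      have "dist (ev (p i) u, ev (p (Suc i)) u) (V (t i) u, V (t (Suc i)) u)
        \<le> norm (ev (p i) u - V (t i) u) + norm (ev (p (Suc i)) u - V (t (Suc i)) u)"
        by (simp add: dist_Pair_Pair sqrt_sum_squares_le_sum flip: dist_norm)
      also have "\<dots> < \<delta>3" using p[of i u] p[of "Suc i" u] i u \<zeta>(2) by simp
      finally show ?thesis
        using \<delta>3(2)[of "(V (t i) u, V (t (Suc i)) u)" "(ev (p i) u, ev (p (Suc i)) u)"] pK VK i u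
        by (simp add: dist_real_def)
    qed
    then have "(\<Sum>i<N. cone_dist2 lam (ev (p i) u) (ev (p (Suc i)) u))
      \<le> (\<Sum>i<N. cone_dist2 lam (V (t i) u) (V (t (Suc i)) u) + e / (2 * (real N)\<^sup>2))"
      by (intro sum_mono) auto
    then have "real N * (\<Sum>i<N. cone_dist2 lam (ev (p i) u) (ev (p (Suc i)) u))
      \<le> real N * ((\<Sum>i<N. cone_dist2 lam (V (t i) u) (V (t (Suc i)) u)) + real N * (e / (2 * (real N)\<^sup>2)))"
      by (intro mult_left_mono) (simp_all add: sum.distrib)
    also have "\<dots> = real N * (\<Sum>i<N. cone_dist2 lam (V (t i) u) (V (t (Suc i)) u)) + e / 2"
      using N by (simp add: field_simps power2_eq_square)
    finally show ?thesis using Vsum[OF u] by simp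
  qed
  have "real N * (\<Sum>i<N. cone_energy lam (p i) (p (Suc i)))
    = integral {0..1} (\<lambda>u. real N * (\<Sum>i<N. cone_dist2 lam (ev (p i) u) (ev (p (Suc i)) u)))"
    unfolding cone_energy_def integral_mult_right
    by (subst integral_sum) (auto intro!: integrable_continuous_real continuous_cone_dist2_ev pnz)
  also have "\<dots> \<le> integral {0..1} (\<lambda>u. cone_dist2 lam (ev v u) (ev w u) + e)"
    by (intro integral_le integrable_continuous_real continuous_intros continuous_cone_dist2_ev v w pnz psum) auto
  also have "\<dots> = cone_energy lam v w + e"
    unfolding cone_energy_def
    by (subst integral_add) (auto intro!: integrable_continuous_real continuous_cone_dist2_ev v w)
  finally have "real N * (\<Sum>i<N. cone_energy lam (p i) (p (Suc i))) \<le> cone_energy lam v w + e" .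
  then show thesis
    by (intro that[of N p] N(1) pnz pstep) (use N(1) in \<open>auto simp: p_def\<close>)
qed

section \<open>The geodesic distance equals the integrated distance\<close>

lemma elastic_form_upper: "elastic_form a b v x \<le> max (a\<^sup>2) (b\<^sup>2) * (norm x)\<^sup>2 / norm v"
proof -
  let ?p = "(v \<bullet> x)\<^sup>2 / (norm v)\<^sup>2"
  have "(v \<bullet> x)\<^sup>2 \<le> (norm v)\<^sup>2 * (norm x)\<^sup>2"
    using Cauchy_Schwarz_ineq[of v x] by (simp add: power2_norm_eq_inner)
  then have "?p \<le> (norm x)\<^sup>2"
    by (cases "v = 0") (auto simp: divide_simps mult.commute)
  then have "a\<^sup>2 * ((norm x)\<^sup>2 - ?p) + b\<^sup>2 * ?p \<le> max (a\<^sup>2) (b\<^sup>2) * ((norm x)\<^sup>2 - ?p) + max (a\<^sup>2) (b\<^sup>2) * ?p"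
    by (intro add_mono mult_right_mono) auto
  also have "\<dots> = max (a\<^sup>2) (b\<^sup>2) * (norm x)\<^sup>2" by (simp add: algebra_simps)
  finally show ?thesis unfolding elastic_form_def by (rule divide_right_mono) simp
qed

lemma antideriv_immersion: "v \<in> nonvanishing_maps \<Longrightarrow> antideriv v \<in> immersions0"
  by (auto simp: immersions0_def antideriv_based D\<^sub>u_antideriv nonvanishing_maps_def)

lemma antideriv_D\<^sub>u: "c \<in> immersions0 \<Longrightarrow> antideriv (D\<^sub>u c) = c"
  by (rule based_eqI) (auto simp: D\<^sub>u_antideriv antideriv_based immersions0_def)

text \<open>The chain leads from \<open>c0'\<close> to a translate of \<open>c1'\<close> that is
  nowhere antiparallel to \<open>c0'\<close>; one more edge leads from there to
  \<open>c1'\<close>.\<close>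

lemma geodesic_dist_le_cone_distance:
  fixes c0 c1 :: "'a::euclidean_space smooth_map"
  assumes a: "a > 0" and b: "b > 0" and c0: "c0 \<in> immersions0" and c1: "c1 \<in> immersions0"
    and generic: "\<And>\<delta>. \<delta> > 0 \<Longrightarrow> \<exists>w. norm w < \<delta> \<and> (\<forall>u\<in>{0..1}. ev (D\<^sub>u c1) u + w \<noteq> 0 \<and> vang (ev (D\<^sub>u c0) u) (ev (D\<^sub>u c1) u + w) < pi)"
  shows "geodesic_dist immersions0 (elastic_metric a b) c0 c1 \<le> ereal (cone_distance a b c0 c1)"
proof (rule ereal_le_epsilon2)
  fix y :: real assume y: "y > 0"
  define lam where "lam = a / (2 * b)"
  have lam: "lam > 0" using a b by (simp add: lam_def)
  define d where "d = cone_distance a b c0 c1"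
  have d: "d \<ge> 0"
    using cone_energy_nonneg[OF D\<^sub>u_immersion[OF c0] D\<^sub>u_immersion[OF c1]] b by (simp add: d_def cone_distance_def)
  \<comment> \<open>The losses are a factor \<open>1 + x\<close> from the polygon and three summands
    \<open>x\<close>: one for aiming at the translate, one for the energy error
    \<open>\<epsilon>\<close>, one for the last edge. For \<open>x \<le> 1\<close> they amount to at
    most \<open>x * (d + 6)\<close>.\<close>
  define x where "x = min 1 (y / (d + 6))"
  have "x \<le> y / (d + 6)" by (simp add: x_def)
  then have x: "0 < x" "x \<le> 1" "x * (d + 6) \<le> y"
    using y d by (simp_all add: pos_le_divide_eq) (simp_all add: x_def)
  have xd: "(1 + x) * (d + 3 * x) \<le> d + y"
  proof -
    have "x * x \<le> x" using x by (simp add: mult_left_le)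
    then show ?thesis using x(3) by (simp add: algebra_simps)
  qed
  obtain k where k: "0 < k" "k < 1" "\<And>N (c :: nat \<Rightarrow> 'a smooth_map). N > 0 \<Longrightarrow>
    (\<And>i. i \<le> N \<Longrightarrow> c i \<in> immersions0) \<Longrightarrow>
    (\<And>i u. i < N \<Longrightarrow> u \<in> {0..1} \<Longrightarrow> norm (ev (D\<^sub>u (c (Suc i))) u - ev (D\<^sub>u (c i)) u) \<le> k * norm (ev (D\<^sub>u (c i)) u)) \<Longrightarrow>
    geodesic_dist immersions0 (elastic_metric a b) (c 0) (c N)
      \<le> ereal ((1 + x) * (\<Sum>i<N. cone_distance a b (c i) (c (Suc i))))"
    using geodesic_dist_polygon[OF x(1) a b] by blast
  obtain k' where k': "0 < k'" "\<And>v w :: 'a. v \<noteq> 0 \<Longrightarrow> norm (w - v) \<le> k' * norm v \<Longrightarrow>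
     2 * b * sqrt (cone_dist2 lam v w) \<le> (1 + 1) * sqrt (elastic_form a b v (w - v))"
    using cone_dist2_local[OF zero_less_one a b lam_def] by metis
  define v0 v1 where "v0 = D\<^sub>u c0" and "v1 = D\<^sub>u c1"
  have v: "v0 \<in> nonvanishing_maps" "v1 \<in> nonvanishing_maps"
    using c0 c1 by (simp_all add: v0_def v1_def D\<^sub>u_immersion)
  obtain m M where m: "0 < m" "\<And>u. u \<in> {0..1} \<Longrightarrow> m \<le> norm (ev v1 u) \<and> norm (ev v1 u) \<le> M"
    using nonvanishing_bounds[OF v(2)] by blast
  define L where "L = max (a\<^sup>2) (b\<^sup>2)"
  have L: "L > 0" using a by (simp add: L_def less_max_iff_disj)
  \<comment> \<open>In this order: the translate keeps norm at least \<open>m / 2\<close>; the last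
    edge satisfies the step condition of the polygon; the local comparison applies to the
    translation; its cost is at most \<open>x\<close>.\<close>
  define \<delta> where "\<delta> = Min {m / 2, k * m / 2, k' * m, x / (2 * sqrt (L / m))}"
  have \<delta>: "\<delta> > 0" "\<delta> \<le> m / 2" "\<delta> \<le> k * m / 2" "\<delta> \<le> k' * m" "\<delta> \<le> x / (2 * sqrt (L / m))"
    using m(1) k(1) k'(1) x(1) L by (auto simp: \<delta>_def)
  obtain z where z: "norm z < \<delta>" "\<And>u. u \<in> {0..1} \<Longrightarrow> ev v1 u + z \<noteq> 0"
      "\<And>u. u \<in> {0..1} \<Longrightarrow> vang (ev v0 u) (ev v1 u + z) < pi"
    using generic[OF \<delta>(1)] by (auto simp: v0_def v1_def)
  obtain zs where zs: "\<And>u. u \<in> {0..1} \<Longrightarrow> ev zs u = z"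
    using smooth_map_of[OF smooth01_const[of z]] by blast
  define w where "w = v1 + zs"
  have ew: "ev w u = ev v1 u + z" if "u \<in> {0..1}" for u using zs[OF that] by (simp add: w_def)
  have w: "w \<in> nonvanishing_maps" using z(2) ew by (simp add: nonvanishing_maps_def)
  define c1' where "c1' = antideriv w"
  have c1': "c1' \<in> immersions0" "D\<^sub>u c1' = w" using w by (simp_all add: c1'_def antideriv_immersion D\<^sub>u_antideriv)
  have near: "cone_distance a b c1 c1' \<le> x"
  proof -
    have "(2 * b)\<^sup>2 * cone_energy lam v1 w = integral {0..1} (\<lambda>u. (2 * b)\<^sup>2 * cone_dist2 lam (ev v1 u) (ev w u))"
      by (simp add: cone_energy_def)
    also have "\<dots> \<le> integral {0..1::real} (\<lambda>u. x\<^sup>2)"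
    proof (intro integral_le integrable_continuous_real continuous_intros continuous_cone_dist2_ev v w)
      fix u :: real assume u: "u \<in> {0..1}"
      have mu: "m \<le> norm (ev v1 u)" using m(2)[OF u] by simp
      have "norm (ev w u - ev v1 u) \<le> k' * m" using z(1) \<delta>(4) by (simp add: ew[OF u])
      also have "\<dots> \<le> k' * norm (ev v1 u)" using mu k'(1) by simp
      finally have "2 * b * sqrt (cone_dist2 lam (ev v1 u) (ev w u)) \<le> 2 * sqrt (elastic_form a b (ev v1 u) z)"
        using k'(2)[of "ev v1 u" "ev w u"] nonvanishing_mapsD[OF v(2) u] by (simp add: ew[OF u])
      also have "sqrt (elastic_form a b (ev v1 u) z) \<le> sqrt (L * (norm z)\<^sup>2 / m)"
      proof (rule real_sqrt_le_mono)
        have "L * (norm z)\<^sup>2 / norm (ev v1 u) \<le> L * (norm z)\<^sup>2 / m"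
          using mu m(1) L by (intro divide_left_mono mult_pos_pos) auto
        then show "elastic_form a b (ev v1 u) z \<le> L * (norm z)\<^sup>2 / m"
          using elastic_form_upper[of a b "ev v1 u" z] by (simp add: L_def)
      qed
      also have "2 * sqrt (L * (norm z)\<^sup>2 / m) = 2 * sqrt (L / m) * norm z"
        by (simp add: real_sqrt_mult real_sqrt_divide)
      also have "\<dots> \<le> 2 * sqrt (L / m) * \<delta>" using z(1) L m(1) by (intro mult_left_mono) auto
      also have "\<dots> \<le> x" using \<delta>(5) L m(1) by (simp add: field_simps)
      finally have "2 * b * sqrt (cone_dist2 lam (ev v1 u) (ev w u)) \<le> x" by simp
      then have "(2 * b * sqrt (cone_dist2 lam (ev v1 u) (ev w u)))\<^sup>2 \<le> x\<^sup>2"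
        using b by (intro power_mono) (auto simp: cone_dist2_nonneg)
      then show "(2 * b)\<^sup>2 * cone_dist2 lam (ev v1 u) (ev w u) \<le> x\<^sup>2"
        by (simp add: power_mult_distrib cone_dist2_nonneg)
    qed
    finally have "(2 * b * sqrt (cone_energy lam v1 w))\<^sup>2 \<le> x\<^sup>2"
      using cone_energy_nonneg[OF v(2) w] by (simp add: power_mult_distrib)
    then have "2 * b * sqrt (cone_energy lam v1 w) \<le> x" by (rule power2_le_imp_le) (use x(1) in simp)
    then show ?thesis by (simp add: cone_distance_def lam_def[symmetric] v1_def[symmetric] c1'(2))
  qed
  \<comment> \<open>So that \<open>2 * b * sqrt \<epsilon> = x\<close>.\<close>
  define \<epsilon> where "\<epsilon> = (x / (2 * b))\<^sup>2"
  have \<epsilon>: "\<epsilon> > 0" using x b by (simp add: \<epsilon>_def)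
  have angw: "vang (ev v0 u) (ev w u) < pi" if "u \<in> {0..1}" for u using z(3)[OF that] unfolding ew[OF that] .
  obtain N p where N: "N > 0" and p: "p 0 = v0" "p N = w" "\<And>i. i \<le> N \<Longrightarrow> p i \<in> nonvanishing_maps"
    "\<And>i u. i < N \<Longrightarrow> u \<in> {0..1} \<Longrightarrow> norm (ev (p (Suc i)) u - ev (p i) u) \<le> k * norm (ev (p i) u)"
    and psum: "real N * (\<Sum>i<N. cone_energy lam (p i) (p (Suc i))) \<le> cone_energy lam v0 w + \<epsilon>"
    using smooth_chain[OF lam v(1) w angw k(1) \<epsilon>] by blast
  \<comment> \<open>The polygon has \<open>Suc N\<close> edges: index \<open>N\<close> is the
    translated curve \<open>c1'\<close>, index \<open>Suc N\<close> is \<open>c1\<close>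
    itself.\<close>
  define c where "c i = (if i \<le> N then antideriv (p i) else c1)" for i
  have c_ends: "c 0 = c0" "c (Suc N) = c1" "c N = c1'"
    using antideriv_D\<^sub>u[OF c0] by (simp_all add: c_def p v0_def c1'_def)
  have "geodesic_dist immersions0 (elastic_metric a b) (c 0) (c (Suc N))
    \<le> ereal ((1 + x) * (\<Sum>i<Suc N. cone_distance a b (c i) (c (Suc i))))"
  proof (rule k(3))
    show "c i \<in> immersions0" if "i \<le> Suc N" for i
      using p(3) c1 by (auto simp: c_def antideriv_immersion)
    fix i and u :: real assume i: "i < Suc N" and u: "u \<in> {0..1}"
    show "norm (ev (D\<^sub>u (c (Suc i))) u - ev (D\<^sub>u (c i)) u) \<le> k * norm (ev (D\<^sub>u (c i)) u)"
    proof (cases "i = N")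
      case True
      have "m - \<delta> \<le> norm (ev w u)"
        using m(2)[OF u] z(1) norm_triangle_ineq2[of "ev v1 u" "- z"] by (simp add: ew[OF u])
      then have "m / 2 \<le> norm (ev w u)" using \<delta>(2) by simp
      then have "k * m / 2 \<le> k * norm (ev w u)" using k(1) by simp
      then have "norm z \<le> k * norm (ev w u)" using z(1) \<delta>(3) by simp
      then show ?thesis by (simp add: True c_ends c1'(2) v1_def[symmetric] ew[OF u])
    next
      case False
      then show ?thesis using i p(4)[of i u] u by (simp add: c_def D\<^sub>u_antideriv)
    qed
  qed simp
  also have "(\<Sum>i<Suc N. cone_distance a b (c i) (c (Suc i))) = (\<Sum>i<N. cone_distance a b (c i) (c (Suc i))) + cone_distance a b c1' c1"
    by (simp add: c_ends)
  also have "(\<Sum>i<N. cone_distance a b (c i) (c (Suc i))) = 2 * b * (\<Sum>i<N. sqrt (cone_energy lam (p i) (p (Suc i))))"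
    by (simp add: sum_distrib_left cone_distance_def c_def D\<^sub>u_antideriv lam_def)
  also have "ereal ((1 + x) * (2 * b * (\<Sum>i<N. sqrt (cone_energy lam (p i) (p (Suc i)))) + cone_distance a b c1' c1))
     \<le> ereal ((1 + x) * (d + 3 * x))"
  proof -
    have "(\<Sum>i<N. sqrt (cone_energy lam (p i) (p (Suc i)))) \<le> sqrt (cone_energy lam v0 w + \<epsilon>)"
    proof (rule real_le_rsqrt)
      \<comment> \<open>The Cauchy-Schwarz inequality turns the bound on \<open>N\<close> times the
        sum of squares into one on the sum of distances; it loses little because the chain is almost
        equally spaced.\<close>
      have "(\<Sum>i<N. sqrt (cone_energy lam (p i) (p (Suc i))))\<^sup>2 \<le> (\<Sum>i<N. (sqrt (cone_energy lam (p i) (p (Suc i))))\<^sup>2) * real (card {..<N})"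
        by (rule sum_squared_le_sum_of_squares)
      also have "\<dots> = real N * (\<Sum>i<N. cone_energy lam (p i) (p (Suc i)))"
        using p(3) by (simp add: cone_energy_nonneg mult.commute)
      finally show "(\<Sum>i<N. sqrt (cone_energy lam (p i) (p (Suc i))))\<^sup>2 \<le> cone_energy lam v0 w + \<epsilon>" using psum by simp
    qed
    also have "\<dots> \<le> sqrt (cone_energy lam v0 w) + sqrt \<epsilon>"
      using cone_energy_nonneg[OF v(1) w] \<epsilon> by (intro sqrt_add_le_add_sqrt) auto
    finally have "2 * b * (\<Sum>i<N. sqrt (cone_energy lam (p i) (p (Suc i)))) \<le> 2 * b * (sqrt (cone_energy lam v0 w) + sqrt \<epsilon>)"
      using b by (intro mult_left_mono) auto
    also have "\<dots> = cone_distance a b c0 c1' + x"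
      using b x by (simp add: cone_distance_def lam_def v0_def c1'(2) \<epsilon>_def distrib_left)
    also have "cone_distance a b c0 c1' \<le> d + x"
      using cone_distance_triangle[OF a b c0 c1 c1'(1)] near by (simp add: d_def)
    finally have "2 * b * (\<Sum>i<N. sqrt (cone_energy lam (p i) (p (Suc i)))) + cone_distance a b c1' c1 \<le> d + 3 * x"
      using near by (simp add: cone_distance_commute)
    then show ?thesis using x(1) by (simp add: mult_left_mono)
  qed
  also have "\<dots> \<le> ereal (d + y)" using xd by simp
  finally show "geodesic_dist immersions0 (elastic_metric a b) c0 c1 \<le> ereal (cone_distance a b c0 c1) + ereal y"
    by (simp add: c_ends d_def)
qed

lemma geodesic_dist_eq_cone_distance:
  fixes c0 c1 :: "'a::euclidean_space smooth_map"
  assumes a: "a > 0" and b: "b > 0" and c0: "c0 \<in> immersions0" and c1: "c1 \<in> immersions0"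
    and generic: "\<And>\<delta>. \<delta> > 0 \<Longrightarrow> \<exists>w. norm w < \<delta> \<and> (\<forall>u\<in>{0..1}. ev (D\<^sub>u c1) u + w \<noteq> 0 \<and> vang (ev (D\<^sub>u c0) u) (ev (D\<^sub>u c1) u + w) < pi)"
  shows "geodesic_dist immersions0 (elastic_metric a b) c0 c1 = ereal (cone_distance a b c0 c1)"
proof (rule antisym)
  show "ereal (cone_distance a b c0 c1) \<le> geodesic_dist immersions0 (elastic_metric a b) c0 c1"
    unfolding geodesic_dist_def
  proof (rule INF_greatest)
    fix \<gamma> assume "\<gamma> \<in> {\<gamma>. piecewise_smooth_path \<gamma> \<and> (\<forall>t\<in>{0..1}. \<gamma> t \<in> immersions0) \<and> \<gamma> 0 = c0 \<and> \<gamma> 1 = c1}"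
    then have "piecewise_smooth_path \<gamma>" "\<And>t. t \<in> {0..1} \<Longrightarrow> \<gamma> t \<in> immersions0" and ends: "\<gamma> 0 = c0" "\<gamma> 1 = c1" by auto
    from cone_distance_le_path_length[OF a b this(1,2)]
    show "ereal (cone_distance a b c0 c1) \<le> ereal (path_length (elastic_metric a b) \<gamma>)" by (simp add: ends)
  qed
qed (rule geodesic_dist_le_cone_distance[OF assms])

section \<open>The explicit formula, near a curve and globally\<close>

lemma srv_angle_eq:
  assumes "c0 \<in> immersions0" "c1 \<in> immersions0" "u \<in> {0..1}"
  shows "srv_angle c0 c1 u = vang (ev (D\<^sub>u c0) u) (ev (D\<^sub>u c1) u)"
proof -
  let ?v = "ev (D\<^sub>u c0) u" and ?w = "ev (D\<^sub>u c1) u"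
  have "?v \<noteq> 0" "?w \<noteq> 0" using assms by (auto simp: immersions0_def)
  then have pos: "sqrt (norm ?v) > 0" "sqrt (norm ?w) > 0" by auto
  have "(?v /\<^sub>R sqrt (norm ?v)) \<bullet> (?w /\<^sub>R sqrt (norm ?w)) = (?v \<bullet> ?w) / (sqrt (norm ?v) * sqrt (norm ?w))"
    by (simp add: divide_inverse mult_ac)
  moreover have "norm (?v /\<^sub>R sqrt (norm ?v)) * norm (?w /\<^sub>R sqrt (norm ?w)) = norm ?v * norm ?w / (sqrt (norm ?v) * sqrt (norm ?w))"
    by (simp add: divide_inverse mult_ac)
  ultimately show ?thesis
    using pos by (simp add: srv_angle_def vang_def ev_SRVT assms(1,2))
qed

text \<open>The squared radii are \<open>|c'|\<close> and integrate to the lengths. The bound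
  \<open>2 * b * pi / a\<close> is \<open>pi / lam\<close>, so cutting \<open>\<theta>\<close> there
  is cutting \<open>lam * \<theta>\<close> at \<open>pi\<close>.\<close>

lemma cone_distance_formula:
  assumes "a > 0" "b > 0" "c0 \<in> immersions0" "c1 \<in> immersions0"
  shows "cone_distance a b c0 c1 = 2 * b * sqrt (curve_length c0 + curve_length c1
     - 2 * integral {0..1} (\<lambda>u. sqrt (norm (ev (D\<^sub>u c0) u) * norm (ev (D\<^sub>u c1) u))
         * cos (a / (2 * b) * min (srv_angle c0 c1 u) (2 * b * pi / a))))"
proof -
  let ?v = "ev (D\<^sub>u c0)" and ?w = "ev (D\<^sub>u c1)" and ?lam = "a / (2 * b)"
  let ?f = "\<lambda>u. sqrt (norm (?v u) * norm (?w u)) * cos (min (?lam * vang (?v u) (?w u)) pi)"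
  have lam: "?lam > 0" using assms by simp
  have nz: "?v u \<noteq> 0" "?w u \<noteq> 0" if "u \<in> {0..1}" for u
    using that assms(3,4) by (auto simp: immersions0_def)
  have i: "(\<lambda>u. norm (?v u)) integrable_on {0..1}" "(\<lambda>u. norm (?w u)) integrable_on {0..1}"
    by (intro integrable_continuous_real continuous_intros order_refl)+
  have f: "?f integrable_on {0..1}"
    unfolding vang_def using nz
    by (intro integrable_continuous_real continuous_intros ballI conjI inner_quotient_bound order_refl) auto
  have "cone_energy ?lam (D\<^sub>u c0) (D\<^sub>u c1) = integral {0..1} (\<lambda>u. norm (?v u) + norm (?w u) - 2 * ?f u)"
    unfolding cone_energy_def cone_dist2_def by (simp add: mult.assoc)
  also have "\<dots> = curve_length c0 + curve_length c1 - 2 * integral {0..1} ?f"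
    unfolding curve_length_def using i f
    by (subst integral_diff) (auto simp: integral_add intro!: integrable_add integrable_on_mult_right)
  also have "integral {0..1} ?f = integral {0..1} (\<lambda>u. sqrt (norm (?v u) * norm (?w u))
         * cos (?lam * min (srv_angle c0 c1 u) (2 * b * pi / a)))"
  proof (rule integral_cong)
    fix u :: real assume u: "u \<in> {0..1}"
    have "?lam * min (srv_angle c0 c1 u) (2 * b * pi / a) = min (?lam * srv_angle c0 c1 u) (?lam * (2 * b * pi / a))"
      using lam by (simp only: min_mult_distrib_left if_True order.strict_implies_order)
    also have "?lam * (2 * b * pi / a) = pi" using assms(1,2) by simp
    finally show "?f u = sqrt (norm (?v u) * norm (?w u)) * cos (?lam * min (srv_angle c0 c1 u) (2 * b * pi / a))"
      by (simp add: srv_angle_eq[OF assms(3,4) u])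
  qed
  finally show ?thesis by (simp add: cone_distance_def)
qed

lemma vang_small:
  assumes "\<rho> > 0"
  obtains k where "k > 0" "\<And>v w :: 'a::real_inner. v \<noteq> 0 \<Longrightarrow> w \<noteq> 0 \<Longrightarrow> norm (w - v) \<le> k * norm v \<Longrightarrow> vang v w < \<rho>"
proof -
  define r where "r = min \<rho> pi"
  have r: "0 < r" "r \<le> pi" using assms by (auto simp: r_def)
  have "cos r < cos 0" using r by (intro cos_monotone_0_pi) auto
  then have c: "1 - cos r > 0" by simp
  \<comment> \<open>Unit vectors at angle \<open>\<alpha>\<close> have squared distance
    \<open>2 - 2 * cos \<alpha>\<close>, and normalizing at most doubles the relative distance. With
    \<open>4 * k\<^sup>2 = 1 - cos r\<close> this leaves half of the allowed
    \<open>2 - 2 * cos r\<close> as a margin for strictness.\<close>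
  define k where "k = sqrt ((1 - cos r) / 4)"
  have k: "k > 0" "4 * k\<^sup>2 = 1 - cos r" using c by (simp_all add: k_def)
  show thesis
  proof (rule that[OF k(1)])
    fix v w :: 'a assume vw: "v \<noteq> 0" "w \<noteq> 0" "norm (w - v) \<le> k * norm v"
    let ?x = "v /\<^sub>R norm v" and ?y = "w /\<^sub>R norm w"
    have "norm (?y - ?x) \<le> 2 * norm (w - v) / norm v" by (rule norm_normalized_diff[OF vw(1,2)])
    also have "\<dots> \<le> 2 * k" using vw by (simp add: divide_le_eq)
    finally have "norm (?y - ?x) \<le> 2 * k" .
    then have "(norm (?y - ?x))\<^sup>2 \<le> (2 * k)\<^sup>2" by (intro power_mono) auto
    moreover have "(norm (?y - ?x))\<^sup>2 = 2 - 2 * cos (vang v w)"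
    proof -
      have "?x \<bullet> ?x = 1" "?y \<bullet> ?y = 1" using vw by (simp_all add: dot_square_norm power2_eq_square)
      moreover have "?x \<bullet> ?y = cos (vang v w)" by (simp add: cos_vang divide_inverse mult_ac)
      ultimately show ?thesis
        unfolding power2_norm_eq_inner inner_diff_left inner_diff_right inner_commute[of ?y ?x] by simp
    qed
    ultimately have "cos r < cos (vang v w)" using k c by (simp add: power_mult_distrib)
    then have "vang v w < r" using cos_monotone_0_pi_le[of r "vang v w"] vang_bounds(2)[of v w] r(1) by linarith
    then show "vang v w < \<rho>" by (simp add: r_def)
  qed
qed

text \<open>As in \<open>tendsto_iff_Ck_lim\<close>, the margin \<open>r < e\<close> gives openness
  by the triangle inequality.\<close>

lemma open_C1_neighbourhood:
  "open {c :: 'a::real_normed_vector smooth_map. \<exists>r<e. \<forall>u\<in>{0..1}. norm (ev (D\<^sub>u c) u - ev v u) \<le> r}"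
  (is "open ?W")
  unfolding open_smooth_map_def
proof
  fix c assume "c \<in> ?W"
  then obtain r where r: "r < e" "\<forall>u\<in>{0..1}. norm (ev (D\<^sub>u c) u - ev v u) \<le> r" by auto
  have "C_ball 1 c ((e - r) / 2) \<subseteq> ?W"
  proof
    fix g assume g: "g \<in> C_ball 1 c ((e - r) / 2)"
    have "norm (ev (D\<^sub>u g) u - ev v u) \<le> (e + r) / 2" if u: "u \<in> {0..1}" for u
    proof -
      have "dist (ev (D\<^sub>u c) u) (ev (D\<^sub>u g) u) < (e - r) / 2"
        using g u unfolding C_ball_def by fastforce
      then have "norm (ev (D\<^sub>u g) u - ev (D\<^sub>u c) u) < (e - r) / 2" by (simp add: dist_norm norm_minus_commute)
      moreover have "norm (ev (D\<^sub>u g) u - ev v u) \<le> norm (ev (D\<^sub>u g) u - ev (D\<^sub>u c) u) + norm (ev (D\<^sub>u c) u - ev v u)"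
        using norm_triangle_ineq[of "ev (D\<^sub>u g) u - ev (D\<^sub>u c) u" "ev (D\<^sub>u c) u - ev v u"] by simp
      moreover have "norm (ev (D\<^sub>u c) u - ev v u) \<le> r" using r(2) u by blast
      moreover have "(e - r) / 2 + r = (e + r) / 2" by (simp add: field_simps)
      ultimately show ?thesis by linarith
    qed
    moreover have "(e + r) / 2 < e" using r(1) by simp
    ultimately show "g \<in> ?W" by blast
  qed
  then show "\<exists>k. \<exists>\<epsilon>>0. C_ball k c \<epsilon> \<subseteq> ?W" using r(1) by (intro exI[of _ 1] exI[of _ "(e - r) / 2"]) auto
qed

lemma geodesic_dist_local:
  fixes c0 :: "'a::euclidean_space smooth_map"
  assumes a: "a > 0" and b: "b > 0" and c0: "c0 \<in> immersions0"
  shows "\<exists>U. openin (top_of_set immersions0) U \<and> c0 \<in> U \<and>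
          (\<forall>c1\<in>U.
             geodesic_dist immersions0 (elastic_metric a b) c0 c1 =
             ereal (2 * b * sqrt (curve_length c0 + curve_length c1
               - 2 * integral {0..1} (\<lambda>u. sqrt (norm (ev (D\<^sub>u c0) u) * norm (ev (D\<^sub>u c1) u))
                   * cos (a / (2 * b) * srv_angle c0 c1 u)))))"
proof -
  \<comment> \<open>Angles below \<open>pi\<close> rule out antiparallel derivatives, so the
    translation 0 is admissible; angles below \<open>2 * b * pi / a\<close> make the cut-off in the
    formula inactive.\<close>
  have "min pi (2 * b * pi / a) > 0" using a b by simp
  then obtain k where k: "k > 0" "\<And>v w :: 'a. v \<noteq> 0 \<Longrightarrow> w \<noteq> 0 \<Longrightarrow> norm (w - v) \<le> k * norm v \<Longrightarrow> vang v w < min pi (2 * b * pi / a)"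
    using vang_small by blast
  obtain m M where m: "0 < m" "\<And>u. u \<in> {0..1} \<Longrightarrow> m \<le> norm (ev (D\<^sub>u c0) u) \<and> norm (ev (D\<^sub>u c0) u) \<le> M"
    using nonvanishing_bounds[OF D\<^sub>u_immersion[OF c0]] by blast
  define W where "W = {c. \<exists>r<k * m. \<forall>u\<in>{0..1}. norm (ev (D\<^sub>u c) u - ev (D\<^sub>u c0) u) \<le> r}"
  show ?thesis
  proof (intro exI[of _ "immersions0 \<inter> W"] conjI ballI)
    show "openin (top_of_set immersions0) (immersions0 \<inter> W)"
      unfolding W_def by (intro openin_open_Int open_C1_neighbourhood)
    show "c0 \<in> immersions0 \<inter> W" using c0 k(1) m(1) by (auto simp: W_def intro!: exI[of _ 0])
    fix c1 assume "c1 \<in> immersions0 \<inter> W"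
    then obtain r where c1: "c1 \<in> immersions0" and r: "r < k * m" "\<forall>u\<in>{0..1}. norm (ev (D\<^sub>u c1) u - ev (D\<^sub>u c0) u) \<le> r"
      by (auto simp: W_def)
    have close: "norm (ev (D\<^sub>u c1) u - ev (D\<^sub>u c0) u) \<le> k * m" if "u \<in> {0..1}" for u
      using bspec[OF r(2) that] r(1) by linarith
    have nz: "ev (D\<^sub>u c0) u \<noteq> 0" "ev (D\<^sub>u c1) u \<noteq> 0" if "u \<in> {0..1}" for u
      using that c0 c1 by (auto simp: immersions0_def)
    have ang: "vang (ev (D\<^sub>u c0) u) (ev (D\<^sub>u c1) u) < min pi (2 * b * pi / a)" if u: "u \<in> {0..1}" for u
    proof -
      have "k * m \<le> k * norm (ev (D\<^sub>u c0) u)" using m(2)[OF u] k(1) by simp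
      then show ?thesis using k(2)[OF nz[OF u]] close[OF u] by simp
    qed
    have "geodesic_dist immersions0 (elastic_metric a b) c0 c1 = ereal (cone_distance a b c0 c1)"
      using nz ang by (intro geodesic_dist_eq_cone_distance[OF a b c0 c1] exI[of _ 0]) auto
    also have "cone_distance a b c0 c1 = 2 * b * sqrt (curve_length c0 + curve_length c1
               - 2 * integral {0..1} (\<lambda>u. sqrt (norm (ev (D\<^sub>u c0) u) * norm (ev (D\<^sub>u c1) u))
                   * cos (a / (2 * b) * srv_angle c0 c1 u)))"
    proof -
      have "integral {0..1} (\<lambda>u. sqrt (norm (ev (D\<^sub>u c0) u) * norm (ev (D\<^sub>u c1) u))
                   * cos (a / (2 * b) * min (srv_angle c0 c1 u) (2 * b * pi / a)))
        = integral {0..1} (\<lambda>u. sqrt (norm (ev (D\<^sub>u c0) u) * norm (ev (D\<^sub>u c1) u))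
                   * cos (a / (2 * b) * srv_angle c0 c1 u))"
      proof (rule integral_cong)
        fix u :: real assume u: "u \<in> {0..1}"
        have "min (srv_angle c0 c1 u) (2 * b * pi / a) = srv_angle c0 c1 u"
          using ang[OF u] by (simp add: srv_angle_eq[OF c0 c1 u])
        then show "sqrt (norm (ev (D\<^sub>u c0) u) * norm (ev (D\<^sub>u c1) u)) * cos (a / (2 * b) * min (srv_angle c0 c1 u) (2 * b * pi / a))
          = sqrt (norm (ev (D\<^sub>u c0) u) * norm (ev (D\<^sub>u c1) u)) * cos (a / (2 * b) * srv_angle c0 c1 u)" by simp
      qed
      then show ?thesis by (simp only: cone_distance_formula[OF a b c0 c1])
    qed
    finally show "geodesic_dist immersions0 (elastic_metric a b) c0 c1 = \<dots>" .
  qed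
qed

text \<open>
  The excluded translations \<open>s f(u) - g(u)\<close> form the image of a two-dimensional set, hence a null set.
\<close>

lemma generic_translation:
  fixes f g :: "real \<Rightarrow> 'a::euclidean_space"
  assumes "DIM('a) \<ge> 3" "f differentiable_on {0..1}" "g differentiable_on {0..1}" "\<delta> > 0"
  shows "\<exists>w. norm w < \<delta> \<and> (\<forall>s. \<forall>u\<in>{0..1}. g u + w \<noteq> s *\<^sub>R f u)"
proof -
  let ?F = "\<lambda>z::real \<times> real. fst z *\<^sub>R f (snd z) - g (snd z)"
  let ?S = "UNIV \<times> {0..1::real}"
  have snd: "(\<lambda>z :: real \<times> real. h (snd z)) differentiable_on ?S" if h: "h differentiable_on {0..1}" for h :: "real \<Rightarrow> 'a"
    unfolding differentiable_on_def
  proof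
    fix z :: "real \<times> real" assume z: "z \<in> ?S"
    have "h differentiable at (snd z) within snd ` ?S"
      using h z by (auto simp: differentiable_on_def)
    moreover have "snd differentiable at z within ?S"
      by (intro bounded_linear_imp_differentiable bounded_linear_snd)
    ultimately have "(h \<circ> snd) differentiable at z within ?S"
      by (intro differentiable_chain_within)
    then show "(\<lambda>z. h (snd z)) differentiable at z within UNIV \<times> {0..1::real}" by (simp add: o_def)
  qed
  have "?F differentiable_on ?S"
    by (intro differentiable_on_diff differentiable_on_scaleR snd assms bounded_linear_imp_differentiable_on bounded_linear_fst)
  then have "negligible (?F ` ?S)"
    using assms(1) by (intro negligible_differentiable_image_lowdim) auto
  then have "\<not> ball 0 \<delta> \<subseteq> ?F ` ?S"
    using assms(4) negligible_subset open_not_negligible[of "ball (0::'a) \<delta>"] by auto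
  then obtain w where w: "w \<in> ball 0 \<delta>" "w \<notin> ?F ` ?S" by blast
  have "g u + w \<noteq> s *\<^sub>R f u" if u: "u \<in> {0..1}" for s u
  proof
    assume "g u + w = s *\<^sub>R f u"
    then have "w = ?F (s, u)" by (simp add: algebra_simps)
    then show False using w(2) u by blast
  qed
  then show ?thesis using w(1) by auto
qed

lemma antiparallel_if_vang_eq_pi:
  fixes v w :: "'a::real_inner"
  assumes "vang v w = pi" "v \<noteq> 0"
  shows "\<exists>s. w = s *\<^sub>R v"
proof (cases "w = 0")
  case False
  have "(v \<bullet> w) / (norm v * norm w) = - 1" using assms(1) unfolding cos_vang[symmetric] by simp
  then have "v \<bullet> w = - (norm v * norm w)" using assms(2) False by (simp add: divide_eq_eq)
  then have "v \<bullet> (- w) = norm v * norm (- w)" by simp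
  then have "norm v *\<^sub>R (- w) = norm (- w) *\<^sub>R v" by (simp only: norm_cauchy_schwarz_eq)
  then have "(- 1 / norm v) *\<^sub>R (norm v *\<^sub>R (- w)) = (- 1 / norm v) *\<^sub>R (norm w *\<^sub>R v)" by (simp only: norm_minus_cancel)
  then have "w = (- norm w / norm v) *\<^sub>R v" using assms(2) by simp
  then show ?thesis by blast
qed (auto intro: exI[of _ 0])

text \<open>Moving \<open>c1'\<close> off the whole line spanned by \<open>c0'\<close> handles both
  requirements at once: multiple 0 for vanishing, negative multiples for antiparallel
  directions.\<close>

lemma geodesic_dist_global:
  fixes c0 c1 :: "'a::euclidean_space smooth_map"
  assumes "DIM('a) \<ge> 3" and a: "a > 0" and b: "b > 0" and c0: "c0 \<in> immersions0" and c1: "c1 \<in> immersions0"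
  shows "geodesic_dist immersions0 (elastic_metric a b) c0 c1 = ereal (cone_distance a b c0 c1)"
proof (rule geodesic_dist_eq_cone_distance[OF a b c0 c1])
  fix \<delta> :: real assume "\<delta> > 0"
  have diff: "ev f differentiable_on {0..1}" for f :: "'a smooth_map"
    unfolding differentiable_on_def using ev_D\<^sub>u differentiableI_vector by blast
  obtain w where w: "norm w < \<delta>" "\<And>s u. u \<in> {0..1} \<Longrightarrow> ev (D\<^sub>u c1) u + w \<noteq> s *\<^sub>R ev (D\<^sub>u c0) u"
    using generic_translation[OF assms(1) diff diff \<open>\<delta> > 0\<close>] by blast
  have "ev (D\<^sub>u c1) u + w \<noteq> 0 \<and> vang (ev (D\<^sub>u c0) u) (ev (D\<^sub>u c1) u + w) < pi" if u: "u \<in> {0..1}" for u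
  proof
    show "ev (D\<^sub>u c1) u + w \<noteq> 0" using w(2)[OF u, of 0] by simp
    have "ev (D\<^sub>u c0) u \<noteq> 0" using c0 u by (auto simp: immersions0_def)
    then have "vang (ev (D\<^sub>u c0) u) (ev (D\<^sub>u c1) u + w) \<noteq> pi"
      using antiparallel_if_vang_eq_pi w(2)[OF u] by blast
    then show "vang (ev (D\<^sub>u c0) u) (ev (D\<^sub>u c1) u + w) < pi"
      using vang_bounds(2)[of "ev (D\<^sub>u c0) u" "ev (D\<^sub>u c1) u + w"] by linarith
  qed
  then show "\<exists>w. norm w < \<delta> \<and> (\<forall>u\<in>{0..1}. ev (D\<^sub>u c1) u + w \<noteq> 0 \<and> vang (ev (D\<^sub>u c0) u) (ev (D\<^sub>u c1) u + w) < pi)"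
    using w(1) by blast
qed

theorem theorem2p1:
  fixes a b lam :: real
  assumes "CARD('n::finite) \<ge> 2" and "a > 0" and "b > 0" and "lam = a / (2 * b)"
  shows
    "riemannian_isometry
       based_maps (immersions0 :: (real ^ 'n) smooth_map set) (elastic_metric a b)
       UNIV nonvanishing_maps (\<lambda>q h k. 4 * b\<^sup>2 * L2_metric lam q h k)
       SRVT
     \<and>
     (\<forall>c0 \<in> (immersions0 :: (real ^ 'n) smooth_map set).
        \<exists>U. openin (top_of_set immersions0) U \<and> c0 \<in> U \<and>
          (\<forall>c1\<in>U.
             geodesic_dist immersions0 (elastic_metric a b) c0 c1 =
             ereal (2 * b * sqrt (curve_length c0 + curve_length c1
               - 2 * integral {0..1} (\<lambda>u. sqrt (norm (ev (D\<^sub>u c0) u) * norm (ev (D\<^sub>u c1) u))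
                   * cos (a / (2 * b) * srv_angle c0 c1 u))))))
     \<and>
     (CARD('n) \<ge> 3 \<longrightarrow>
       (\<forall>c0 \<in> (immersions0 :: (real ^ 'n) smooth_map set). \<forall>c1 \<in> immersions0.
          geodesic_dist immersions0 (elastic_metric a b) c0 c1 =
          ereal (2 * b * sqrt (curve_length c0 + curve_length c1
            - 2 * integral {0..1} (\<lambda>u. sqrt (norm (ev (D\<^sub>u c0) u) * norm (ev (D\<^sub>u c1) u))
                * cos (a / (2 * b) * min (srv_angle c0 c1 u) (2 * b * pi / a)))))))"
proof (intro conjI impI ballI)
  show "riemannian_isometry
       based_maps (immersions0 :: (real ^ 'n) smooth_map set) (elastic_metric a b)
       UNIV nonvanishing_maps (\<lambda>q h k. 4 * b\<^sup>2 * L2_metric lam q h k)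
       SRVT"
    using assms(2-4) by (rule riemannian_isometry_SRVT)
next
  fix c0 :: "(real ^ 'n) smooth_map" assume "c0 \<in> immersions0"
  then show "\<exists>U. openin (top_of_set immersions0) U \<and> c0 \<in> U \<and>
          (\<forall>c1\<in>U.
             geodesic_dist immersions0 (elastic_metric a b) c0 c1 =
             ereal (2 * b * sqrt (curve_length c0 + curve_length c1
               - 2 * integral {0..1} (\<lambda>u. sqrt (norm (ev (D\<^sub>u c0) u) * norm (ev (D\<^sub>u c1) u))
                   * cos (a / (2 * b) * srv_angle c0 c1 u)))))"
    by (rule geodesic_dist_local[OF assms(2,3)])
next
  fix c0 c1 :: "(real ^ 'n) smooth_map"
  assume "CARD('n) \<ge> 3" and c: "c0 \<in> immersions0" "c1 \<in> immersions0"
  then have "DIM(real ^ 'n) \<ge> 3" by simp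
  from geodesic_dist_global[OF this assms(2,3) c]
  show "geodesic_dist immersions0 (elastic_metric a b) c0 c1 =
          ereal (2 * b * sqrt (curve_length c0 + curve_length c1
            - 2 * integral {0..1} (\<lambda>u. sqrt (norm (ev (D\<^sub>u c0) u) * norm (ev (D\<^sub>u c1) u))
                * cos (a / (2 * b) * min (srv_angle c0 c1 u) (2 * b * pi / a)))))"
    unfolding cone_distance_formula[OF assms(2,3) c] .
qed

end
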